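(* Fix the dimension $d$ as a constant. Let $\Omega \subset \mathbb{R}^d$ be a convex polytope of unit diameter with nonempty interior, given as the intersection of $n$ halfspaces, and let $\varepsilon > 0$. Then there exists a smooth function $\widetilde{d}_{\Omega}$ satisfying $$d_{\Omega}(x) \leq \widetilde{d}_{\Omega}(x) \leq d_{\Omega}(x) + \varepsilon \cdot \mathrm{diam}(\Omega) \quad \text{for all } x \in \Omega,$$ such that $\widetilde{d}_{\Omega}(x)$ together with its gradient $\nabla \widetilde{d}_{\Omega}(x)$ can be evaluated for any query point $x \in \Omega$ from a data structure with query time $O(\log(1/\varepsilon))$ and storage $O(1/\varepsilon^{d/2})$. Further, for all $x$ the norms of the gradient and Hessian satisfy $$\|\nabla \widetilde{d}_{\Omega}(x)\| = O(1) \qquad\text{and}\qquad \|\nabla^2 \widetilde{d}_{\Omega}(x)\| = O(1/\varepsilon).$$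
   Context: $\partial\Omega$ denotes the boundary of $\Omega$ and $d_{\Omega}(x) = \inf_{y \in \partial \Omega}\|x - y\|$ is the Euclidean distance from $x \in \Omega$ to the boundary of $\Omega$ (the boundary distance function). $\mathrm{diam}(\Omega)$ is the diameter of $\Omega$. The parameter $\varepsilon$ is treated as an asymptotic quantity and the dimension $d$ as a constant; the constants hidden in the $O$-notation depend only on $d$ (not on $\varepsilon$ or $n$). *)

theory Defs
  imports "HOL-Analysis.Analysis"
begin

definition axisv :: "'n::finite \<Rightarrow> real^'n" where
  "axisv i = axis i 1"

fun ipartial :: "'n::finite list \<Rightarrow> (real^'n \<Rightarrow> real) \<Rightarrow> real^'n \<Rightarrow> real" where
  "ipartial [] f = f"
| "ipartial (k # ks) f = (\<lambda>x. deriv (\<lambda>t. ipartial ks f (x + t *\<^sub>R axisv k)) 0)"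

definition smooth_on :: "(real^'n::finite \<Rightarrow> real) \<Rightarrow> (real^'n) set \<Rightarrow> bool" where
  "smooth_on f U \<longleftrightarrow> open U \<and>
     (\<forall>ks. continuous_on U (ipartial ks f) \<and>
       (\<forall>k. \<forall>x\<in>U. ((\<lambda>t. ipartial ks f (x + t *\<^sub>R axisv k)) has_real_derivative
                      ipartial (k # ks) f x) (at 0)))"

definition grad :: "(real^'n::finite \<Rightarrow> real) \<Rightarrow> real^'n \<Rightarrow> real^'n" where
  "grad f x = (\<chi> i. ipartial [i] f x)"

definition hessian :: "(real^'n::finite \<Rightarrow> real) \<Rightarrow> real^'n \<Rightarrow> real^'n^'n" where
  "hessian f x = (\<chi> i j. ipartial [i, j] f x)"

definition hess_norm :: "(real^'n::finite \<Rightarrow> real) \<Rightarrow> real^'n \<Rightarrow> real" where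
  "hess_norm f x = onorm (\<lambda>v. hessian f x *v v)"

definition bdist :: "(real^'n::finite) set \<Rightarrow> real^'n \<Rightarrow> real" where
  "bdist \<Omega> x = infdist x (frontier \<Omega>)"

definition halfspace_inter :: "nat \<Rightarrow> (nat \<Rightarrow> real^'n::finite) \<Rightarrow> (nat \<Rightarrow> real) \<Rightarrow> (real^'n) set" where
  "halfspace_inter n a b = {x. \<forall>i<n. a i \<bullet> x \<le> b i}"

datatype bop = Add | Sub | Mul | Div
datatype uop = Sqrt | Exp | Ln

text \<open>A query structure is a finite tree. Each internal node appends one new register
  (a stored real constant, an input coordinate, or the result of an arithmetic operation on
  existing registers) or branches on the sign of a register; leaves name the registers holding
  the function value and the gradient coordinates. Query time = depth; storage = number of nodes
  (this includes all stored real constants).\<close>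
datatype 'n ctree =
    Out nat "'n \<Rightarrow> nat"
  | Cst real "'n ctree"
  | Inp 'n "'n ctree"
  | Bin bop nat nat "'n ctree"
  | Una uop nat "'n ctree"
  | Branch nat "'n ctree" "'n ctree"

definition reg :: "real list \<Rightarrow> nat \<Rightarrow> real" where
  "reg rs i = (if i < length rs then rs ! i else 0)"

fun bop_sem :: "bop \<Rightarrow> real \<Rightarrow> real \<Rightarrow> real" where
  "bop_sem Add u v = u + v"
| "bop_sem Sub u v = u - v"
| "bop_sem Mul u v = u * v"
| "bop_sem Div u v = u / v"

fun uop_sem :: "uop \<Rightarrow> real \<Rightarrow> real" where
  "uop_sem Sqrt u = sqrt u"
| "uop_sem Exp u = exp u"
| "uop_sem Ln u = ln u"

primrec ct_eval :: "'n::finite ctree \<Rightarrow> real^'n \<Rightarrow> real list \<Rightarrow> real \<times> (real^'n)" where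
  "ct_eval (Out v g) x rs = (reg rs v, \<chi> i. reg rs (g i))"
| "ct_eval (Cst c t) x rs = ct_eval t x (rs @ [c])"
| "ct_eval (Inp i t) x rs = ct_eval t x (rs @ [x $ i])"
| "ct_eval (Bin o' i j t) x rs = ct_eval t x (rs @ [bop_sem o' (reg rs i) (reg rs j)])"
| "ct_eval (Una u i t) x rs = ct_eval t x (rs @ [uop_sem u (reg rs i)])"
| "ct_eval (Branch i t1 t2) x rs = (if reg rs i \<le> 0 then ct_eval t1 x rs else ct_eval t2 x rs)"

definition query :: "'n::finite ctree \<Rightarrow> real^'n \<Rightarrow> real \<times> (real^'n)" where
  "query t x = ct_eval t x []"

primrec ct_depth :: "'n ctree \<Rightarrow> nat" where
  "ct_depth (Out v g) = 0"
| "ct_depth (Cst c t) = Suc (ct_depth t)"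
| "ct_depth (Inp i t) = Suc (ct_depth t)"
| "ct_depth (Bin o' i j t) = Suc (ct_depth t)"
| "ct_depth (Una u i t) = Suc (ct_depth t)"
| "ct_depth (Branch i t1 t2) = Suc (max (ct_depth t1) (ct_depth t2))"

primrec ct_size :: "'n ctree \<Rightarrow> nat" where
  "ct_size (Out v g) = 1"
| "ct_size (Cst c t) = Suc (ct_size t)"
| "ct_size (Inp i t) = Suc (ct_size t)"
| "ct_size (Bin o' i j t) = Suc (ct_size t)"
| "ct_size (Una u i t) = Suc (ct_size t)"
| "ct_size (Branch i t1 t2) = Suc (ct_size t1 + ct_size t2)"

end

theory Submission
  imports Defs "HOL-Library.Countable"
begin

text \<open>The boundary distance on \<open>\<Omega>\<close> is minus a convex function \<open>\<phi>\<close>, a maximum of affine functions with unit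
  slopes.  Where the symmetric second difference of \<open>\<phi>\<close> at \<open>x\<close> is at most \<open>\<delta>\<close>, a supporting affine
  function at \<open>x\<close> approximates \<open>\<phi>\<close> up to \<open>\<delta>\<close>; this Macbeath region is comparable to an ellipsoid, by
  Auerbach's lemma.  A maximal separated set of such ellipsoids covers \<open>\<Omega>\<close> with bounded overlap, and
  blending the affine functions with bump functions of the ellipsoids of level \<open>\<delta> \<approx> \<epsilon>\<close> gives the smooth
  approximation.

  A query descends through nets of levels \<open>1, 1/B, 1/B\<^sup>2, \<dots>\<close>, moving between ellipsoids that
  meet.  As the structure is a tree, an ellipsoid is stored once for every descending path to it,
  and the number of paths grows by a factor \<open>m\<close>, independent of \<open>B\<close>, per level.  This is paid for by a
  count better than \<open>\<delta> powr (-d/2)\<close>: a net of level \<open>\<delta>\<close> has at most \<open>C * \<delta> powr (1/8 - d/2)\<close> points, so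
  that \<open>B = m ^ 8\<close> suffices.  The count compares each ellipsoid with a box of dual volume inside the
  \<open>\<delta>\<close>-subdifferential.  Since all gradients of \<open>\<phi>\<close> have norm \<open>1\<close>, either the box lies in a thin
  shell at the unit sphere, or the ellipsoid lies where \<open>\<phi>\<close> bends, a set of small volume.\<close>

section \<open>Smooth expressions and their symbolic derivatives\<close>

text \<open>The plain count comes from volumes. An ellipsoid and its dual box have volume product c
  * \<delta>^d; suitably shrunk ellipsoids are disjoint inside a fixed ball, and the boxes overlap
  boundedly inside the unit ball, so the arithmetic-geometric mean inequality gives
  O(\<delta>^(-d/2)). With a shell of width about \<tau>, the two cases save the factors sqrt \<tau>
  and sqrt \<delta> / \<tau>; taking \<tau> of order s^2 with s = \<delta>^(1/8) makes both O(s) and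
  keeps the arithmetic to integer powers of s. On the smooth side the obstacle is that bump
  functions of level \<delta> may have second derivatives of order 1/\<delta>^2. Near a net point
  the blend is therefore written as one affine function plus weighted differences of affine
  functions. These differences are O(\<delta>) there, which turns 1/\<delta> and 1/\<delta>^2 into
  O(1) and O(1/\<delta>). The function \<phi> is a supremum over all unit vectors rather than over
  facet normals, so that its growth at infinity, and with it every constant, is independent of the
  halfspaces.\<close>

definition bump :: "nat \<Rightarrow> real \<Rightarrow> real" where
  "bump n t = (if t > 0 then exp (- (1 / t)) / t ^ n else 0)"

lemma bump_nonneg: "0 \<le> bump n t"
  by (simp add: bump_def)

lemma power_le_fact_exp:
  fixes u :: real
  assumes "0 \<le> u"
  shows "u ^ n \<le> fact n * exp u"
proof -
  have "u ^ n / fact n \<le> (\<Sum>i\<le>n. u ^ i / fact i)"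
    using assms by (intro member_le_sum) auto
  also have "\<dots> = (\<Sum>i<Suc n. u ^ i / fact i)"
    by (simp add: lessThan_Suc_atMost)
  also have "\<dots> \<le> (\<Sum>i. u ^ i / fact i)"
    using assms summable_exp[of u] by (intro sum_le_suminf) (auto simp: field_simps)
  also have "\<dots> = exp u"
    by (simp add: exp_def field_simps scaleR_conv_of_real)
  finally show ?thesis by (simp add: field_simps)
qed

text \<open>This is \<open>power_le_fact_exp\<close> at 1/t: bump functions vanish to every order at
  0. The case k = 2 yields the derivative there, k = 0 the uniform bound n!.\<close>

lemma bump_le: 
  assumes "0 < t"
  shows "bump n t \<le> fact (n + k) * t ^ k"
proof -
  have "(1/t) ^ (n + k) \<le> fact (n+k) * exp (1/t)"
    using assms by (intro power_le_fact_exp) simp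
  then have "(1/t)^(n+k) * exp (-(1/t)) \<le> fact (n+k) * exp (1/t) * exp (-(1/t))"
    by (intro mult_right_mono) auto
  also have "\<dots> = fact (n+k)"
    by (simp add: mult.assoc flip: exp_add)
  finally have "(1/t)^(n+k) * exp (-(1/t)) \<le> fact (n+k)" .
  then show ?thesis using assms
    by (simp add: bump_def power_add power_divide field_simps)
qed

lemma bump_le_fact: "bump n t \<le> fact n"
  using bump_le[of t n 0] by (cases "t > 0") (auto simp: bump_def)

text \<open>The index n exists for this closure under differentiation. At 0 the difference quotient
  is squeezed by a linear bound.\<close>

lemma has_real_derivative_bump:
  "(bump n has_real_derivative (bump (n + 2) t - real n * bump (n + 1) t)) (at t)"
proof -
  consider "t > 0" | "t < 0" | "t = 0" by linarith
  then show ?thesis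
  proof cases
    case 1
    have "((\<lambda>t. exp (- (1 / t)) / t ^ n) has_real_derivative
        (bump (n + 2) t - real n * bump (n + 1) t)) (at t)"
      using 1
      apply (cases n)
       apply (auto intro!: derivative_eq_intros simp: bump_def field_simps power2_eq_square)
      apply (case_tac nat; simp)
      done
    then show ?thesis
      by (rule has_field_derivative_transform_within_open[where S = "{0<..}"])
         (use 1 in \<open>auto simp: bump_def\<close>)
  next
    case 2
    have "((\<lambda>t. 0) has_real_derivative (bump (n + 2) t - real n * bump (n + 1) t)) (at t)"
      using 2 by (auto intro!: derivative_eq_intros simp: bump_def)
    then show ?thesis
      by (rule has_field_derivative_transform_within_open[where S = "{..<0}"])
         (use 2 in \<open>auto simp: bump_def\<close>)
  next
    case 3
    have b: "\<bar>bump n h / h\<bar> \<le> fact (n + 2) * \<bar>h\<bar>" for h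
    proof (cases "h > 0")
      case True
      then show ?thesis using bump_le[OF True, of n 2] bump_nonneg[of n h]
        by (simp add: field_simps power2_eq_square)
    next
      case False
      then have "bump n h / h = 0" by (simp add: bump_def)
      then show ?thesis by (simp only: abs_zero) simp
    qed
    have lim: "((\<lambda>h. fact (n + 2) * \<bar>h\<bar>) \<longlongrightarrow> 0) (at (0::real))"
      by (intro tendsto_mult_right_zero tendsto_rabs_zero tendsto_ident_at)
    have "((\<lambda>h. bump n h / h) \<longlongrightarrow> 0) (at 0)"
      by (rule Lim_null_comparison[OF always_eventually lim]) (simp only: real_norm_def b simp_thms)
    then show ?thesis using 3
      by (simp add: has_field_derivative_def DERIV_def bump_def flip: has_field_derivative_def)
  qed
qed

text \<open>A syntax closed under partial derivatives. One term then serves three purposes: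
  smoothness, explicit derivative bounds, and (after translation) the program in a leaf that
  evaluates value and gradient.\<close>

datatype 'n sexpr =
    SC real
  | SAff "real^'n" real
  | SAdd "'n sexpr" "'n sexpr"
  | SMul "'n sexpr" "'n sexpr"
  | SInv "'n sexpr"
  | SBump nat "'n sexpr"

primrec seval :: "'n::finite sexpr \<Rightarrow> real^'n \<Rightarrow> real" where
  "seval (SC c) x = c"
| "seval (SAff v c) x = v \<bullet> x + c"
| "seval (SAdd e f) x = seval e x + seval f x"
| "seval (SMul e f) x = seval e x * seval f x"
| "seval (SInv e) x = inverse (seval e x)"
| "seval (SBump n e) x = bump n (seval e x)"

primrec sderiv :: "'n::finite \<Rightarrow> 'n sexpr \<Rightarrow> 'n sexpr" where
  "sderiv k (SC c) = SC 0"
| "sderiv k (SAff v c) = SC (v $ k)"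
| "sderiv k (SAdd e f) = SAdd (sderiv k e) (sderiv k f)"
| "sderiv k (SMul e f) = SAdd (SMul (sderiv k e) f) (SMul e (sderiv k f))"
| "sderiv k (SInv e) = SMul (SC (-1)) (SMul (sderiv k e) (SMul (SInv e) (SInv e)))"
| "sderiv k (SBump n e) = SMul (SAdd (SBump (n + 2) e) (SMul (SC (- real n)) (SBump (n + 1) e))) (sderiv k e)"

primrec swf :: "'n::finite sexpr \<Rightarrow> real^'n \<Rightarrow> bool" where
  "swf (SC c) x = True"
| "swf (SAff v c) x = True"
| "swf (SAdd e f) x = (swf e x \<and> swf f x)"
| "swf (SMul e f) x = (swf e x \<and> swf f x)"
| "swf (SInv e) x = (swf e x \<and> seval e x \<noteq> 0)"
| "swf (SBump n e) x = swf e x"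

lemma swf_sderiv: "swf e x \<Longrightarrow> swf (sderiv k e) x"
  by (induction e) auto

lemma seval_has_partial:
  "swf e x \<Longrightarrow> ((\<lambda>t. seval e (x + t *\<^sub>R axisv k)) has_real_derivative seval (sderiv k e) x) (at 0)"
proof (induction e)
  case (SAff v c)
  show ?case
    by (auto intro!: derivative_eq_intros simp: inner_add_right axisv_def inner_axis)
next
  case (SMul e f)
  then show ?case by (auto intro!: derivative_eq_intros)
next
  case (SInv e)
  then show ?case by (auto intro!: derivative_eq_intros simp: power2_eq_square field_simps)
next
  case (SBump n e)
  have "((\<lambda>t. bump n (seval e (x + t *\<^sub>R axisv k))) has_real_derivative
     (bump (n + 2) (seval e (x + 0 *\<^sub>R axisv k)) - real n * bump (n + 1) (seval e (x + 0 *\<^sub>R axisv k))) * seval (sderiv k e) x) (at 0)"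
    using SBump by (intro DERIV_chain2[where f = "bump n"] has_real_derivative_bump) auto
  then show ?case by simp
qed (auto intro!: derivative_eq_intros)

lemma continuous_on_seval:
  "(\<And>x. x \<in> U \<Longrightarrow> swf e x) \<Longrightarrow> continuous_on U (seval e)"
proof (induction e)
  case (SBump n e)
  have "continuous_on UNIV (bump n)"
    by (intro continuous_at_imp_continuous_on) (auto intro: DERIV_isCont[OF has_real_derivative_bump])
  then show ?case using SBump
    by (auto intro!: continuous_on_compose2[of UNIV "bump n"])
qed (auto intro!: continuous_intros)

text \<open>The two conjuncts support each other in the induction: the derivative at
  \<open>ks\<close> identifies \<open>ipartial (k # ks)\<close> on all of V, and since V is open
  this identity can be differentiated again.\<close>

lemma ipartial_eq_seval:
  assumes "open V" "\<And>x. x \<in> V \<Longrightarrow> f x = seval e x" "\<And>x. x \<in> V \<Longrightarrow> swf e x"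
  shows "x \<in> V \<Longrightarrow> ipartial ks f x = seval (foldr sderiv ks e) x
    \<and> ((\<lambda>t. ipartial ks f (x + t *\<^sub>R axisv k)) has_real_derivative seval (sderiv k (foldr sderiv ks e)) x) (at 0)"
proof (induction ks arbitrary: x k)
  case base: Nil
  have *: "swf (foldr sderiv [] e) y" if "y \<in> V" for y using assms that by auto
  have cont: "isCont (\<lambda>t::real. x + t *\<^sub>R axisv k) 0" by (intro continuous_intros)
  have "open ((\<lambda>t::real. x + t *\<^sub>R axisv k) -` V)"
    using assms(1) by (intro open_vimage) (auto intro!: continuous_intros)
  then have "((\<lambda>t. f (x + t *\<^sub>R axisv k)) has_real_derivative seval (sderiv k e) x) (at 0)"
    by (rule has_field_derivative_transform_within_open[OF seval_has_partial, rotated])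
       (use assms base in auto)
  then show ?case using assms base by simp
next
  case (Cons j ks)
  have wf: "swf (foldr sderiv ks e) y" if "y \<in> V" for y and ks :: "'a list"
    using assms(3)[OF that] by (induction ks) (auto intro: swf_sderiv)
  have eq: "ipartial (j # ks) f y = seval (foldr sderiv (j # ks) e) y" if "y \<in> V" for y
    using Cons.IH[OF that, of j] by (auto intro: DERIV_imp_deriv)
  have "open ((\<lambda>t::real. x + t *\<^sub>R axisv k) -` V)"
    using assms(1) by (intro open_vimage) (auto intro!: continuous_intros)
  then have "((\<lambda>t. ipartial (j # ks) f (x + t *\<^sub>R axisv k)) has_real_derivative
      seval (sderiv k (foldr sderiv (j # ks) e)) x) (at 0)"
    by (rule has_field_derivative_transform_within_open[OF seval_has_partial, rotated])
       (use wf Cons.prems eq in \<open>auto intro: swf_sderiv\<close>)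
  with eq[OF Cons.prems] show ?case by blast
qed

lemma smooth_on_locally_seval:
  assumes "open U"
    and loc: "\<And>x. x \<in> U \<Longrightarrow> \<exists>V e. open V \<and> x \<in> V \<and> (\<forall>y\<in>V. f y = seval e y \<and> swf e y)"
  shows "smooth_on f U"
  unfolding smooth_on_def
proof (intro conjI allI ballI)
  fix ks :: "'a list"
  have wf: "swf e y \<Longrightarrow> swf (foldr sderiv ks e) y" for y e
    by (induction ks) (auto intro: swf_sderiv)
  show "continuous_on U (ipartial ks f)"
  proof (rule continuous_at_imp_continuous_on, rule ballI)
    fix x assume "x \<in> U"
    then obtain V e where V: "open V" "x \<in> V" "\<forall>y\<in>V. f y = seval e y \<and> swf e y"
      using loc by metis
    have "continuous_on V (seval (foldr sderiv ks e))"
      by (intro continuous_on_seval wf) (use V in auto)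
    moreover have "ipartial ks f y = seval (foldr sderiv ks e) y" if "y \<in> V" for y
      using ipartial_eq_seval[of V f e y ks] V that by blast
    ultimately have "continuous_on V (ipartial ks f)"
      by (simp cong: continuous_on_cong)
    then show "isCont (ipartial ks f) x"
      using V continuous_on_eq_continuous_at by blast
  qed
  fix k x assume "x \<in> U"
  then obtain V e where V: "open V" "x \<in> V" "\<forall>y\<in>V. f y = seval e y \<and> swf e y"
    using loc by metis
  have 1: "ipartial (k # ks) f x = seval (sderiv k (foldr sderiv ks e)) x"
    using conjunct1[OF ipartial_eq_seval[of V f e x "k # ks"]] V by simp
  have 2: "((\<lambda>t. ipartial ks f (x + t *\<^sub>R axisv k)) has_real_derivative seval (sderiv k (foldr sderiv ks e)) x) (at 0)"
    by (rule conjunct2[OF ipartial_eq_seval[of V f e x ks k]]) (use V in auto)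
  show "((\<lambda>t. ipartial ks f (x + t *\<^sub>R axisv k)) has_real_derivative ipartial (k # ks) f x) (at 0)"
    unfolding 1 by (rule 2)
qed (use assms in auto)

text \<open>The bounds of a function of size a that varies at length scale s. Sums, products,
  inverses and bumps preserve this form, so that only the constant a has to be tracked.\<close>

definition scaled_bound :: "real \<Rightarrow> 'n::finite sexpr \<Rightarrow> real^'n \<Rightarrow> real \<Rightarrow> bool" where
  "scaled_bound s e x a \<longleftrightarrow> \<bar>seval e x\<bar> \<le> a \<and> (\<forall>i. \<bar>seval (sderiv i e) x\<bar> \<le> a / s)
     \<and> (\<forall>i j. \<bar>seval (sderiv i (sderiv j e)) x\<bar> \<le> a / s\<^sup>2)"

lemma scaled_bound_nonneg: "scaled_bound s e x a \<Longrightarrow> 0 \<le> a"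
  unfolding scaled_bound_def by linarith

lemma scaled_bound_mono: "scaled_bound s e x a \<Longrightarrow> a \<le> b \<Longrightarrow> 0 < s \<Longrightarrow> scaled_bound s e x b"
  unfolding scaled_bound_def by (meson divide_right_mono less_imp_le order_trans zero_le_power)

lemma scaled_bound_SC: "\<bar>c\<bar> \<le> a \<Longrightarrow> 0 < s \<Longrightarrow> scaled_bound s (SC c) x a"
  unfolding scaled_bound_def by simp

lemma scaled_bound_SAff:
  assumes "\<bar>v \<bullet> x + c\<bar> \<le> a" "\<And>i. \<bar>v $ i\<bar> \<le> a / s" "0 < s"
  shows "scaled_bound s (SAff v c) x a"
  using assms unfolding scaled_bound_def by simp

lemma scaled_bound_SAdd: "scaled_bound s e x a \<Longrightarrow> scaled_bound s f x b \<Longrightarrow> scaled_bound s (SAdd e f) x (a + b)"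
  unfolding scaled_bound_def by (auto simp: add_divide_distrib intro!: order_trans[OF abs_triangle_ineq] add_mono)

text \<open>By the Leibniz rule the second derivative has four terms of size
  \<open>a * b / s\<^sup>2\<close>, hence the factor 4.\<close>

lemma scaled_bound_SMul:
  assumes "scaled_bound s e x a" "scaled_bound s f x b" "0 < s"
  shows "scaled_bound s (SMul e f) x (4 * (a * b))"
proof -
  have a: "0 \<le> a" "0 \<le> b" using assms scaled_bound_nonneg by auto
  have m: "\<bar>u * v\<bar> \<le> p * q" if "\<bar>u\<bar> \<le> p" "\<bar>v\<bar> \<le> q" for u v p q :: real
    using that by (simp add: abs_mult mult_mono')
  note e = assms(1)[unfolded scaled_bound_def] and f = assms(2)[unfolded scaled_bound_def]
  have 1: "\<bar>seval (SMul e f) x\<bar> \<le> 4 * (a * b)"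
    using m[of "seval e x" a "seval f x" b] e f a mult_nonneg_nonneg[OF a] by simp
  have 2: "\<bar>seval (sderiv i (SMul e f)) x\<bar> \<le> 4 * (a * b) / s" for i
  proof -
    have "\<bar>seval (sderiv i (SMul e f)) x\<bar> \<le> (a / s) * b + a * (b / s)"
      unfolding sderiv.simps seval.simps using e f
      by (intro order_trans[OF abs_triangle_ineq] add_mono m) auto
    also have "\<dots> \<le> 4 * (a * b) / s"
      using assms(3) a mult_nonneg_nonneg[OF a] by (simp add: field_simps)
    finally show ?thesis .
  qed
  have 3: "\<bar>seval (sderiv i (sderiv j (SMul e f))) x\<bar> \<le> 4 * (a * b) / s\<^sup>2" for i j
  proof -
    have "\<bar>seval (sderiv i (sderiv j (SMul e f))) x\<bar> \<le>
       ((a / s\<^sup>2) * b + (a / s) * (b / s)) + ((a / s) * (b / s) + a * (b / s\<^sup>2))"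
      unfolding sderiv.simps seval.simps using e f
      by (intro order_trans[OF abs_triangle_ineq] add_mono m) auto
    also have "\<dots> = 4 * (a * b) / s\<^sup>2"
      using assms(3) by (simp add: field_simps power2_eq_square)
    finally show ?thesis .
  qed
  show ?thesis unfolding scaled_bound_def using 1 2 3 by blast
qed

lemma scaled_bound_SInv:
  assumes "scaled_bound s e x a" "c \<le> \<bar>seval e x\<bar>" "0 < c" "0 < s"
  shows "scaled_bound s (SInv e) x (1 / c + a / c\<^sup>2 + 2 * a\<^sup>2 / c ^ 3)"
proof -
  have a: "0 \<le> a" using assms scaled_bound_nonneg by auto
  let ?g = "seval e x" and ?A = "1 / c + a / c\<^sup>2 + 2 * a\<^sup>2 / c ^ 3"
  have m: "\<bar>u * v\<bar> \<le> p * q" if "\<bar>u\<bar> \<le> p" "\<bar>v\<bar> \<le> q" for u v p q :: real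
    using that by (simp add: abs_mult mult_mono')
  note e = assms(1)[unfolded scaled_bound_def]
  have i: "\<bar>inverse ?g\<bar> \<le> 1 / c"
    using assms by (simp add: abs_inverse inverse_eq_divide frac_le)
  have nn: "0 \<le> 1 / c" "0 \<le> a / c\<^sup>2" "0 \<le> 2 * a\<^sup>2 / c ^ 3" using a assms by auto
  have 1: "\<bar>seval (SInv e) x\<bar> \<le> ?A"
  proof -
    have "seval (SInv e) x = inverse ?g" by simp
    then show ?thesis using i nn by linarith
  qed
  have 2: "\<bar>seval (sderiv k (SInv e)) x\<bar> \<le> ?A / s" for k
  proof -
    have "\<bar>seval (sderiv k (SInv e)) x\<bar> \<le> 1 * ((a / s) * ((1 / c) * (1 / c)))"
      unfolding sderiv.simps seval.simps using e i by (intro m) auto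
    also have "\<dots> = (a / c\<^sup>2) / s" by (simp add: power2_eq_square)
    also have "\<dots> \<le> ?A / s" using nn assms by (intro divide_right_mono) auto
    finally show ?thesis .
  qed
  have 3: "\<bar>seval (sderiv k (sderiv j (SInv e))) x\<bar> \<le> ?A / s\<^sup>2" for k j
  proof -
    have "seval (sderiv k (sderiv j (SInv e))) x =
       (-1) * (seval (sderiv k (sderiv j e)) x * (inverse ?g * inverse ?g)) +
       2 * ((seval (sderiv j e) x * seval (sderiv k e) x) * (inverse ?g * (inverse ?g * inverse ?g)))"
      by (simp add: algebra_simps)
    also have "\<bar>\<dots>\<bar> \<le> 1 * ((a / s\<^sup>2) * ((1 / c) * (1 / c))) +
       2 * (((a / s) * (a / s)) * ((1 / c) * ((1 / c) * (1 / c))))"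
      using e i by (intro order_trans[OF abs_triangle_ineq] add_mono m) auto
    also have "\<dots> = (a / c\<^sup>2 + 2 * a\<^sup>2 / c ^ 3) / s\<^sup>2"
      using assms by (simp add: field_simps power2_eq_square power3_eq_cube)
    also have "\<dots> \<le> ?A / s\<^sup>2" using nn assms by (intro divide_right_mono) auto
    finally show ?thesis .
  qed
  show ?thesis unfolding scaled_bound_def using 1 2 3 by blast
qed

text \<open>From \<open>bump n t\<close> \<le> n!: the first derivative of \<open>bump 0\<close> is
  \<open>bump 2\<close>, at most 2; the second is \<open>bump 4\<close> minus twice
  \<open>bump 3\<close>, at most 24 + 2 * 6 = 36.\<close>

lemma scaled_bound_SBump0:
  assumes "scaled_bound s e x a" "0 < s"
  shows "scaled_bound s (SBump 0 e) x (1 + 2 * a + 36 * a\<^sup>2)"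
proof -
  have a: "0 \<le> a" using assms scaled_bound_nonneg by auto
  let ?g = "seval e x" and ?A = "1 + 2 * a + 36 * a\<^sup>2"
  have m: "\<bar>u * v\<bar> \<le> p * q" if "\<bar>u\<bar> \<le> p" "\<bar>v\<bar> \<le> q" for u v p q :: real
    using that by (simp add: abs_mult mult_mono')
  note e = assms(1)[unfolded scaled_bound_def]
  have b: "\<bar>bump n t\<bar> \<le> fact n" for n t using bump_le_fact[of n t] bump_nonneg[of n t] by simp
  have b2: "\<bar>bump 2 ?g\<bar> \<le> 2" using b[of 2 ?g] by (simp add: fact_numeral)
  have b3: "\<bar>bump 3 ?g\<bar> \<le> 6" using b[of 3 ?g] by (simp add: fact_numeral)
  have b4: "\<bar>bump 4 ?g\<bar> \<le> 24" using b[of 4 ?g] by (simp add: fact_numeral)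
  have 1: "\<bar>seval (SBump 0 e) x\<bar> \<le> ?A"
  proof -
    have "seval (SBump 0 e) x = bump 0 ?g" by simp
    then show ?thesis using b[of 0 ?g] a zero_le_power2[of a] fact_0[where 'a = real] by linarith
  qed
  have 2: "\<bar>seval (sderiv k (SBump 0 e)) x\<bar> \<le> ?A / s" for k
  proof -
    have "seval (sderiv k (SBump 0 e)) x = bump 2 ?g * seval (sderiv k e) x" by (simp add: eval_nat_numeral)
    also have "\<bar>\<dots>\<bar> \<le> 2 * (a / s)" using e b2 by (intro m) auto
    also have "\<dots> = (2 * a) / s" by simp
    also have "\<dots> \<le> ?A / s" using a assms by (intro divide_right_mono) auto
    finally show ?thesis .
  qed
  have 3: "\<bar>seval (sderiv k (sderiv j (SBump 0 e))) x\<bar> \<le> ?A / s\<^sup>2" for k j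
  proof -
    have "seval (sderiv k (sderiv j (SBump 0 e))) x =
       (bump 4 ?g + (-2) * bump 3 ?g) * (seval (sderiv k e) x * seval (sderiv j e) x) + bump 2 ?g * seval (sderiv k (sderiv j e)) x"
      by (simp add: algebra_simps eval_nat_numeral)
    also have "\<bar>\<dots>\<bar> \<le> (24 + 2 * 6) * ((a / s) * (a / s)) + 2 * (a / s\<^sup>2)"
      using e b2 b3 b4 by (intro order_trans[OF abs_triangle_ineq] add_mono m) auto
    also have "\<dots> = (2 * a + 36 * a\<^sup>2) / s\<^sup>2"
      using assms by (simp add: field_simps power2_eq_square)
    also have "\<dots> \<le> ?A / s\<^sup>2" using assms by (intro divide_right_mono) auto
    finally show ?thesis .
  qed
  show ?thesis unfolding scaled_bound_def using 1 2 3 by blast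
qed

definition ssum :: "'n::finite sexpr list \<Rightarrow> 'n sexpr" where
  "ssum es = foldr SAdd es (SC 0)"

lemma ssum_simps [simp]: "ssum [] = SC 0" "ssum (e # es) = SAdd e (ssum es)"
  by (auto simp: ssum_def)

lemma seval_ssum: "seval (ssum es) x = (\<Sum>e\<leftarrow>es. seval e x)"
  by (induction es) auto

lemma swf_ssum: "swf (ssum es) x \<longleftrightarrow> (\<forall>e\<in>set es. swf e x)"
  by (induction es) auto

lemma scaled_bound_ssum:
  assumes "0 < s" "\<And>e. e \<in> set es \<Longrightarrow> scaled_bound s e x a"
  shows "scaled_bound s (ssum es) x (real (length es) * a)"
  using assms(2)
proof (induction es)
  case Nil
  then show ?case by (simp add: scaled_bound_SC assms)
next
  case (Cons e es)
  have "scaled_bound s (SAdd e (ssum es)) x (a + real (length es) * a)"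
    using Cons by (intro scaled_bound_SAdd) auto
  then show ?case by (simp add: algebra_simps)
qed

section \<open>Straight-line code for smooth expressions\<close>

datatype 'n cexpr = KC real | KX 'n | KB bop "'n cexpr" "'n cexpr" | KU uop "'n cexpr"

primrec ceval :: "'n::finite cexpr \<Rightarrow> real^'n \<Rightarrow> real" where
  "ceval (KC c) x = c"
| "ceval (KX i) x = x $ i"
| "ceval (KB b e f) x = bop_sem b (ceval e x) (ceval f x)"
| "ceval (KU u e) x = uop_sem u (ceval e x)"

primrec code_size :: "'n cexpr \<Rightarrow> nat" where
  "code_size (KC c) = 1"
| "code_size (KX i) = 1"
| "code_size (KB b e f) = code_size e + code_size f + 1"
| "code_size (KU u e) = code_size e + 1"

text \<open>With \<open>n\<close> registers in use, the value of \<open>e\<close> ends up in register \<open>n + code_size e - 1\<close>.\<close>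
primrec compile :: "'n cexpr \<Rightarrow> nat \<Rightarrow> 'n ctree \<Rightarrow> 'n ctree" where
  "compile (KC c) n t = Cst c t"
| "compile (KX i) n t = Inp i t"
| "compile (KB b e f) n t = compile e n (compile f (n + code_size e) (Bin b (n + code_size e - 1) (n + code_size e + code_size f - 1) t))"
| "compile (KU u e) n t = compile e n (Una u (n + code_size e - 1) t)"

lemma code_size_pos: "0 < code_size e"
  by (induction e) auto

lemma ct_depth_compile: "ct_depth (compile e n t) = code_size e + ct_depth t"
  by (induction e arbitrary: n t) auto

lemma ct_size_compile: "ct_size (compile e n t) = code_size e + ct_size t"
  by (induction e arbitrary: n t) auto

lemma reg_append: "i < length u \<Longrightarrow> reg (rs @ u @ v) (length rs + i) = u ! i"
  by (simp add: reg_def nth_append)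

lemma compile_correct:
  "\<exists>vs. length vs = code_size e \<and> vs ! (code_size e - 1) = ceval e x
     \<and> (\<forall>t. ct_eval (compile e (length rs) t) x rs = ct_eval t x (rs @ vs))"
proof (induction e arbitrary: rs)
  case (KC c)
  show ?case by (intro exI[of _ "[c]"]) auto
next
  case (KX i)
  show ?case by (intro exI[of _ "[x $ i]"]) auto
next
  case (KB b e f)
  obtain u where u: "length u = code_size e" "u ! (code_size e - 1) = ceval e x"
    "\<And>t. ct_eval (compile e (length rs) t) x rs = ct_eval t x (rs @ u)"
    using KB.IH(1)[of rs] by blast
  obtain v where v: "length v = code_size f" "v ! (code_size f - 1) = ceval f x"
    "\<And>t. ct_eval (compile f (length (rs @ u)) t) x (rs @ u) = ct_eval t x ((rs @ u) @ v)"
    using KB.IH(2)[of "rs @ u"] by blast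
  have p: "0 < code_size e" "0 < code_size f" by (auto simp: code_size_pos)
  have 1: "reg (rs @ u @ v) (length rs + code_size e - 1) = ceval e x"
    using reg_append[of "code_size e - 1" u rs v] u p by simp
  have 2: "reg (rs @ u @ v) (length rs + code_size e + code_size f - 1) = ceval f x"
    using reg_append[of "code_size f - 1" v "rs @ u" "[]"] u v p by simp
  show ?case
    by (intro exI[of _ "u @ v @ [bop_sem b (ceval e x) (ceval f x)]"])
       (use u v 1 2 in \<open>auto simp: nth_append\<close>)
next
  case (KU b e)
  obtain u where u: "length u = code_size e" "u ! (code_size e - 1) = ceval e x"
    "\<And>t. ct_eval (compile e (length rs) t) x rs = ct_eval t x (rs @ u)"
    using KU.IH[of rs] by blast
  have p: "0 < code_size e" by (auto simp: code_size_pos)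
  have 1: "reg (rs @ u) (length rs + code_size e - 1) = ceval e x"
    using reg_append[of "code_size e - 1" u rs "[]"] u p by simp
  show ?case
    by (intro exI[of _ "u @ [uop_sem b (ceval e x)]"]) (use u 1 in \<open>auto simp: nth_append\<close>)
qed

definition list_of :: "'a set \<Rightarrow> 'a list" where
  "list_of S = (SOME xs. set xs = S \<and> distinct xs)"

lemma list_of: "finite S \<Longrightarrow> set (list_of S) = S" "finite S \<Longrightarrow> distinct (list_of S)"
  using someI_ex[OF finite_distinct_list[of S]] unfolding list_of_def by auto

lemma length_list_of: "finite S \<Longrightarrow> length (list_of S) = card S"
  by (metis list_of distinct_card)

lemma sum_list_of: "finite S \<Longrightarrow> (\<Sum>x\<leftarrow>list_of S. f x) = sum f S" for f :: "'a \<Rightarrow> 'b::comm_monoid_add"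
  by (simp add: sum_list_distinct_conv_sum_set list_of)

abbreviation univ_list :: "'n::finite list" where
  "univ_list \<equiv> list_of UNIV"

lemma length_univ_list: "length (univ_list :: 'n::finite list) = CARD('n)"
  by (simp add: length_list_of)

text \<open>This is max(e, 0) = (e + |e|) / 2 with |e| = sqrt (e * e), which stays within
  straight-line code.\<close>

definition kmax0 :: "'n cexpr \<Rightarrow> 'n cexpr" where
  "kmax0 e = KB Mul (KC (1/2)) (KB Add e (KU Sqrt (KB Mul e e)))"

primrec kpow :: "'n cexpr \<Rightarrow> nat \<Rightarrow> 'n cexpr" where
  "kpow e 0 = KC 1"
| "kpow e (Suc n) = KB Mul e (kpow e n)"

primrec translate :: "'n::finite sexpr \<Rightarrow> 'n cexpr" where
  "translate (SC c) = KC c"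
| "translate (SAff v c) = foldr (\<lambda>i a. KB Add (KB Mul (KC (v $ i)) (KX i)) a) univ_list (KC c)"
| "translate (SAdd e f) = KB Add (translate e) (translate f)"
| "translate (SMul e f) = KB Mul (translate e) (translate f)"
| "translate (SInv e) = KB Div (KC 1) (translate e)"
| "translate (SBump n e) = KB Mul (KB Div (kmax0 (translate e)) (kmax0 (translate e)))
     (KB Div (KU Exp (KB Sub (KC 0) (KB Div (KC 1) (kmax0 (translate e))))) (kpow (kmax0 (translate e)) n))"

lemma ceval_kpow: "ceval (kpow e n) x = ceval e x ^ n"
  by (induction n) auto

lemma code_size_kpow: "code_size (kpow e n) = n * (code_size e + 1) + 1"
  by (induction n) auto

text \<open>The factor \<open>m / m\<close> with \<open>m = max t 0\<close> is the indicator of \<open>t > 0\<close>, because \<open>0 / 0 = 0\<close>;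
  so the bump function is evaluated without branching.\<close>
lemma ceval_translate: "ceval (translate e) x = seval e x"
proof (induction e)
  case (SAff v c)
  have "ceval (foldr (\<lambda>i a. KB Add (KB Mul (KC (v $ i)) (KX i)) a) is (KC c)) x
    = (\<Sum>i\<leftarrow>is. v $ i * x $ i) + c" for "is"
    by (induction "is") auto
  then show ?case by (simp add: sum_list_of inner_vec_def)
next
  case (SBump n e)
  have m: "ceval (kmax0 (translate e)) x = max (seval e x) 0"
    using SBump by (simp add: kmax0_def)
  show ?case
    by (cases "seval e x > 0") (simp_all add: m ceval_kpow bump_def max_def)
qed (auto simp: inverse_eq_divide)

lemma code_size_translate_SAff: "code_size (translate (SAff v c :: 'n::finite sexpr)) = 4 * CARD('n) + 1"
proof -
  have "code_size (foldr (\<lambda>i a. KB Add (KB Mul (KC (v $ i)) (KX i)) a) is (KC c)) = 4 * length is + 1" for "is"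
    by (induction "is") auto
  then show ?thesis by (simp add: length_univ_list)
qed

lemma code_size_translate_SBump: "code_size (translate (SBump n e)) = (3 * code_size (translate e) + 6) * n + 9 * code_size (translate e) + 24"
  by (simp add: code_size_kpow kmax0_def algebra_simps)

text \<open>The product rule copies both factors, so the growth is not linear; a quadratic bound
  absorbs the copies in the induction.\<close>

lemma code_size_translate_sderiv: "code_size (translate (sderiv k e)) \<le> 20 * code_size (translate e) ^ 2"
proof (induction e)
  case (SMul e f)
  have "code_size (translate (sderiv k (SMul e f))) \<le> 20 * code_size (translate e) ^ 2 + 20 * code_size (translate f) ^ 2 + code_size (translate e) + code_size (translate f) + 3"
    using SMul by simp
  also have "\<dots> \<le> 20 * (code_size (translate e) + code_size (translate f) + 1) ^ 2"
    by (simp add: power2_eq_square algebra_simps)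
  finally show ?case by simp
next
  case (SAdd e f)
  have "code_size (translate (sderiv k (SAdd e f))) \<le> 20 * code_size (translate e) ^ 2 + 20 * code_size (translate f) ^ 2 + 1"
    using SAdd by simp
  also have "\<dots> \<le> 20 * (code_size (translate e) + code_size (translate f) + 1) ^ 2"
    by (simp add: power2_eq_square algebra_simps)
  finally show ?case by simp
next
  case (SInv e)
  have "code_size (translate (sderiv k (SInv e))) \<le> 20 * code_size (translate e) ^ 2 + 2 * code_size (translate e) + 9"
    using SInv by simp
  also have "\<dots> \<le> 20 * (code_size (translate e) + 2) ^ 2"
    by (simp add: power2_eq_square algebra_simps)
  finally show ?case by simp
next
  case (SBump n e)
  define s where "s = code_size (translate e)"
  define b where "b = code_size (translate (SBump n e))"
  have b: "b = (3 * s + 6) * n + 9 * s + 24"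
    unfolding b_def s_def code_size_translate_SBump ..
  have 1: "code_size (translate (SBump (n + 2) e)) \<le> 3 * b" "code_size (translate (SBump (n + 1) e)) \<le> 3 * b"
    unfolding code_size_translate_SBump b s_def by (auto simp: algebra_simps)
  have "code_size (translate (sderiv k (SBump n e))) =
    code_size (translate (SBump (n + 2) e)) + code_size (translate (SBump (n + 1) e)) + code_size (translate (sderiv k e)) + 4"
    by (simp del: translate.simps(6))
  also have "\<dots> \<le> 6 * b + 20 * s ^ 2 + 4"
    using SBump 1 unfolding s_def by linarith
  also have "\<dots> \<le> 20 * b ^ 2"
  proof -
    have "10 * b \<le> b * b" using b by (intro mult_right_mono) auto
    moreover have "2 * s * (2 * s) \<le> b * b" using b by (intro mult_mono) auto
    moreover have "23 \<le> b" using b by simp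
    ultimately show ?thesis unfolding power2_eq_square by linarith
  qed
  finally show ?case unfolding b_def .
next
  case (SAff v c)
  have "0 < code_size (translate (SAff v c))" by (rule code_size_pos)
  then have "1 \<le> code_size (translate (SAff v c)) ^ 2" by (metis One_nat_def Suc_leI zero_less_power)
  then show ?case by simp
qed simp

text \<open>The tests run one after another and the first with value \<le> 0 decides. Subtrees are
  functions of the register count, because each failed test has appended registers. The default leaf
  is reached only if every test fails, which the covering property excludes.\<close>

fun search_tree :: "('n cexpr \<times> (nat \<Rightarrow> 'n ctree)) list \<Rightarrow> nat \<Rightarrow> 'n ctree" where
  "search_tree [] n = Out 0 (\<lambda>_. 0)"
| "search_tree ((e, t) # r) n =
     compile e n (Branch (n + code_size e - 1) (t (n + code_size e)) (search_tree r (n + code_size e)))"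

text \<open>Every entry whose test succeeds must lead to the same answer, since the order of the
  list decides which one is taken.\<close>

lemma search_tree_correct:
  assumes "\<And>e t rs. (e, t) \<in> set l \<Longrightarrow> ceval e x \<le> 0 \<Longrightarrow> ct_eval (t (length rs)) x rs = r"
    and "\<exists>(e, t)\<in>set l. ceval e x \<le> 0"
  shows "ct_eval (search_tree l (length rs)) x rs = r"
  using assms
proof (induction l arbitrary: rs)
  case (Cons p l)
  obtain e t where p: "p = (e, t)" by (cases p)
  obtain vs where vs: "length vs = code_size e" "vs ! (code_size e - 1) = ceval e x"
    "\<And>t. ct_eval (compile e (length rs) t) x rs = ct_eval t x (rs @ vs)"
    using compile_correct[of e x rs] by blast
  have reg: "reg (rs @ vs) (length rs + code_size e - 1) = ceval e x"
    using reg_append[of "code_size e - 1" vs rs "[]"] vs code_size_pos[of e] by simp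
  show ?case
  proof (cases "ceval e x \<le> 0")
    case True
    then show ?thesis using Cons.prems(1)[of e t "rs @ vs"] by (simp add: p vs reg[unfolded One_nat_def])
  next
    case False
    then have "ct_eval (search_tree l (length (rs @ vs))) x (rs @ vs) = r"
      using Cons.prems by (intro Cons.IH) (auto simp: p)
    then show ?thesis using False by (simp add: p vs reg[unfolded One_nat_def])
  qed
qed auto

lemma ct_depth_search_tree:
  assumes "\<And>e t n. (e, t) \<in> set l \<Longrightarrow> code_size e \<le> c \<and> ct_depth (t n) \<le> s"
  shows "ct_depth (search_tree l n) \<le> length l * (c + 1) + s"
  using assms
proof (induction l arbitrary: n)
  case (Cons p l)
  obtain e t where p: "p = (e, t)" by (cases p)
  have "code_size e \<le> c" "ct_depth (t (n + code_size e)) \<le> s" using Cons.prems by (auto simp: p)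
  moreover have "ct_depth (search_tree l (n + code_size e)) \<le> length l * (c + 1) + s"
    using Cons.prems by (intro Cons.IH) auto
  ultimately show ?case by (simp add: p ct_depth_compile)
qed auto

lemma ct_size_search_tree:
  assumes "\<And>z n. z \<in> set l \<Longrightarrow> code_size (e z) \<le> c \<and> ct_size (t z n) \<le> s z"
  shows "ct_size (search_tree (map (\<lambda>z. (e z, t z)) l) n) \<le> 1 + (\<Sum>z\<leftarrow>l. c + 1 + s z)"
  using assms
proof (induction l arbitrary: n)
  case (Cons z l)
  have "code_size (e z) \<le> c" "ct_size (t z (n + code_size (e z))) \<le> s z" using Cons.prems by auto
  moreover have "ct_size (search_tree (map (\<lambda>z. (e z, t z)) l) (n + code_size (e z))) \<le> 1 + (\<Sum>z\<leftarrow>l. c + 1 + s z)"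
    using Cons.prems by (intro Cons.IH) auto
  ultimately show ?case by (simp add: ct_size_compile)
qed auto

section \<open>Unfolding a layered graph into a search tree\<close>

context
  fixes X :: "nat \<Rightarrow> 'a set" and te :: "nat \<Rightarrow> 'a \<Rightarrow> 'n::finite cexpr"
    and leaf :: "'a \<Rightarrow> nat \<Rightarrow> 'n ctree" and \<Omega> :: "(real^'n) set"
begin

text \<open>An edge is present exactly when some query could use it, so a descent at y that holds x
  finds its next node among the nodes linked to y.\<close>

definition linked :: "nat \<Rightarrow> 'a \<Rightarrow> 'a \<Rightarrow> bool" where
  "linked k y z \<longleftrightarrow> (\<exists>x\<in>\<Omega>. ceval (te k y) x \<le> 0 \<and> ceval (te (Suc k) z) x \<le> 0)"

primrec node_tree :: "nat \<Rightarrow> nat \<Rightarrow> 'a \<Rightarrow> nat \<Rightarrow> 'n ctree" where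
  "node_tree 0 k y = leaf y"
| "node_tree (Suc j) k y =
     search_tree (map (\<lambda>z. (te (Suc k) z, node_tree j (Suc k) z)) (list_of {z \<in> X (Suc k). linked k y z}))"

text \<open>A node of level i is reached by at most m^i descending paths, which bounds its copies in
  the tree. The out-degree b enters only the cost of a single node and a single step.\<close>

lemma layered_search_tree:
  assumes fin: "\<And>k. k \<le> K \<Longrightarrow> finite (X k)"
    and cover: "\<And>x k. x \<in> \<Omega> \<Longrightarrow> k \<le> K \<Longrightarrow> \<exists>y\<in>X k. ceval (te k y) x \<le> 0"
    and leaf: "\<And>x y rs. x \<in> \<Omega> \<Longrightarrow> y \<in> X K \<Longrightarrow> ceval (te K y) x \<le> 0 \<Longrightarrow>
        ct_eval (leaf y (length rs)) x rs = F x"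
    and te: "\<And>k y. k \<le> K \<Longrightarrow> y \<in> X k \<Longrightarrow> code_size (te k y) \<le> c"
    and lsz: "\<And>y n. y \<in> X K \<Longrightarrow> ct_depth (leaf y n) \<le> s \<and> ct_size (leaf y n) \<le> s"
    and b0: "card (X 0) \<le> b"
    and b: "\<And>k y. k < K \<Longrightarrow> y \<in> X k \<Longrightarrow> card {z \<in> X (Suc k). linked k y z} \<le> b"
    and m: "\<And>k z. k < K \<Longrightarrow> z \<in> X (Suc k) \<Longrightarrow> card {y \<in> X k. linked k y z} \<le> m"
  shows "\<exists>T. (\<forall>x\<in>\<Omega>. query T x = F x) \<and>
     ct_depth T \<le> (K + 1) * (b * (c + 1)) + s \<and>
     ct_size T \<le> (1 + b * (c + 1) + s) * (1 + (\<Sum>i\<le>K. m ^ i * card (X i)))"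
proof -
  let ?c1 = "1 + b * (c + 1) + s"
  have cor: "ct_eval (node_tree j k y (length rs)) x rs = F x"
    if "x \<in> \<Omega>" "k + j = K" "y \<in> X k" "ceval (te k y) x \<le> 0" for j k y x rs
    using that
  proof (induction j arbitrary: k y rs)
    case 0
    then show ?case using leaf by simp
  next
    case (Suc j)
    have f: "finite {z \<in> X (Suc k). linked k y z}" using fin[of "Suc k"] Suc.prems by auto
    obtain z where z: "z \<in> X (Suc k)" "ceval (te (Suc k) z) x \<le> 0"
      using cover[of x "Suc k"] Suc.prems by auto
    then have "linked k y z" unfolding linked_def using Suc.prems by blast
    then show ?case
      unfolding node_tree.simps using Suc z by (intro search_tree_correct) (auto simp: list_of f)
  qed
  have dep: "ct_depth (node_tree j k y n) \<le> j * (b * (c + 1)) + s"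
    if "k + j = K" "y \<in> X k" for j k y n
    using that
  proof (induction j arbitrary: k y n)
    case 0
    then show ?case using lsz by simp
  next
    case (Suc j)
    have f: "finite {z \<in> X (Suc k). linked k y z}" using fin[of "Suc k"] Suc.prems by auto
    let ?l = "map (\<lambda>z. (te (Suc k) z, node_tree j (Suc k) z)) (list_of {z \<in> X (Suc k). linked k y z})"
    have "ct_depth (search_tree ?l n) \<le> length ?l * (c + 1) + (j * (b * (c + 1)) + s)"
      using Suc te by (intro ct_depth_search_tree) (auto simp: list_of f)
    moreover have "length ?l \<le> b" using b[of k y] Suc.prems by (simp add: length_list_of f)
    then have "length ?l * (c + 1) \<le> b * (c + 1)" by (rule mult_right_mono) simp
    ultimately show ?case unfolding node_tree.simps by simp
  qed
  \<comment> \<open>The size bound is kept separately for every node: replacing it by a maximum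
    would cost a factor b per level, whereas the sum over a whole level costs only m.\<close>
  define sg where "sg = rec_nat (\<lambda>k y. s) (\<lambda>j r k y. 1 + (\<Sum>z\<in>{z \<in> X (Suc k). linked k y z}. c + 1 + r (Suc k) z))"
  have sg: "sg 0 k y = s" "sg (Suc j) k y = 1 + (\<Sum>z\<in>{z \<in> X (Suc k). linked k y z}. c + 1 + sg j (Suc k) z)" for j k y
    by (auto simp: sg_def)
  have siz: "ct_size (node_tree j k y n) \<le> sg j k y"
    if "k + j = K" "y \<in> X k" for j k y n
    using that
  proof (induction j arbitrary: k y n)
    case 0
    then show ?case using lsz by (simp add: sg)
  next
    case (Suc j)
    have f: "finite {z \<in> X (Suc k). linked k y z}" using fin[of "Suc k"] Suc.prems by auto
    have "ct_size (node_tree (Suc j) k y n) \<le>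
       1 + (\<Sum>z\<leftarrow>list_of {z \<in> X (Suc k). linked k y z}. c + 1 + sg j (Suc k) z)"
      unfolding node_tree.simps using Suc te by (intro ct_size_search_tree) (auto simp: list_of f)
    then show ?case by (simp add: sg sum_list_of f)
  qed
  have tot: "(\<Sum>y\<in>X k. sg j k y) \<le> (\<Sum>i\<le>j. m ^ i * card (X (k + i))) * ?c1"
    if "k + j = K" for j k
    using that
  proof (induction j arbitrary: k)
    case 0
    have "(\<Sum>y\<in>X k. sg 0 k y) = card (X k) * s" by (simp add: sg)
    also have "\<dots> \<le> card (X k) * ?c1" by (intro mult_left_mono) auto
    also have "\<dots> = (\<Sum>i\<le>0. m ^ i * card (X (k + i))) * ?c1" by simp
    finally show ?case .
  next
    case (Suc j)
    have f: "finite (X k)" "finite (X (Suc k))" using fin[of k] fin[of "Suc k"] Suc.prems by auto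
    have "(\<Sum>y\<in>X k. sg (Suc j) k y) =
       (\<Sum>y\<in>X k. 1 + card {z \<in> X (Suc k). linked k y z} * (c + 1) + (\<Sum>z\<in>{z \<in> X (Suc k). linked k y z}. sg j (Suc k) z))"
      unfolding sg sum.distrib sum_constant of_nat_id by (simp add: algebra_simps sum.distrib)
    also have "\<dots> \<le> (\<Sum>y\<in>X k. ?c1 + (\<Sum>z\<in>{z \<in> X (Suc k). linked k y z}. sg j (Suc k) z))"
    proof (intro sum_mono add_right_mono)
      fix y assume "y \<in> X k"
      then have "card {z \<in> X (Suc k). linked k y z} * (c + 1) \<le> b * (c + 1)"
        using b[of k y] Suc.prems by (intro mult_right_mono) auto
      then show "1 + card {z \<in> X (Suc k). linked k y z} * (c + 1) \<le> ?c1" by simp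
    qed
    also have "\<dots> = card (X k) * ?c1 + (\<Sum>y\<in>X k. \<Sum>z\<in>{z \<in> X (Suc k). linked k y z}. sg j (Suc k) z)"
      by (simp only: sum.distrib sum_constant of_nat_id distrib_left)
    \<comment> \<open>Double counting of the edges: each z is copied once for every y linked to it,
      hence at most m times.\<close>
    also have "(\<Sum>y\<in>X k. \<Sum>z\<in>{z \<in> X (Suc k). linked k y z}. sg j (Suc k) z)
       = (\<Sum>z\<in>X (Suc k). \<Sum>y\<in>{y \<in> X k. linked k y z}. sg j (Suc k) z)"
      by (rule sum.swap_restrict) (use f in auto)
    also have "\<dots> \<le> (\<Sum>z\<in>X (Suc k). m * sg j (Suc k) z)"
      using m[of k] Suc.prems by (intro sum_mono) auto
    also have "\<dots> = m * (\<Sum>z\<in>X (Suc k). sg j (Suc k) z)"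
      by (simp add: sum_distrib_left)
    also have "\<dots> \<le> m * ((\<Sum>i\<le>j. m ^ i * card (X (Suc k + i))) * ?c1)"
      using Suc by (intro mult_left_mono Suc.IH) auto
    also have "card (X k) * ?c1 + m * ((\<Sum>i\<le>j. m ^ i * card (X (Suc k + i))) * ?c1)
       = (\<Sum>i\<le>Suc j. m ^ i * card (X (k + i))) * ?c1"
      by (subst sum.atMost_Suc_shift) (simp add: algebra_simps sum_distrib_left)
    finally show ?case by simp
  qed
  define T where "T = search_tree (map (\<lambda>y. (te 0 y, node_tree K 0 y)) (list_of (X 0))) 0"
  have f: "finite (X 0)" using fin by auto
  have 1: "query T x = F x" if "x \<in> \<Omega>" for x
  proof -
    have "ct_eval (search_tree (map (\<lambda>y. (te 0 y, node_tree K 0 y)) (list_of (X 0))) (length ([] :: real list))) x [] = F x"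
      using cor[of x 0 K] cover[of x 0] that by (intro search_tree_correct) (auto simp: list_of f)
    then show ?thesis by (simp add: query_def T_def)
  qed
  have "ct_depth T \<le> length (map (\<lambda>y. (te 0 y, node_tree K 0 y)) (list_of (X 0))) * (c + 1) + (K * (b * (c + 1)) + s)"
    unfolding T_def using dep[of 0 K] te[of 0] by (intro ct_depth_search_tree) (auto simp: list_of f)
  also have "\<dots> \<le> b * (c + 1) + (K * (b * (c + 1)) + s)"
    using b0 by (intro add_right_mono mult_right_mono) (auto simp: length_list_of f)
  finally have 2: "ct_depth T \<le> (K + 1) * (b * (c + 1)) + s" by simp
  have "ct_size T \<le> 1 + (\<Sum>y\<leftarrow>list_of (X 0). c + 1 + sg K 0 y)"
    unfolding T_def using siz[of 0 K] te[of 0] by (intro ct_size_search_tree) (auto simp: list_of f)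
  also have "\<dots> = 1 + card (X 0) * (c + 1) + (\<Sum>y\<in>X 0. sg K 0 y)"
    by (simp only: sum_list_of[OF f] sum.distrib sum_constant of_nat_id distrib_left add.assoc)
  also have "\<dots> \<le> 1 + b * (c + 1) + (\<Sum>i\<le>K. m ^ i * card (X (0 + i))) * ?c1"
    using tot[of 0 K] b0 by (intro add_mono mult_right_mono) auto
  also have "\<dots> \<le> ?c1 * (1 + (\<Sum>i\<le>K. m ^ i * card (X i)))"
    by (simp add: algebra_simps)
  finally have 3: "ct_size T \<le> ?c1 * (1 + (\<Sum>i\<le>K. m ^ i * card (X i)))" .
  show ?thesis using 1 2 3 by blast
qed

end

primrec compile_list :: "'n cexpr list \<Rightarrow> nat \<Rightarrow> 'n ctree \<Rightarrow> 'n ctree" where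
  "compile_list [] n t = t"
| "compile_list (e # es) n t = compile e n (compile_list es (n + code_size e) t)"

text \<open>Each compiled expression fills a block of registers whose last entry is its value; hence
  \<open>Suc k\<close> blocks minus one.\<close>

definition code_pos :: "nat \<Rightarrow> 'n cexpr list \<Rightarrow> nat \<Rightarrow> nat" where
  "code_pos n es k = n + (\<Sum>e\<leftarrow>take (Suc k) es. code_size e) - 1"

lemma compile_list_correct:
  "\<exists>vs. length vs = (\<Sum>e\<leftarrow>es. code_size e) \<and> (\<forall>t. ct_eval (compile_list es (length rs) t) x rs = ct_eval t x (rs @ vs))
     \<and> (\<forall>k<length es. reg (rs @ vs) (code_pos (length rs) es k) = ceval (es ! k) x)"
proof (induction es arbitrary: rs)
  case (Cons e es)
  obtain u where u: "length u = code_size e" "u ! (code_size e - 1) = ceval e x"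
    "\<And>t. ct_eval (compile e (length rs) t) x rs = ct_eval t x (rs @ u)"
    using compile_correct[of e x rs] by blast
  obtain v where v: "length v = (\<Sum>e\<leftarrow>es. code_size e)"
    "\<And>t. ct_eval (compile_list es (length (rs @ u)) t) x (rs @ u) = ct_eval t x ((rs @ u) @ v)"
    "\<And>k. k < length es \<Longrightarrow> reg ((rs @ u) @ v) (code_pos (length (rs @ u)) es k) = ceval (es ! k) x"
    using Cons.IH[of "rs @ u"] by blast
  have "reg (rs @ u @ v) (code_pos (length rs) (e # es) k) = ceval ((e # es) ! k) x" if k: "k < length (e # es)" for k
  proof (cases k)
    case 0
    have "reg (rs @ u @ v) (length rs + (code_size e - 1)) = ceval e x"
      using reg_append[of "code_size e - 1" u rs v] u code_size_pos[of e] by simp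
    then show ?thesis using 0 code_size_pos[of e] by (simp add: code_pos_def)
  next
    case (Suc j)
    then show ?thesis using v(3)[of j] k u(1) by (simp add: code_pos_def add.assoc)
  qed
  then show ?case
    by (intro exI[of _ "u @ v"]) (use u v in auto)
qed simp

lemma ct_depth_compile_list: "ct_depth (compile_list es n t) = (\<Sum>e\<leftarrow>es. code_size e) + ct_depth t"
  by (induction es arbitrary: n) (auto simp: ct_depth_compile)

lemma ct_size_compile_list: "ct_size (compile_list es n t) = (\<Sum>e\<leftarrow>es. code_size e) + ct_size t"
  by (induction es arbitrary: n) (auto simp: ct_size_compile)

definition list_index :: "'n::finite \<Rightarrow> nat" where
  "list_index i = (SOME k. k < CARD('n) \<and> univ_list ! k = i)"

lemma list_index: "list_index (i::'n::finite) < CARD('n)" "univ_list ! list_index i = i"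
proof -
  have "i \<in> set univ_list" by (simp add: list_of)
  then have "\<exists>k. k < CARD('n) \<and> univ_list ! k = i"
    by (metis in_set_conv_nth length_univ_list)
  from someI_ex[OF this] show "list_index i < CARD('n)" "univ_list ! list_index i = i"
    unfolding list_index_def by auto
qed

definition leaf_tree :: "'n::finite sexpr \<Rightarrow> nat \<Rightarrow> 'n ctree" where
  "leaf_tree e n = (let es = translate e # map (\<lambda>i. translate (sderiv i e)) univ_list
     in compile_list es n (Out (code_pos n es 0) (\<lambda>i. code_pos n es (Suc (list_index i)))))"

lemma leaf_tree_correct:
  "ct_eval (leaf_tree e (length rs)) x rs = (seval e x, \<chi> i. seval (sderiv i e) x)"
proof -
  define es where "es = translate e # map (\<lambda>i. translate (sderiv i e)) univ_list"
  obtain vs where vs: "\<And>t. ct_eval (compile_list es (length rs) t) x rs = ct_eval t x (rs @ vs)"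
    "\<And>k. k < length es \<Longrightarrow> reg (rs @ vs) (code_pos (length rs) es k) = ceval (es ! k) x"
    using compile_list_correct[of es rs x] by blast
  have l: "length es = Suc CARD('a)" by (simp add: es_def length_univ_list)
  have 0: "reg (rs @ vs) (code_pos (length rs) es 0) = seval e x"
    using vs(2)[of 0] l by (simp add: es_def ceval_translate)
  have 1: "reg (rs @ vs) (code_pos (length rs) es (Suc (list_index i))) = seval (sderiv i e) x" for i
    using vs(2)[of "Suc (list_index i)"] l list_index[of i] by (simp add: es_def ceval_translate length_univ_list)
  show ?thesis by (simp add: leaf_tree_def Let_def vs(1) 0 1 flip: es_def)
qed

lemma leaf_tree_size:
  fixes e :: "'n::finite sexpr"
  assumes "code_size (translate e) \<le> s"
  shows "ct_depth (leaf_tree e n) \<le> s + CARD('n) * (20 * s\<^sup>2) + 1" "ct_size (leaf_tree e n) \<le> s + CARD('n) * (20 * s\<^sup>2) + 1"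
proof -
  have "(code_size (translate e))\<^sup>2 \<le> s\<^sup>2" using assms by (rule power_mono) simp
  then have "code_size (translate (sderiv i e)) \<le> 20 * s\<^sup>2" for i
    using code_size_translate_sderiv[of i e] by linarith
  then have "(\<Sum>i\<leftarrow>univ_list. code_size (translate (sderiv i e))) \<le> (\<Sum>i\<leftarrow>(univ_list :: 'n list). 20 * s\<^sup>2)"
    by (intro sum_list_mono) auto
  also have "\<dots> = CARD('n) * (20 * s\<^sup>2)" by (simp add: sum_list_triv length_univ_list)
  finally have "(\<Sum>i\<leftarrow>univ_list. code_size (translate (sderiv i e))) \<le> CARD('n) * (20 * s\<^sup>2)" .
  then show "ct_depth (leaf_tree e n) \<le> s + CARD('n) * (20 * s\<^sup>2) + 1" "ct_size (leaf_tree e n) \<le> s + CARD('n) * (20 * s\<^sup>2) + 1"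
    using assms by (simp_all add: leaf_tree_def Let_def ct_depth_compile_list ct_size_compile_list ct_depth_compile ct_size_compile comp_def)
qed

lemma code_size_translate_ssum: "code_size (translate (ssum es)) = (\<Sum>e\<leftarrow>es. code_size (translate e)) + length es + 1"
  by (induction es) auto


section \<open>Volumes of linear images and packings\<close>

text \<open>The change-of-variables theorems of the library need a well-ordered index type; we transport
  them to an arbitrary finite index type along a well-ordered copy.\<close>

typedef 'a wcopy = "UNIV :: 'a set" by simp

lemma bij_Rep_wcopy: "bij Rep_wcopy"
  by (meson bijI Rep_wcopy_inject injI Abs_wcopy_inverse UNIV_I surjI)

instance wcopy :: (finite) finite
proof
  show "finite (UNIV :: 'a wcopy set)"
    using bij_betw_finite[OF bij_Rep_wcopy[where 'a = 'a]] by simp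
qed

instantiation wcopy :: (finite) wellorder
begin

definition "x \<le> y \<longleftrightarrow> to_nat (Rep_wcopy x) \<le> to_nat (Rep_wcopy y)"
definition "x < y \<longleftrightarrow> to_nat (Rep_wcopy x) < to_nat (Rep_wcopy y)"

instance
proof
  fix P :: "'a wcopy \<Rightarrow> bool" and a
  assume "\<And>x. (\<And>y. y < x \<Longrightarrow> P y) \<Longrightarrow> P x"
  then show "P a"
    unfolding less_wcopy_def by (rule measure_induct_rule[where f = "\<lambda>x. to_nat (Rep_wcopy x)"])
qed (auto simp: less_eq_wcopy_def less_wcopy_def Rep_wcopy_inject)

end

definition to_w :: "real^'n::finite \<Rightarrow> real^'n wcopy" where
  "to_w x = (\<chi> j. x $ Rep_wcopy j)"

lemma linear_to_w: "linear to_w"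
  by (rule linearI) (auto simp: to_w_def vec_eq_iff)

lemma continuous_on_to_w: "continuous_on S to_w"
  using linear_to_w by (intro linear_continuous_on) (simp add: linear_conv_bounded_linear)

lemma inj_to_w: "inj to_w"
proof (rule injI)
  fix x y :: "real^'n" assume "to_w x = to_w y"
  then have "x $ Rep_wcopy (Abs_wcopy i) = y $ Rep_wcopy (Abs_wcopy i)" for i
    by (metis to_w_def vec_lambda_beta)
  then show "x = y" by (simp add: vec_eq_iff Abs_wcopy_inverse)
qed

lemma prod_Basis_cart:
  fixes x :: "real^'n::finite"
  shows "(\<Prod>b\<in>Basis. x \<bullet> b) = (\<Prod>i\<in>UNIV. x $ i)"
proof -
  have B: "(Basis :: (real^'n) set) = (\<lambda>i. axis i 1) ` UNIV" by (auto simp: Basis_vec_def)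
  have inj: "inj (\<lambda>i::'n. axis i (1::real))" by (auto simp: inj_on_def axis_eq_axis)
  show ?thesis unfolding B prod.reindex[OF inj] by (simp add: inner_axis)
qed

text \<open>Relabelling coordinates takes boxes to boxes with the same side lengths, and Lebesgue
  measure is determined by boxes.\<close>

lemma lborel_to_w: "lborel = distr (lborel :: (real^'n::finite) measure) borel to_w"
proof (rule lborel_eqI)
  fix l u :: "real^'n wcopy"
  assume le: "\<And>b. b \<in> Basis \<Longrightarrow> l \<bullet> b \<le> u \<bullet> b"
  have le': "l $ j \<le> u $ j" for j using le[of "axis j 1"] by (simp add: inner_axis axis_in_Basis_iff)
  define l' u' :: "real^'n" where "l' = (\<chi> i. l $ Abs_wcopy i)" and "u' = (\<chi> i. u $ Abs_wcopy i)"
  have sur: "\<exists>j. i = Rep_wcopy j" for i :: 'n by (metis Abs_wcopy_inverse UNIV_I)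
  have pre: "to_w -` box l u = box l' u'"
  proof (rule set_eqI)
    fix x :: "real^'n"
    have "(\<forall>j. l $ j < x $ Rep_wcopy j \<and> x $ Rep_wcopy j < u $ j) \<longleftrightarrow>
      (\<forall>i. l $ Abs_wcopy i < x $ i \<and> x $ i < u $ Abs_wcopy i)"
      using sur by (metis Rep_wcopy_inverse)
    then show "x \<in> to_w -` box l u \<longleftrightarrow> x \<in> box l' u'"
      by (simp add: mem_box_cart to_w_def l'_def u'_def)
  qed
  have meas: "to_w \<in> measurable lborel borel"
    using borel_measurable_continuous_onI[OF continuous_on_to_w] by simp
  have "emeasure (distr lborel borel to_w) (box l u) = emeasure lborel (box l' u')"
    by (subst emeasure_distr[OF meas]) (simp_all add: pre)
  also have "\<dots> = (\<Prod>b\<in>Basis. (u' - l') \<bullet> b)"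
    by (rule emeasure_lborel_box) (use le' in \<open>auto simp: Basis_vec_def inner_axis l'_def u'_def\<close>)
  also have "(\<Prod>b\<in>Basis. (u' - l') \<bullet> b) = (\<Prod>i\<in>UNIV. (u' - l') $ i)"
    by (simp only: prod_Basis_cart)
  also have "\<dots> = (\<Prod>j\<in>UNIV. (u - l) $ j)"
    by (subst prod.reindex_bij_betw[OF bij_Rep_wcopy, symmetric]) (simp add: l'_def u'_def Rep_wcopy_inverse)
  also have "\<dots> = (\<Prod>b\<in>Basis. (u - l) \<bullet> b)"
    by (simp only: prod_Basis_cart)
  finally show "emeasure (distr lborel borel to_w) (box l u) = ennreal (\<Prod>b\<in>Basis. (u - l) \<bullet> b)" .
qed simp

lemma measure_to_w:
  assumes "compact S"
  shows "measure lebesgue (to_w ` S) = measure lebesgue S"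
proof -
  have c: "compact (to_w ` S)" by (rule compact_continuous_image[OF continuous_on_to_w assms])
  have b: "to_w ` S \<in> sets borel" "S \<in> sets borel"
    using compact_imp_closed[OF c] compact_imp_closed[OF assms] by auto
  have meas: "to_w \<in> measurable lborel borel"
    using borel_measurable_continuous_onI[OF continuous_on_to_w] by simp
  have "measure lebesgue (to_w ` S) = measure lborel (to_w ` S)" using b by simp
  also have "\<dots> = measure (distr lborel borel to_w) (to_w ` S)" by (simp flip: lborel_to_w)
  also have "\<dots> = measure lborel (to_w -` (to_w ` S) \<inter> space lborel)"
    by (rule measure_distr[OF meas b(1)])
  also have "to_w -` (to_w ` S) \<inter> space lborel = S" by (simp add: inj_vimage_image_eq[OF inj_to_w])
  finally show ?thesis using b by simp
qed

definition mat_w :: "real^'n::finite^'n \<Rightarrow> real^'n wcopy^'n wcopy" where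
  "mat_w A = (\<chi> i j. A $ Rep_wcopy i $ Rep_wcopy j)"

lemma to_w_mult: "to_w (A *v x) = mat_w A *v to_w x"
proof -
  have "(\<Sum>j\<in>UNIV. A $ Rep_wcopy i $ j * x $ j) =
     (\<Sum>j\<in>UNIV. A $ Rep_wcopy i $ Rep_wcopy j * x $ Rep_wcopy j)" for i
    by (rule sum.reindex_bij_betw[OF bij_Rep_wcopy, symmetric])
  then show ?thesis by (simp add: vec_eq_iff to_w_def mat_w_def matrix_vector_mult_def)
qed

text \<open>Volume scaling factor of a matrix, i.e. the absolute value of its determinant.\<close>
definition vol_factor :: "real^'n::finite^'n \<Rightarrow> real" where
  "vol_factor A = \<bar>det (mat_w A)\<bar>"

lemma measure_matrix_image:
  assumes "compact S"
  shows "measure lebesgue ((\<lambda>x. A *v x) ` S) = vol_factor A * measure lebesgue S"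
proof -
  have c: "compact ((\<lambda>x. A *v x) ` S)"
    by (intro compact_continuous_image assms matrix_vector_mult_linear_continuous_on)
  have "measure lebesgue ((\<lambda>x. A *v x) ` S) = measure lebesgue (to_w ` (\<lambda>x. A *v x) ` S)"
    by (rule measure_to_w[OF c, symmetric])
  also have "to_w ` (\<lambda>x. A *v x) ` S = (\<lambda>y. mat_w A *v y) ` (to_w ` S)"
    by (simp add: image_image to_w_mult)
  also have "measure lebesgue \<dots> = vol_factor A * measure lebesgue (to_w ` S)"
    using measure_linear_image[of "\<lambda>y. mat_w A *v y" "to_w ` S"]
    by (simp add: vol_factor_def lmeasurable_compact compact_continuous_image[OF continuous_on_to_w assms])
  finally show ?thesis by (simp add: measure_to_w[OF assms])
qed

lemma vol_factor_transpose: "vol_factor (transpose A) = vol_factor A"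
proof -
  have "mat_w (transpose A) = transpose (mat_w A)" by (simp add: vec_eq_iff mat_w_def transpose_def)
  then show ?thesis by (simp add: vol_factor_def det_transpose)
qed

lemma vol_factor_mult: "vol_factor (A ** B) = vol_factor A * vol_factor B"
proof -
  have "(\<Sum>k\<in>UNIV. A $ i $ k * B $ k $ j) = (\<Sum>k\<in>UNIV. A $ i $ Rep_wcopy k * B $ Rep_wcopy k $ j)" for i j
    by (rule sum.reindex_bij_betw[OF bij_Rep_wcopy, symmetric])
  then have "mat_w (A ** B) = mat_w A ** mat_w B"
    by (simp add: vec_eq_iff mat_w_def matrix_matrix_mult_def)
  then show ?thesis by (simp add: vol_factor_def det_mul abs_mult)
qed

lemma vol_factor_mat_1: "vol_factor (mat 1 :: real^'n::finite^'n) = 1"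
proof -
  have "mat_w (mat 1 :: real^'n^'n) = mat 1" by (simp add: vec_eq_iff mat_w_def mat_def Rep_wcopy_inject)
  then show ?thesis by (simp add: vol_factor_def)
qed

lemma det_scaleR: "det (c *\<^sub>R A) = c ^ CARD('n) * det A" for A :: "real^'n^'n"
proof -
  have "c *\<^sub>R A = (\<chi> i. c *s A $ i)" by (simp add: vec_eq_iff)
  then show ?thesis using det_rows_mul[of "\<lambda>_. c" "\<lambda>i. A $ i"] by (simp add: vec_lambda_eta)
qed

lemma vol_factor_scaleR: "vol_factor (c *\<^sub>R A) = \<bar>c\<bar> ^ CARD('n) * vol_factor A" for A :: "real^'n::finite^'n"
proof -
  have "mat_w (c *\<^sub>R A) = c *\<^sub>R mat_w A" by (simp add: vec_eq_iff mat_w_def)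
  moreover have "CARD('n wcopy) = CARD('n)" using bij_betw_same_card[OF bij_Rep_wcopy] by simp
  ultimately show ?thesis by (simp add: vol_factor_def det_scaleR abs_mult power_abs)
qed

section \<open>Packing and overlap bounds\<close>

abbreviation unit_vol :: "'n::finite itself \<Rightarrow> real" where
  "unit_vol _ \<equiv> measure lebesgue (cball (0 :: real^'n) 1)"

lemma measure_cball: "0 \<le> r \<Longrightarrow> measure lebesgue (cball c r) = r ^ CARD('n) * unit_vol TYPE('n)"
  for c :: "real^'n"
  using content_ball_conv_unit_ball[of r c]
  by (simp add: content_cball_conv_ball)

lemma unit_vol_pos: "0 < unit_vol TYPE('n::finite)"
  using content_cball_pos[of 1 "0 :: real^'n"] by simp

text \<open>Balls of radius \<sigma>/2 about the points are disjoint and lie in the ball of radius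
  \<alpha> + \<sigma>/2 about c; compare volumes.\<close>

lemma card_separated_le:
  fixes S :: "(real^'n) set"
  assumes "finite S" "0 < \<sigma>" "0 \<le> \<alpha>" and near: "\<And>x. x \<in> S \<Longrightarrow> norm (x - c) \<le> \<alpha>"
    and sep: "\<And>x y. x \<in> S \<Longrightarrow> y \<in> S \<Longrightarrow> x \<noteq> y \<Longrightarrow> \<sigma> < norm (x - y)"
  shows "real (card S) \<le> (1 + 2 * \<alpha> / \<sigma>) ^ CARD('n)"
proof -
  let ?w = "unit_vol TYPE('n)"
  have "disjnt (cball x (\<sigma>/2)) (cball y (\<sigma>/2))" if "x \<in> S" "y \<in> S" "x \<noteq> y" for x y
  proof -
    have "norm (x - y) \<le> \<sigma>" if "norm (x - z) \<le> \<sigma>/2" "norm (y - z) \<le> \<sigma>/2" for z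
      using norm_triangle_ineq4[of "x - z" "y - z"] that by simp
    then show ?thesis using sep[OF that] by (fastforce simp: disjnt_iff dist_norm)
  qed
  then have "measure lebesgue (\<Union>x\<in>S. cball x (\<sigma>/2)) = (\<Sum>x\<in>S. measure lebesgue (cball x (\<sigma>/2)))"
    using assms(1) by (intro measure_UNION') (auto simp: pairwise_def)
  also have "\<dots> = card S * ((\<sigma>/2) ^ CARD('n) * ?w)"
  proof -
    have "measure lebesgue (cball x (\<sigma>/2)) = (\<sigma>/2) ^ CARD('n) * ?w" for x :: "real^'n"
      using assms(2) by (intro measure_cball) simp
    then show ?thesis by (simp only: sum_constant)
  qed
  finally have "card S * ((\<sigma>/2) ^ CARD('n) * ?w) = measure lebesgue (\<Union>x\<in>S. cball x (\<sigma>/2))" ..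
  also have "\<dots> \<le> measure lebesgue (cball c (\<alpha> + \<sigma>/2))"
  proof (rule measure_mono_fmeasurable)
    show "(\<Union>x\<in>S. cball x (\<sigma>/2)) \<subseteq> cball c (\<alpha> + \<sigma>/2)"
    proof (intro UN_least subsetI)
      fix x y assume "x \<in> S" "y \<in> cball x (\<sigma>/2)"
      then show "y \<in> cball c (\<alpha> + \<sigma>/2)"
        using near[of x] dist_triangle[of c y x] by (simp add: dist_norm norm_minus_commute)
    qed
    show "(\<Union>x\<in>S. cball x (\<sigma>/2)) \<in> sets lebesgue"
      using assms(1) by (intro sets.finite_UN fmeasurableD) auto
  qed auto
  also have "\<dots> = (\<alpha> + \<sigma>/2) ^ CARD('n) * ?w" using assms(2,3) by (intro measure_cball) simp
  finally have "card S * (\<sigma>/2) ^ CARD('n) \<le> (\<alpha> + \<sigma>/2) ^ CARD('n)"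
    using unit_vol_pos[where 'n = 'n] by (simp flip: mult.assoc)
  then have "card S \<le> (\<alpha> + \<sigma>/2) ^ CARD('n) / (\<sigma>/2) ^ CARD('n)"
    using assms(2) by (subst pos_le_divide_eq) auto
  also have "\<dots> = ((\<alpha> + \<sigma>/2) / (\<sigma>/2)) ^ CARD('n)" by (simp only: power_divide)
  also have "(\<alpha> + \<sigma>/2) / (\<sigma>/2) = 1 + 2 * \<alpha> / \<sigma>" using assms(2) by (simp add: field_simps)
  finally show ?thesis .
qed

text \<open>Integrate the multiplicity function, the sum of the indicators, which is at most m on U
  and 0 elsewhere.\<close>

lemma sum_measure_overlap_le:
  fixes A :: "'i \<Rightarrow> ('a::euclidean_space) set"
  assumes "finite I" "\<And>i. i \<in> I \<Longrightarrow> A i \<in> lmeasurable" "\<And>i. i \<in> I \<Longrightarrow> A i \<subseteq> U" "U \<in> lmeasurable"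
    and m: "\<And>p. p \<in> U \<Longrightarrow> real (card {i \<in> I. p \<in> A i}) \<le> m"
  shows "(\<Sum>i\<in>I. measure lebesgue (A i)) \<le> m * measure lebesgue U"
proof -
  have "(\<Sum>i\<in>I. measure lebesgue (A i)) = (\<Sum>i\<in>I. \<integral>p. indicator (A i) p \<partial>lebesgue)"
    by simp
  also have "\<dots> = (\<integral>p. (\<Sum>i\<in>I. indicator (A i) p) \<partial>lebesgue)"
    by (rule Bochner_Integration.integral_sum[symmetric]) (use assms(2) in \<open>simp add: lmeasurable_iff_integrable\<close>)
  also have "\<dots> \<le> (\<integral>p. m * indicator U p \<partial>lebesgue)"
  proof (rule integral_mono)
    show "integrable lebesgue (\<lambda>p. \<Sum>i\<in>I. indicator (A i) p :: real)"
      using assms(2) by (intro Bochner_Integration.integrable_sum) (simp add: lmeasurable_iff_integrable)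
    show "integrable lebesgue (\<lambda>p. m * indicator U p)"
      using assms(4) by (intro integrable_mult_right) (simp add: lmeasurable_iff_integrable)
    fix p
    have "(\<Sum>i\<in>I. indicator (A i) p :: real) = real (card {i \<in> I. p \<in> A i})"
      using assms(1) by (simp add: indicator_def sum.If_cases Int_def)
    also have "\<dots> \<le> m * indicator U p"
    proof (cases "p \<in> U")
      case False
      then have "{i \<in> I. p \<in> A i} = {}" using assms(3) by auto
      then show ?thesis using False by (simp only: card.empty) simp
    qed (use m in simp)
    finally show "(\<Sum>i\<in>I. indicator (A i) p) \<le> m * indicator U p" .
  qed
  finally show ?thesis by simp
qed


section \<open>The signed distance function and its Macbeath regions\<close>

text \<open>The witness is the supremum of u \<bullet> x - h u over unit vectors u, with h the
  support function of \<Omega>. A maximizing u is a unit subgradient at x. On \<Omega>, a supporting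
  normal at the nearest frontier point gives one inequality. Outside, the direction of y - x0 gives
  growth at unit rate.\<close>

lemma signed_distance_exists:
  fixes \<Omega> :: "(real^'n) set"
  assumes "convex \<Omega>" "compact \<Omega>" "x0 \<in> \<Omega>" and diam: "\<And>x y. x \<in> \<Omega> \<Longrightarrow> y \<in> \<Omega> \<Longrightarrow> norm (x - y) \<le> 1"
    and "interior \<Omega> \<noteq> {}"
  shows "\<exists>\<phi>::real^'n \<Rightarrow> real. (\<forall>x. \<exists>u. norm u = 1 \<and> (\<forall>y. \<phi> x + u \<bullet> (y - x) \<le> \<phi> y)) \<and>
    (\<forall>x\<in>\<Omega>. \<phi> x = - bdist \<Omega> x) \<and> (\<forall>y. norm (y - x0) - 1 \<le> \<phi> y)"
proof -
  have ne: "\<Omega> \<noteq> {}" using assms by auto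
  define h where "h u = Sup ((\<lambda>y. u \<bullet> y) ` \<Omega>)" for u :: "real^'n"
  have cimg: "compact ((\<lambda>y. u \<bullet> y) ` \<Omega>)" for u :: "real^'n"
    by (intro compact_continuous_image continuous_intros assms)
  have hle: "u \<bullet> y \<le> h u" if "y \<in> \<Omega>" for u y
    unfolding h_def using that bounded_imp_bdd_above[OF compact_imp_bounded[OF cimg]]
    by (intro cSup_upper) auto
  have hatt: "\<exists>y\<in>\<Omega>. h u = u \<bullet> y" for u
    using compact_attains_sup[OF cimg[of u]] ne hle h_def
    by (smt (verit) cSup_eq_maximum image_iff image_is_empty)
  obtain R where R: "\<And>y. y \<in> \<Omega> \<Longrightarrow> norm y \<le> R"
    using compact_imp_bounded[OF assms(2)] bounded_iff by blast
  have hlip: "h u - h v \<le> R * norm (u - v)" for u v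
  proof -
    obtain y where y: "y \<in> \<Omega>" "h u = u \<bullet> y" using hatt by blast
    have "h u - h v \<le> (u - v) \<bullet> y" using y hle[of y v] by (simp add: inner_diff_left)
    also have "\<dots> \<le> norm (u - v) * norm y" by (rule norm_cauchy_schwarz)
    also have "\<dots> \<le> norm (u - v) * R" using R[OF y(1)] by (intro mult_left_mono) auto
    finally show ?thesis by (simp add: mult.commute)
  qed
  have "R-lipschitz_on UNIV h"
  proof (rule lipschitz_onI)
    fix u v :: "real^'n"
    show "dist (h u) (h v) \<le> R * dist u v"
      using hlip[of u v] hlip[of v u] by (simp add: dist_norm abs_if norm_minus_commute)
    show "0 \<le> R" using R[OF assms(3)] norm_ge_zero order_trans by blast
  qed
  then have hcont: "continuous_on S h" for S
    using lipschitz_on_continuous_on continuous_on_subset by blast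
  let ?S = "sphere (0::real^'n) 1"
  define \<phi> where "\<phi> x = Sup ((\<lambda>u. u \<bullet> x - h u) ` ?S)" for x
  have cS: "compact ((\<lambda>u. u \<bullet> x - h u) ` ?S)" for x
    by (intro compact_continuous_image continuous_intros hcont) auto
  have Sne: "?S \<noteq> {}" by simp
  have \<phi>ge: "u \<bullet> x - h u \<le> \<phi> x" if "norm u = 1" for u x
    unfolding \<phi>_def using that bounded_imp_bdd_above[OF compact_imp_bounded[OF cS]]
    by (intro cSup_upper) auto
  have \<phi>att: "\<exists>u. norm u = 1 \<and> \<phi> x = u \<bullet> x - h u" for x
  proof -
    obtain s where s: "s \<in> (\<lambda>u. u \<bullet> x - h u) ` ?S" "\<And>t. t \<in> (\<lambda>u. u \<bullet> x - h u) ` ?S \<Longrightarrow> t \<le> s"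
      using compact_attains_sup[OF cS[of x]] by (auto simp: Sne)
    then have "\<phi> x = s" unfolding \<phi>_def by (intro cSup_eq_maximum) auto
    then show ?thesis using s(1) by auto
  qed
  have 1: "\<exists>u. norm u = 1 \<and> (\<forall>y. \<phi> x + u \<bullet> (y - x) \<le> \<phi> y)" for x
  proof -
    obtain u where u: "norm u = 1" "\<phi> x = u \<bullet> x - h u" using \<phi>att by blast
    then show ?thesis using \<phi>ge[OF u(1)] by (intro exI[of _ u]) (auto simp: inner_diff_right)
  qed
  have 2: "\<phi> x = - bdist \<Omega> x" if x: "x \<in> \<Omega>" for x
  proof (rule antisym)
    have "frontier \<Omega> \<noteq> {}" using ne assms(2) by (metis compact_imp_bounded frontier_eq_empty not_bounded_UNIV)
    then obtain y where y: "y \<in> frontier \<Omega>" "infdist x (frontier \<Omega>) = dist x y"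
      using infdist_attains_inf[of "frontier \<Omega>" x] by auto
    have yO: "y \<in> \<Omega>" using y(1) assms(2) compact_imp_closed frontier_subset_closed by blast
    obtain a where a: "a \<noteq> 0" "\<And>z. z \<in> \<Omega> \<Longrightarrow> a \<bullet> z \<le> a \<bullet> y"
    proof -
      have "rel_interior \<Omega> = interior \<Omega>" using assms(5) by (rule rel_interior_nonempty_interior)
      then have "y \<in> closure \<Omega>" "y \<notin> rel_interior \<Omega>" using y(1) by (auto simp: frontier_def)
      then obtain a where "a \<noteq> 0" "\<And>z. z \<in> closure \<Omega> \<Longrightarrow> a \<bullet> y \<le> a \<bullet> z"
        using supporting_hyperplane_relative_frontier[OF assms(1)] by metis
      then show ?thesis using that[of "-a"] closure_subset[of \<Omega>] by auto
    qed
    define u where "u = a /\<^sub>R norm a"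
    have u: "norm u = 1" using a by (simp add: u_def)
    obtain z where z: "z \<in> \<Omega>" "h u = u \<bullet> z" using hatt by blast
    have "h u = u \<bullet> y"
      using z hle[OF yO, of u] a(2)[OF z(1)] a(1) by (simp add: u_def divide_simps mult_le_cancel_left)
    then have "\<phi> x \<ge> - (u \<bullet> (y - x))" using \<phi>ge[OF u, of x] by (simp add: inner_diff_right)
    moreover have "u \<bullet> (y - x) \<le> norm u * norm (y - x)" by (rule norm_cauchy_schwarz)
    ultimately show "- bdist \<Omega> x \<le> \<phi> x"
      using y u by (simp add: bdist_def dist_norm norm_minus_commute)
    obtain u where u: "norm u = 1" "\<phi> x = u \<bullet> x - h u" using \<phi>att by blast
    \<comment> \<open>Beyond the length \<open>h u - u \<bullet> x\<close> the ray from x along the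
      maximizing u has left \<Omega>, so it has met the frontier.\<close>
    have "infdist x (frontier \<Omega>) \<le> s" if s: "h u - u \<bullet> x < s" for s
    proof -
      have uu: "u \<bullet> u = 1" using u by (simp add: dot_square_norm)
      have s0: "0 \<le> s" using hle[OF x, of u] s by linarith
      have "x + s *\<^sub>R u \<notin> \<Omega>" using hle[of "x + s *\<^sub>R u" u] s uu by (auto simp: inner_add_right)
      then have "closed_segment x (x + s *\<^sub>R u) \<inter> frontier \<Omega> \<noteq> {}"
        using x by (intro connected_Int_frontier) auto
      then obtain w where w: "w \<in> closed_segment x (x + s *\<^sub>R u)" "w \<in> frontier \<Omega>" by auto
      have "infdist x (frontier \<Omega>) \<le> dist x w" using w by (intro infdist_le)
      also have "\<dots> \<le> dist x (x + s *\<^sub>R u)"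
        using w(1) by (metis dist_in_closed_segment dist_commute)
      also have "\<dots> = s" using u s0 by (simp add: dist_norm)
      finally show ?thesis .
    qed
    then have "infdist x (frontier \<Omega>) \<le> h u - u \<bullet> x" by (rule dense_ge) 
    then show "\<phi> x \<le> - bdist \<Omega> x" using u by (simp add: bdist_def)
  qed
  have 3: "norm (y - x0) - 1 \<le> \<phi> y" for y
  proof -
    obtain u where u: "norm u = 1" "norm (y - x0) = u \<bullet> (y - x0)"
    proof (cases "y = x0")
      case True
      then show ?thesis using that[of "axis undefined 1"] by (simp add: norm_axis_1)
    next
      case False
      then show ?thesis using that[of "(y - x0) /\<^sub>R norm (y - x0)"]
        by (simp add: dot_square_norm power2_eq_square)
    qed
    obtain z where z: "z \<in> \<Omega>" "h u = u \<bullet> z" using hatt by blast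
    have "u \<bullet> (z - x0) \<le> norm u * norm (z - x0)" by (rule norm_cauchy_schwarz)
    then show ?thesis using diam[OF z(1) assms(3)] \<phi>ge[OF u(1), of y] u z
      by (simp add: inner_diff_right)
  qed
  show ?thesis using 1 2 3 by blast
qed

text \<open>All that is kept of the polytope; no facet occurs, so no constant below can depend on
  their number. Convexity is contained in \<open>subgradient\<close>, compactness of the level sets
  comes from \<open>growth\<close>.\<close>

locale signed_dist =
  fixes \<phi> :: "real^'n \<Rightarrow> real" and \<Omega> :: "(real^'n) set" and x0 :: "real^'n"
    and dm :: real
  assumes dm_eq: "dm = real CARD('n)"
    and subgradient: "\<exists>u. norm u = 1 \<and> (\<forall>y. \<phi> x + u \<bullet> (y - x) \<le> \<phi> y)"
    and growth: "norm (y - x0) - 1 \<le> \<phi> y"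
    and neg: "x \<in> \<Omega> \<Longrightarrow> \<phi> x \<le> 0" and near: "x \<in> \<Omega> \<Longrightarrow> norm (x - x0) \<le> 1"
begin

lemma lipschitz: "\<bar>\<phi> x - \<phi> y\<bar> \<le> norm (x - y)"
proof -
  have "\<phi> x - \<phi> y \<le> norm (x - y)" for x y
  proof -
    obtain u where u: "norm u = 1" "\<phi> x + u \<bullet> (y - x) \<le> \<phi> y" using subgradient by blast
    have "u \<bullet> (x - y) \<le> norm u * norm (x - y)" by (rule norm_cauchy_schwarz)
    then show ?thesis using u by (simp add: inner_diff_right)
  qed
  from this[of x y] this[of y x] show ?thesis by (simp add: abs_le_iff norm_minus_commute)
qed

lemma continuous: "continuous_on S \<phi>"
proof -
  have "1-lipschitz_on UNIV \<phi>"
    by (rule lipschitz_onI) (use lipschitz in \<open>auto simp: dist_norm\<close>)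
  then show ?thesis using lipschitz_on_continuous_on continuous_on_subset by blast
qed

lemma convex_combination:
  assumes "0 \<le> s" "0 \<le> t" "s + t = 1"
  shows "\<phi> (s *\<^sub>R x + t *\<^sub>R y) \<le> s * \<phi> x + t * \<phi> y"
proof -
  let ?z = "s *\<^sub>R x + t *\<^sub>R y"
  obtain u where u: "\<And>w. \<phi> ?z + u \<bullet> (w - ?z) \<le> \<phi> w" using subgradient[of ?z] by blast
  have "s * (\<phi> ?z + u \<bullet> (x - ?z)) + t * (\<phi> ?z + u \<bullet> (y - ?z)) \<le> s * \<phi> x + t * \<phi> y"
    using assms u by (intro add_mono mult_left_mono) auto
  moreover have "s * (\<phi> ?z + u \<bullet> (x - ?z)) + t * (\<phi> ?z + u \<bullet> (y - ?z))
     = (s + t) * \<phi> ?z + (u \<bullet> ?z - (s + t) * (u \<bullet> ?z))"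
    by (simp add: inner_diff_right inner_add_right algebra_simps)
  ultimately show ?thesis using assms(3) by simp
qed

text \<open>In contrast to the gap above a supporting function, this does not depend on the choice
  of a subgradient, and its level sets are centrally symmetric.\<close>

definition D :: "real^'n \<Rightarrow> real^'n \<Rightarrow> real" where
  "D x h = \<phi> (x + h) + \<phi> (x - h) - 2 * \<phi> x"

lemma D_minus [simp]: "D x (- h) = D x h"
  by (simp add: D_def)

lemma D_zero [simp]: "D x 0 = 0"
  by (simp add: D_def)

lemma D_nonneg: "0 \<le> D x h"
proof -
  obtain u where "\<And>y. \<phi> x + u \<bullet> (y - x) \<le> \<phi> y" using subgradient by blast
  from this[of "x + h"] this[of "x - h"] show ?thesis by (simp add: D_def)
qed

lemma D_le: "D x h \<le> 2 * norm h"
  using lipschitz[of "x + h" x] lipschitz[of "x - h" x] by (simp add: D_def)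

lemma D_continuous: "continuous_on S (D x)"
  unfolding D_def by (intro continuous_intros continuous_on_compose2[OF continuous[of UNIV]]) auto

lemma D_continuous': "continuous_on S (\<lambda>x. D x h)"
  unfolding D_def by (intro continuous_intros continuous_on_compose2[OF continuous[of UNIV]]) auto

lemma D_convex:
  assumes "0 \<le> s" "0 \<le> t" "s + t = 1"
  shows "D x (s *\<^sub>R h + t *\<^sub>R k) \<le> s * D x h + t * D x k"
proof -
  have "x + (s *\<^sub>R h + t *\<^sub>R k) = s *\<^sub>R (x + h) + t *\<^sub>R (x + k)"
    "x - (s *\<^sub>R h + t *\<^sub>R k) = s *\<^sub>R (x - h) + t *\<^sub>R (x - k)"
    using assms(3) by (auto simp: algebra_simps simp flip: scaleR_add_left)
  then have "D x (s *\<^sub>R h + t *\<^sub>R k) \<le> (s * \<phi> (x + h) + t * \<phi> (x + k)) + (s * \<phi> (x - h) + t * \<phi> (x - k)) - 2 * ((s + t) * \<phi> x)"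
    unfolding D_def using convex_combination[OF assms, of "x + h" "x + k"] convex_combination[OF assms, of "x - h" "x - k"] assms(3)
    by simp
  then show ?thesis by (simp add: D_def algebra_simps)
qed

lemma D_scale: "0 \<le> t \<Longrightarrow> t \<le> 1 \<Longrightarrow> D x (t *\<^sub>R h) \<le> t * D x h"
  using D_convex[of t "1 - t" x h 0] by simp

lemma D_growth: "2 * norm h - 2 * norm (x - x0) - 2 - 2 * \<phi> x \<le> D x h"
proof -
  have "norm h \<le> norm (x + h - x0) + norm (x - x0)" "norm h \<le> norm (x - h - x0) + norm (x - x0)"
    using norm_triangle_ineq4[of "x + h - x0" "x - x0"] norm_triangle_ineq4[of "x - x0" "x - h - x0"]
    by simp_all
  then show ?thesis using growth[of "x + h"] growth[of "x - h"] unfolding D_def by linarith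
qed

lemma D_level_set_convex: "convex {h. D x h \<le> \<delta>}"
proof (rule convexI)
  fix h k :: "real^'n" and s t :: real
  assume a: "h \<in> {h. D x h \<le> \<delta>}" "k \<in> {h. D x h \<le> \<delta>}" "0 \<le> s" "0 \<le> t" "s + t = 1"
  have "s * D x h + t * D x k \<le> s * \<delta> + t * \<delta>"
    using a by (intro add_mono mult_left_mono) auto
  also have "\<dots> = \<delta>" using a by (simp flip: distrib_right)
  finally show "s *\<^sub>R h + t *\<^sub>R k \<in> {h. D x h \<le> \<delta>}" using D_convex[OF a(3-5), of x h k] by simp
qed

lemma D_level_set_compact: "compact {h. D x h \<le> \<delta>}"
proof -
  have "closed {h. D x h \<le> \<delta>}"
    using D_continuous[of UNIV] by (intro closed_Collect_le) auto
  moreover have "bounded {h. D x h \<le> \<delta>}"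
  proof (rule boundedI)
    fix h assume "h \<in> {h. D x h \<le> \<delta>}"
    then show "norm h \<le> (\<delta> + 2 * norm (x - x0) + 2 + 2 * \<phi> x) / 2"
      using D_growth[of h x] by simp
  qed
  ultimately show ?thesis by (simp add: compact_eq_bounded_closed)
qed

text \<open>On \<open>x + M\<close> with \<open>M\<close> a level set of \<open>D x\<close>, the function is affine up to the level.\<close>
lemma affine_on_level_set:
  assumes "\<And>y. \<phi> x + u \<bullet> (y - x) \<le> \<phi> y"
  shows "\<phi> y \<le> \<phi> x + u \<bullet> (y - x) + D x (y - x)"
  using assms[of "x - (y - x)"] by (simp add: D_def inner_diff_right algebra_simps)

text \<open>The expansion property of Macbeath regions. By convexity (k + h)/2 and (k - h)/2 stay in
  the level set, where \<phi> is affine up to \<delta>. Hence the second difference of h/2 at the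
  shifted point is at most 2 * \<delta>, and halving once more brings it down to \<delta>.\<close>

lemma D_shift:
  assumes "D x k \<le> \<delta>" "D x h \<le> \<delta>"
  shows "D (x + (1/2) *\<^sub>R k) ((1/4) *\<^sub>R h) \<le> \<delta>"
proof -
  obtain u where u: "\<And>y. \<phi> x + u \<bullet> (y - x) \<le> \<phi> y" using subgradient by blast
  let ?y = "x + (1/2) *\<^sub>R k"
  have 1: "D x ((1/2) *\<^sub>R k + (1/2) *\<^sub>R g) \<le> \<delta>" if "D x g \<le> \<delta>" for g
    using D_convex[of "1/2" "1/2" x k g] that assms(1) by simp
  have 2: "\<phi> (?y + (1/2) *\<^sub>R g) \<le> \<phi> x + u \<bullet> ((1/2) *\<^sub>R k + (1/2) *\<^sub>R g) + \<delta>" if "D x g \<le> \<delta>" for g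
    using affine_on_level_set[OF u, of "?y + (1/2) *\<^sub>R g"] 1[OF that] by (simp add: add.assoc)
  have "D ?y ((1/2) *\<^sub>R h) \<le> 2 * \<delta>"
    using 2[OF assms(2)] 2[of "-h"] assms(2) u[of ?y] by (simp add: D_def inner_add_right inner_diff_right)
  then show ?thesis using D_scale[of "1/2" ?y "(1/2) *\<^sub>R h"] by simp
qed

text \<open>Auerbach's lemma for the level sets of \<open>D x\<close>: the rows of \<open>A\<close> are, up to scaling, dual to a
  basis of maximal determinant in the level set.\<close>
lemma auerbach_matrix:
  assumes "0 < \<delta>"
  shows "\<exists>A::real^'n^'n. det A \<noteq> 0 \<and> (\<forall>h. norm (A *v h) \<le> 1 \<longrightarrow> D x h \<le> \<delta>) \<and>
    (\<forall>h. D x h \<le> \<delta> \<longrightarrow> (\<forall>i. \<bar>(A *v h) $ i\<bar> \<le> sqrt (real CARD('n))))"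
proof -
  let ?M = "{h. D x h \<le> \<delta>}"
  define S where "S = {V::real^'n^'n. \<forall>i. V $ i \<in> ?M}"
  have clM: "closed ?M" and bM: "bounded ?M" using D_level_set_compact compact_imp_closed compact_imp_bounded by blast+
  have "closed S"
  proof -
    have "S = (\<Inter>i. (\<lambda>V. V $ i) -` ?M)" unfolding S_def by auto
    moreover have "closed ((\<lambda>V::real^'n^'n. V $ i) -` ?M)" for i
      by (rule closed_vimage[OF clM]) (intro continuous_intros)
    ultimately show ?thesis by (simp only:) (intro closed_INT ballI)
  qed
  moreover have "bounded S"
  proof -
    obtain R where R: "\<forall>h\<in>?M. norm h \<le> R" using bM unfolding bounded_iff by (rule exE)
    have "norm V \<le> (\<Sum>i\<in>(UNIV::'n set). R)" if "V \<in> S" for V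
    proof -
      have "norm V \<le> (\<Sum>i\<in>UNIV. norm (V $ i))" unfolding norm_vec_def by (rule L2_set_le_sum) auto
      also have "\<dots> \<le> (\<Sum>i\<in>(UNIV::'n set). R)" using that R unfolding S_def by (intro sum_mono) blast
      finally show ?thesis .
    qed
    then show ?thesis using boundedI by blast
  qed
  ultimately have "compact S" by (simp add: compact_eq_bounded_closed)
  have small: "norm h \<le> \<delta> / 2 \<Longrightarrow> h \<in> ?M" for h using D_le[of x h] by auto
  define V0 :: "real^'n^'n" where "V0 = (\<chi> i. (\<delta> / 2) *\<^sub>R axis i 1)"
  have V0: "V0 \<in> S" unfolding S_def V0_def using small assms by (auto simp: norm_axis_1)
  have "V0 = (\<delta> / 2) *\<^sub>R mat 1" by (simp add: V0_def vec_eq_iff mat_def axis_def)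
  then have det0: "det V0 \<noteq> 0" using assms by (simp add: det_scaleR)
  have "continuous_on S (\<lambda>V. \<bar>det V\<bar>)" unfolding det_def by (intro continuous_intros)
  then obtain V where V: "V \<in> S" "\<And>W. W \<in> S \<Longrightarrow> \<bar>det W\<bar> \<le> \<bar>det V\<bar>"
    using continuous_attains_sup[OF \<open>compact S\<close>] V0 by blast
  have detV: "det V \<noteq> 0" using V(2)[OF V0] det0 by auto
  then have inv: "invertible (transpose V)" by (simp add: invertible_det_nz)
  then obtain W where WV: "transpose V ** W = mat 1" "W ** transpose V = mat 1"
    unfolding invertible_def by blast
  have detW: "det W \<noteq> 0" using WV by (metis det_I det_mul mult_zero_right zero_neq_one)
  have rep: "h = (\<Sum>i\<in>UNIV. (W *v h) $ i *\<^sub>R V $ i)" for h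
  proof -
    have "h = transpose V *v (W *v h)" by (simp add: matrix_vector_mul_assoc WV)
    also have "\<dots> = (\<Sum>i\<in>UNIV. (W *v h) $ i *\<^sub>R V $ i)"
      by (simp add: matrix_mult_sum column_transpose row_def vec_lambda_eta scalar_mult_eq_scaleR)
    finally show ?thesis .
  qed
  \<comment> \<open>Cramer's rule: exchanging row k of V for h multiplies the determinant by the
    k-th coordinate of h in the basis V. Maximality bounds that coordinate by 1.\<close>
  have le1: "\<bar>(W *v h) $ k\<bar> \<le> 1" if h: "h \<in> ?M" for h k
  proof -
    let ?U = "(\<chi> i. if i = k then h else V $ i) :: real^'n^'n"
    have "?U \<in> S" using V(1) h unfolding S_def by auto
    then have "\<bar>det ?U\<bar> \<le> \<bar>det V\<bar>" by (rule V(2))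
    moreover have "det ?U = (W *v h) $ k * det V"
    proof -
      have "?U = (\<chi> i. if i = k then sum (\<lambda>i. (W *v h) $ i *s row i V) UNIV else row i V)"
        using rep[of h] by (simp add: vec_eq_iff row_def vec_lambda_eta scalar_mult_eq_scaleR)
      then show ?thesis using cramer_lemma_transpose[of k "W *v h" V] by simp
    qed
    ultimately show ?thesis using detV by (simp add: abs_mult)
  qed
  let ?d = "sqrt (real CARD('n))"
  have d: "0 < ?d" by simp
  \<comment> \<open>By the Cauchy-Schwarz inequality, Euclidean norm at most 1/sqrt d implies l1
    norm at most 1. This scaling thus puts the ellipsoid inside the cross-polytope spanned by the
    rows of V and their negatives.\<close>
  define A where "A = ?d *\<^sub>R W"
  have A: "A *v h = ?d *\<^sub>R (W *v h)" for h by (simp add: A_def scaleR_matrix_vector_assoc)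
  have "det A \<noteq> 0" using detW d by (simp add: A_def det_scaleR)
  moreover have "D x h \<le> \<delta>" if "norm (A *v h) \<le> 1" for h
  proof -
    let ?c = "W *v h"
    have l1: "(\<Sum>i\<in>UNIV. \<bar>?c $ i\<bar>) \<le> 1"
    proof -
      have "(\<Sum>i\<in>UNIV. \<bar>?c $ i\<bar> * \<bar>1\<bar>) \<le> L2_set (($) ?c) UNIV * L2_set (\<lambda>_. 1) (UNIV :: 'n set)"
        by (rule L2_set_mult_ineq)
      also have "\<dots> = norm ?c * ?d" by (simp add: norm_vec_def L2_set_def)
      also have "\<dots> = norm (A *v h)" using d by (simp add: A)
      finally show ?thesis using that by simp
    qed
    have 0: "0 \<in> ?M" using assms by simp
    \<comment> \<open>The slack of the l1 norm becomes the weight of the point 0, which carries the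
      extra index \<open>None\<close>.\<close>
    define t where "t = 1 - (\<Sum>i\<in>UNIV. \<bar>?c $ i\<bar>)"
    define y where "y i = (case i of None \<Rightarrow> 0 | Some i \<Rightarrow> sgn (?c $ i) *\<^sub>R V $ i)" for i
    define w where "w i = (case i of None \<Rightarrow> t | Some i \<Rightarrow> \<bar>?c $ i\<bar>)" for i
    have U: "(UNIV :: 'n option set) = insert None (Some ` UNIV)" by (simp add: UNIV_option_conv)
    have "(\<Sum>i\<in>UNIV. w i *\<^sub>R y i) \<in> ?M"
    proof (rule convex_sum[OF _ D_level_set_convex])
      show "sum w UNIV = 1" unfolding U by (simp add: sum.reindex w_def t_def)
      show "0 \<le> w i" for i using l1 by (auto simp: w_def t_def split: option.split)
      show "y i \<in> ?M" for i
        using V(1) 0 assms unfolding S_def y_def by (auto split: option.split simp: sgn_if)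
    qed auto
    moreover have "(\<Sum>i\<in>UNIV. w i *\<^sub>R y i) = (\<Sum>i\<in>UNIV. ?c $ i *\<^sub>R V $ i)"
      unfolding U by (simp add: sum.reindex w_def y_def abs_mult_sgn)
    ultimately show ?thesis using rep[of h] by simp
  qed
  moreover have "\<bar>(A *v h) $ i\<bar> \<le> ?d" if "D x h \<le> \<delta>" for h i
    using le1[of h i] that d by (simp add: A abs_mult)
  ultimately show ?thesis by blast
qed


lemma dm_ge_1: "1 \<le> dm" by (simp add: dm_eq Suc_leI)

section \<open>The ellipsoid norms at a point and a level\<close>

definition mmat :: "real \<Rightarrow> real^'n \<Rightarrow> real^'n^'n" where
  "mmat \<delta> x = (SOME A. det A \<noteq> 0 \<and> (\<forall>h. norm (A *v h) \<le> 1 \<longrightarrow> D x h \<le> \<delta>) \<and>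
    (\<forall>h. D x h \<le> \<delta> \<longrightarrow> (\<forall>i. \<bar>(A *v h) $ i\<bar> \<le> sqrt (real CARD('n)))))"

lemma mmat:
  assumes "0 < \<delta>"
  shows "det (mmat \<delta> x) \<noteq> 0" "norm (mmat \<delta> x *v h) \<le> 1 \<Longrightarrow> D x h \<le> \<delta>"
    "D x h \<le> \<delta> \<Longrightarrow> \<bar>(mmat \<delta> x *v h) $ i\<bar> \<le> sqrt dm"
  using someI_ex[OF auerbach_matrix[OF assms, of x]] unfolding mmat_def dm_eq by blast+

text \<open>Its unit ball E satisfies E \<subseteq> {h. D x h \<le> \<delta>} \<subseteq> d E, by
  \<open>D_le_mnorm\<close> and \<open>mnorm_le_D\<close>.\<close>

definition mnorm :: "real \<Rightarrow> real^'n \<Rightarrow> real^'n \<Rightarrow> real" where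
  "mnorm \<delta> x h = norm (mmat \<delta> x *v h)"

lemma mnorm_nonneg [simp]: "0 \<le> mnorm \<delta> x h" by (simp add: mnorm_def)

lemma mnorm_zero [simp]: "mnorm \<delta> x 0 = 0" by (simp add: mnorm_def)

lemma mnorm_triangle: "mnorm \<delta> x (h + k) \<le> mnorm \<delta> x h + mnorm \<delta> x k"
  by (simp add: mnorm_def matrix_vector_right_distrib norm_triangle_ineq)

lemma mnorm_scale: "mnorm \<delta> x (c *\<^sub>R h) = \<bar>c\<bar> * mnorm \<delta> x h"
  by (simp add: mnorm_def matrix_vector_mult_scaleR)

lemma mnorm_minus: "mnorm \<delta> x (h - k) = mnorm \<delta> x (k - h)"
  using mnorm_scale[of \<delta> x "-1" "h - k"] by simp

lemma mnorm_triangle3: "mnorm \<delta> x (a - c) \<le> mnorm \<delta> x (a - b) + mnorm \<delta> x (b - c)"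
  using mnorm_triangle[of \<delta> x "a - b" "b - c"] by simp

lemma mnorm_continuous: "continuous_on S (\<lambda>h. mnorm \<delta> x (f h))" if "continuous_on S f"
  unfolding mnorm_def by (intro continuous_intros continuous_on_compose2[OF matrix_vector_mult_linear_continuous_on[of UNIV] that]) auto

lemma mnorm_eq_0:
  assumes "0 < \<delta>" "mnorm \<delta> x h = 0"
  shows "h = 0"
proof -
  obtain B where "B ** mmat \<delta> x = mat 1"
    using mmat(1)[OF assms(1), of x] unfolding invertible_det_nz[symmetric] invertible_def by blast
  then have "h = B *v (mmat \<delta> x *v h)" by (simp add: matrix_vector_mul_assoc)
  then show ?thesis using assms(2) by (simp add: mnorm_def)
qed

lemma D_le_mnorm: "0 < \<delta> \<Longrightarrow> mnorm \<delta> x h \<le> 1 \<Longrightarrow> D x h \<le> \<delta>"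
  unfolding mnorm_def by (rule mmat)

lemma mnorm_le_D:
  assumes "0 < \<delta>" "D x h \<le> \<delta>"
  shows "mnorm \<delta> x h \<le> dm"
proof -
  have "(mnorm \<delta> x h)\<^sup>2 = (\<Sum>i\<in>UNIV. \<bar>(mmat \<delta> x *v h) $ i\<bar>\<^sup>2)"
    by (simp add: mnorm_def norm_vec_def L2_set_def sum_nonneg)
  also have "\<dots> \<le> (\<Sum>i\<in>(UNIV::'n set). (sqrt dm)\<^sup>2)"
    by (intro sum_mono power_mono mmat(3)[OF assms]) auto
  also have "\<dots> = dm\<^sup>2" using dm_ge_1 by (simp add: power2_eq_square flip: dm_eq)
  finally show ?thesis by (rule power2_le_imp_le) (use dm_ge_1 in simp)
qed

lemma mnorm_compare:
  assumes "0 < \<delta>" "\<And>h. mnorm \<delta> x h \<le> 1 \<Longrightarrow> mnorm \<delta>' y h \<le> c"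
  shows "mnorm \<delta>' y h \<le> c * mnorm \<delta> x h"
proof (cases "h = 0")
  case False
  then have p: "0 < mnorm \<delta> x h" using mnorm_eq_0[OF assms(1), of x h] mnorm_nonneg[of \<delta> x h] by linarith
  have "mnorm \<delta>' y ((1 / mnorm \<delta> x h) *\<^sub>R h) \<le> c"
    using p by (intro assms(2)) (simp add: mnorm_scale)
  then show ?thesis using p by (simp add: mnorm_scale field_simps)
qed simp

text \<open>The radius 1/8 is what a return trip costs. The vector 8 (y - x) is in the level set at
  x, hence so is 2 (y - x), and \<open>D_shift\<close> leads from x to y. It also puts a quarter of
  8 (y - x) into the level set at y, so that the same shift leads back. The factor 4 comes from the
  shift, \<open>dm\<close> from Auerbach's lemma.\<close>

lemma mnorm_near:
  assumes "0 < \<delta>" "mnorm \<delta> x (y - x) \<le> 1/8"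
  shows "mnorm \<delta> y h \<le> 4 * dm * mnorm \<delta> x h" "mnorm \<delta> x h \<le> 4 * dm * mnorm \<delta> y h"
proof -
  have "mnorm \<delta> x (8 *\<^sub>R (y - x)) \<le> 1" using assms(2) by (simp only: mnorm_scale)
  then have 8: "D x (8 *\<^sub>R (y - x)) \<le> \<delta>" by (rule D_le_mnorm[OF assms(1)])
  have "D x (2 *\<^sub>R (y - x)) \<le> (1/4) * D x (8 *\<^sub>R (y - x))"
    using D_scale[of "1/4" x "8 *\<^sub>R (y - x)"] by simp
  then have 2: "D x (2 *\<^sub>R (y - x)) \<le> \<delta>" using 8 assms(1) by linarith
  have y: "x + (1/2) *\<^sub>R (2 *\<^sub>R (y - x)) = y" by simp
  have A: "D y ((1/4) *\<^sub>R h) \<le> \<delta>" if "D x h \<le> \<delta>" for h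
    using D_shift[OF 2 that] y by simp
  from A[OF 8] have "D y (2 *\<^sub>R (y - x)) \<le> \<delta>" by simp
  then have 3: "D y (2 *\<^sub>R (x - y)) \<le> \<delta>" using D_minus[of y "2 *\<^sub>R (y - x)"] by (simp add: algebra_simps)
  have x: "y + (1/2) *\<^sub>R (2 *\<^sub>R (x - y)) = x" by simp
  have B: "D x ((1/4) *\<^sub>R h) \<le> \<delta>" if "D y h \<le> \<delta>" for h
    using D_shift[OF 3 that] x by simp
  show "mnorm \<delta> y h \<le> 4 * dm * mnorm \<delta> x h"
  proof (rule mnorm_compare[OF assms(1)])
    fix h assume "mnorm \<delta> x h \<le> 1"
    then have "mnorm \<delta> y ((1/4) *\<^sub>R h) \<le> dm" using A D_le_mnorm mnorm_le_D assms(1) by blast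
    then show "mnorm \<delta> y h \<le> 4 * dm" by (simp add: mnorm_scale)
  qed
  show "mnorm \<delta> x h \<le> 4 * dm * mnorm \<delta> y h"
  proof (rule mnorm_compare[OF assms(1)])
    fix h assume "mnorm \<delta> y h \<le> 1"
    then have "mnorm \<delta> x ((1/4) *\<^sub>R h) \<le> dm" using B D_le_mnorm mnorm_le_D assms(1) by blast
    then show "mnorm \<delta> x h \<le> 4 * dm" by (simp add: mnorm_scale)
  qed
qed

lemma mnorm_level_mono:
  assumes "0 < \<delta>'" "\<delta>' \<le> \<delta>"
  shows "mnorm \<delta> x h \<le> dm * mnorm \<delta>' x h"
  by (rule mnorm_compare[OF assms(1)]) (use D_le_mnorm[OF assms(1), of x] mnorm_le_D[of \<delta> x] assms in force)

text \<open>By convexity D x grows at least linearly along rays, so shrinking a vector by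
  \<delta>'/\<delta> brings it from level \<delta> down to level \<delta>'.\<close>

lemma mnorm_level_ratio:
  assumes "0 < \<delta>'" "\<delta>' \<le> \<delta>"
  shows "mnorm \<delta>' x h \<le> dm * (\<delta> / \<delta>') * mnorm \<delta> x h"
proof (rule mnorm_compare)
  fix h assume "mnorm \<delta> x h \<le> 1"
  then have "D x h \<le> \<delta>" using D_le_mnorm[of \<delta> x h] assms by simp
  have "D x ((\<delta>' / \<delta>) *\<^sub>R h) \<le> (\<delta>' / \<delta>) * D x h"
    using assms by (intro D_scale) auto
  also have "\<dots> \<le> (\<delta>' / \<delta>) * \<delta>" using \<open>D x h \<le> \<delta>\<close> assms by (intro mult_left_mono) auto
  finally have "D x ((\<delta>' / \<delta>) *\<^sub>R h) \<le> (\<delta>' / \<delta>) * \<delta>" .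
  then have "D x ((\<delta>' / \<delta>) *\<^sub>R h) \<le> \<delta>'" using assms by simp
  from mnorm_le_D[OF assms(1) this] show "mnorm \<delta>' x h \<le> dm * (\<delta> / \<delta>')"
    using assms by (simp add: mnorm_scale field_simps)
qed (use assms in simp)

text \<open>As \<phi> is 1-Lipschitz, the level set contains the ball of radius \<delta>/2. This is
  the length scale \<delta> of all derivative bounds.\<close>

lemma mnorm_le_norm:
  assumes "0 < \<delta>"
  shows "mnorm \<delta> x h \<le> 2 * dm / \<delta> * norm h"
proof (cases "h = 0")
  case False
  have "D x ((\<delta> / (2 * norm h)) *\<^sub>R h) \<le> \<delta>"
    using D_le[of x "(\<delta> / (2 * norm h)) *\<^sub>R h"] False assms by (simp add: field_simps)
  from mnorm_le_D[OF assms this] show ?thesis using False assms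
    by (simp add: mnorm_scale field_simps)
qed simp

text \<open>By \<open>D_growth\<close>, 2 * norm h is at most 1 + 2 + 2 = 5, the contributions of
  the level, the distance from x0 and the growth offset.\<close>

lemma norm_le_mnorm:
  assumes "x \<in> \<Omega>" "0 < \<delta>" "\<delta> \<le> 1"
  shows "mnorm \<delta> x h \<le> 1 \<Longrightarrow> norm h \<le> 5 / 2"
  using D_growth[of h x] D_le_mnorm[OF assms(2), of x h] near[OF assms(1)] neg[OF assms(1)] assms(3) by linarith

section \<open>The approximate subdifferential\<close>

definition subdiff :: "real \<Rightarrow> real^'n \<Rightarrow> (real^'n) set" where
  "subdiff \<delta> x = {p. \<forall>y. \<phi> x + p \<bullet> (y - x) - \<delta> \<le> \<phi> y}"

text \<open>Along a slope longer than 1 the affine minorant would overtake the 1-Lipschitz function;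
  t is chosen so that it does so by more than \<delta>.\<close>

lemma subdiff_norm:
  assumes "p \<in> subdiff \<delta> x"
  shows "norm p \<le> 1"
proof (rule ccontr)
  assume "\<not> norm p \<le> 1"
  define t where "t = (\<bar>\<delta>\<bar> + 1) / (norm p * (norm p - 1))"
  have p: "1 < norm p" using \<open>\<not> norm p \<le> 1\<close> by simp
  then have t: "0 < t" unfolding t_def by (intro divide_pos_pos mult_pos_pos) auto
  have "\<phi> x + t * (norm p)\<^sup>2 - \<delta> \<le> \<phi> (x + t *\<^sub>R p)"
    using assms unfolding subdiff_def by (force simp: dot_square_norm dest: spec[of _ "x + t *\<^sub>R p"])
  also have "\<dots> \<le> \<phi> x + t * norm p" using lipschitz[of "x + t *\<^sub>R p" x] t by simp
  finally have "t * (norm p * (norm p - 1)) \<le> \<delta>" by (simp add: power2_eq_square algebra_simps)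
  moreover have "norm p * (norm p - 1) \<noteq> 0" using p by auto
  then have "t * (norm p * (norm p - 1)) = \<bar>\<delta>\<bar> + 1"
    using nonzero_eq_divide_eq t_def by blast
  ultimately show False by linarith
qed

lemma subdiff_convex: "convex (subdiff \<delta> x)"
proof (rule convexI)
  fix p q :: "real^'n" and s t :: real
  assume a: "p \<in> subdiff \<delta> x" "q \<in> subdiff \<delta> x" "0 \<le> s" "0 \<le> t" "s + t = 1"
  have "\<phi> x + (s *\<^sub>R p + t *\<^sub>R q) \<bullet> (y - x) - \<delta> \<le> \<phi> y" for y
  proof -
    have "s * (\<phi> x + p \<bullet> (y - x) - \<delta>) + t * (\<phi> x + q \<bullet> (y - x) - \<delta>) \<le> s * \<phi> y + t * \<phi> y"
      using a unfolding subdiff_def by (intro add_mono mult_left_mono) auto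
    moreover have "s * (\<phi> x + p \<bullet> (y - x) - \<delta>) + t * (\<phi> x + q \<bullet> (y - x) - \<delta>)
       = (s + t) * (\<phi> x - \<delta>) + (s *\<^sub>R p + t *\<^sub>R q) \<bullet> (y - x)"
      by (simp add: inner_add_left algebra_simps)
    moreover have "s * \<phi> y + t * \<phi> y = \<phi> y" using a(5) by (simp flip: distrib_right)
    ultimately show ?thesis using a(5) by simp
  qed
  then show "s *\<^sub>R p + t *\<^sub>R q \<in> subdiff \<delta> x" by (simp add: subdiff_def)
qed

lemma subdiff_compact: "compact (subdiff \<delta> x)"
proof -
  have "subdiff \<delta> x = (\<Inter>y. {p. \<phi> x + p \<bullet> (y - x) - \<delta> \<le> \<phi> y})" by (auto simp: subdiff_def)
  moreover have "closed {p. \<phi> x + p \<bullet> (y - x) - \<delta> \<le> \<phi> y}" for y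
    by (intro closed_Collect_le continuous_intros)
  ultimately have "closed (subdiff \<delta> x)" by (simp only:) (intro closed_INT ballI)
  moreover have "bounded (subdiff \<delta> x)" using subdiff_norm boundedI by blast
  ultimately show ?thesis by (simp add: compact_eq_bounded_closed)
qed

text \<open>A subgradient q at x + v misses \<phi> x by some error e. If e exceeds \<delta>, mixing
  q with the exact subgradient u in the proportion \<delta>/e makes the error exactly \<delta>, and
  the slope along v still suffices because the gap at x + v is at most \<delta>.\<close>

lemma subdiff_direction:
  assumes u: "\<And>y. \<phi> x + u \<bullet> (y - x) \<le> \<phi> y" and "0 < \<delta>" and le: "\<phi> (x + v) - \<phi> x - u \<bullet> v \<le> \<delta>"
  shows "\<exists>q\<in>subdiff \<delta> x. \<phi> (x + v) - \<phi> x \<le> q \<bullet> v"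
proof -
  obtain q where q: "\<And>y. \<phi> (x + v) + q \<bullet> (y - (x + v)) \<le> \<phi> y" using subgradient by blast
  define e where "e = q \<bullet> v - (\<phi> (x + v) - \<phi> x)"
  have e0: "0 \<le> e" using q[of x] by (simp add: e_def)
  have qe: "\<phi> x + q \<bullet> (y - x) - e \<le> \<phi> y" for y
    using q[of y] by (simp add: e_def inner_diff_right inner_add_right)
  show ?thesis
  proof (cases "e \<le> \<delta>")
    case True
    have "\<phi> x + q \<bullet> (y - x) - \<delta> \<le> \<phi> y" for y using qe[of y] True by linarith
    then have "q \<in> subdiff \<delta> x" by (simp add: subdiff_def)
    then show ?thesis using e0 by (auto simp: e_def)
  next
    case False
    define s where "s = \<delta> / e"
    have s: "0 \<le> s" "s \<le> 1" "s * e = \<delta>" using False assms(2) by (auto simp: s_def)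
    define p where "p = s *\<^sub>R q + (1 - s) *\<^sub>R u"
    have "\<phi> x + p \<bullet> (y - x) - \<delta> \<le> \<phi> y" for y
    proof -
      have "s * (\<phi> x + q \<bullet> (y - x) - e) + (1 - s) * (\<phi> x + u \<bullet> (y - x)) \<le> s * \<phi> y + (1 - s) * \<phi> y"
        using s qe[of y] u[of y] by (intro add_mono mult_left_mono) auto
      moreover have "s * (\<phi> x + q \<bullet> (y - x) - e) + (1 - s) * (\<phi> x + u \<bullet> (y - x)) = \<phi> x + p \<bullet> (y - x) - s * e"
        by (simp add: p_def inner_add_left algebra_simps)
      ultimately show ?thesis using s(3) by (simp add: algebra_simps)
    qed
    then have "p \<in> subdiff \<delta> x" by (simp add: subdiff_def)
    moreover have "\<phi> (x + v) - \<phi> x \<le> p \<bullet> v"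
    proof -
      have "p \<bullet> v = s * e + s * (\<phi> (x + v) - \<phi> x - u \<bullet> v) + u \<bullet> v"
        by (simp add: p_def e_def inner_add_left algebra_simps)
      moreover have "0 \<le> s * (\<phi> (x + v) - \<phi> x - u \<bullet> v)" using s(1) u[of "x + v"] by simp
      ultimately show ?thesis using s(3) le by linarith
    qed
    ultimately show ?thesis by blast
  qed
qed

text \<open>The difference body of the \<open>\<delta>\<close>-subdifferential contains \<open>\<delta>\<close> times the polar of the level set
  \<open>{h. D x h \<le> \<delta>}\<close>; this replaces the lower bound in Mahler's inequality.\<close>
lemma subdiff_difference:
  assumes "0 < \<delta>" and w: "\<And>h. D x h \<le> \<delta> \<Longrightarrow> w \<bullet> h \<le> 1"
  shows "\<exists>p\<in>subdiff \<delta> x. \<exists>q\<in>subdiff \<delta> x. p - q = \<delta> *\<^sub>R w"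
proof (rule ccontr)
  let ?Q = "subdiff \<delta> x"
  let ?P = "\<Union>p\<in>?Q. \<Union>q\<in>?Q. {p - q}"
  assume "\<not> ?thesis"
  then have ni: "\<delta> *\<^sub>R w \<notin> ?P" by force
  have cv: "convex ?P" by (rule convex_differences[OF subdiff_convex subdiff_convex])
  have "?P = {p - q | p q. p \<in> ?Q \<and> q \<in> ?Q}" by auto
  then have cl: "closed ?P" using compact_differences[OF subdiff_compact subdiff_compact, of \<delta> x \<delta> x] compact_imp_closed by simp
  obtain a b where ab1: "a \<bullet> (\<delta> *\<^sub>R w) < b" and ab2: "\<forall>p\<in>?P. b < a \<bullet> p"
    using separating_hyperplane_closed_point[OF cv cl ni] by (elim exE conjE)
  note ab = ab1 bspec[OF ab2]
  obtain u where u: "\<And>y. \<phi> x + u \<bullet> (y - x) \<le> \<phi> y" using subgradient by blast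
  have uQ: "u \<in> ?Q" using u assms(1) unfolding subdiff_def by (auto intro: order_trans[OF _ u])
  then have "u - u \<in> ?P" by blast
  then have "b < a \<bullet> (u - u)" by (rule ab(2))
  then have a0: "a \<noteq> 0" and b0: "b < 0" using ab(1) by auto
  \<comment> \<open>A length at which \<open>D_growth\<close> forces level \<delta> along the
    separating direction, so that the intermediate value theorem finds v with \<open>D x v\<close>
    equal to \<delta>.\<close>
  define R where "R = (\<delta> + 2 * norm (x - x0) + 2 + 2 * \<phi> x) / (2 * norm a)"
  have big: "\<delta> \<le> D x (\<bar>R\<bar> *\<^sub>R (- a))"
  proof -
    have "\<delta> + 2 * norm (x - x0) + 2 + 2 * \<phi> x = R * (2 * norm a)" using a0 by (simp add: R_def)
    also have "\<dots> \<le> \<bar>R\<bar> * (2 * norm a)" by (intro mult_right_mono) auto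
    finally show ?thesis using D_growth[of "\<bar>R\<bar> *\<^sub>R (- a)" x] by simp
  qed
  have "continuous_on {0..\<bar>R\<bar>} (\<lambda>t. D x (t *\<^sub>R (- a)))"
    by (rule continuous_on_compose2[OF D_continuous[of UNIV]]) (auto intro!: continuous_intros)
  then obtain t where t: "0 \<le> t" "D x (t *\<^sub>R (- a)) = \<delta>"
    using IVT'[of "\<lambda>t. D x (t *\<^sub>R (- a))" 0 \<delta> "\<bar>R\<bar>"] big assms(1) by auto
  define v where "v = t *\<^sub>R (- a)"
  have Dv: "D x v = \<delta>" using t by (simp add: v_def)
  have tp: "0 < t" using Dv assms(1) t(1) by (cases "t = 0") (auto simp: v_def)
  have F: "\<phi> (x + v) - \<phi> x - u \<bullet> v \<le> \<delta>" "\<phi> (x + (- v)) - \<phi> x - u \<bullet> (- v) \<le> \<delta>"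
    using Dv u[of "x + v"] u[of "x - v"] by (auto simp: D_def)
  obtain q1 where q1: "q1 \<in> ?Q" "\<phi> (x + v) - \<phi> x \<le> q1 \<bullet> v"
    using subdiff_direction[OF u assms(1) F(1)] by blast
  obtain q2 where q2: "q2 \<in> ?Q" "\<phi> (x + (- v)) - \<phi> x \<le> q2 \<bullet> (- v)"
    using subdiff_direction[OF u assms(1) F(2)] by blast
  \<comment> \<open>Between them q1 and q2 account for the whole second difference along v, whereas
    the separation puts q1 - q2 strictly below \<delta> * (w \<bullet> v), which is at most
    \<delta>.\<close>
  have "\<delta> \<le> (q1 - q2) \<bullet> v" using q1(2) q2(2) Dv by (simp add: D_def inner_diff_left)
  moreover have "q1 - q2 \<in> ?P" using q1(1) q2(1) by blast
  then have "b < a \<bullet> (q1 - q2)" by (rule ab(2))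
  then have "t * b < t * (a \<bullet> (q1 - q2))" using tp by simp
  moreover have "(q1 - q2) \<bullet> v = - (t * (a \<bullet> (q1 - q2)))" by (simp add: v_def inner_commute)
  moreover have "t * (a \<bullet> (\<delta> *\<^sub>R w)) < t * b" using ab(1) tp by simp
  moreover have "\<delta> * (w \<bullet> v) \<le> \<delta> * 1" using w[of v] Dv assms(1) by (intro mult_left_mono) auto
  moreover have "\<delta> * (w \<bullet> v) = - (t * (a \<bullet> (\<delta> *\<^sub>R w)))" by (simp add: v_def inner_commute)
  ultimately show False by linarith
qed

text \<open>Each row of the matrix, divided by sqrt d, is in the polar of the level set; hence
  \<delta> times it is the difference of two points of the subdifferential. The mean of these d
  segments contains a parallelotope about the mean p of their midpoints, and the weight 1/d of a
  segment limits the coefficients to 1/(2d).\<close>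

lemma subdiff_box:
  assumes "0 < \<delta>"
  shows "\<exists>p. \<forall>c. norm c \<le> 1 / (2 * dm) \<longrightarrow> p + (\<delta> / sqrt dm) *\<^sub>R (transpose (mmat \<delta> x) *v c) \<in> subdiff \<delta> x"
proof -
  let ?A = "mmat \<delta> x"
  have "\<exists>p\<in>subdiff \<delta> x. \<exists>q\<in>subdiff \<delta> x. p - q = \<delta> *\<^sub>R ((1 / sqrt dm) *\<^sub>R ?A $ i)" for i
  proof (rule subdiff_difference[OF assms])
    fix h assume "D x h \<le> \<delta>"
    then have "(?A *v h) $ i \<le> sqrt dm" using mmat(3)[OF assms, of x h i] by linarith
    then show "((1 / sqrt dm) *\<^sub>R ?A $ i) \<bullet> h \<le> 1"
      using dm_ge_1 by (simp add: matrix_vector_mul_component divide_le_eq)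
  qed
  then have "\<exists>f. \<forall>i. fst (f i) \<in> subdiff \<delta> x \<and> snd (f i) \<in> subdiff \<delta> x \<and>
      fst (f i) - snd (f i) = \<delta> *\<^sub>R ((1 / sqrt dm) *\<^sub>R ?A $ i)"
    by (intro choice allI) (metis fst_conv snd_conv)
  then obtain f where f: "\<And>i. fst (f i) \<in> subdiff \<delta> x" "\<And>i. snd (f i) \<in> subdiff \<delta> x"
      "\<And>i. fst (f i) - snd (f i) = \<delta> *\<^sub>R ((1 / sqrt dm) *\<^sub>R ?A $ i)" by blast
  define p where "p = (\<Sum>i\<in>UNIV. (1 / dm) *\<^sub>R ((1/2) *\<^sub>R fst (f i) + (1/2) *\<^sub>R snd (f i)))"
  have "p + (\<delta> / sqrt dm) *\<^sub>R (transpose ?A *v c) \<in> subdiff \<delta> x" if c: "norm c \<le> 1 / (2 * dm)" for c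
  proof -
    define y where "y i = (1/2 + dm * c $ i) *\<^sub>R fst (f i) + (1/2 - dm * c $ i) *\<^sub>R snd (f i)" for i
    have "y i \<in> subdiff \<delta> x" for i
    proof -
      have "\<bar>c $ i\<bar> \<le> 1 / (2 * dm)" using component_le_norm_cart[of c i] c by linarith
      then have "\<bar>dm * c $ i\<bar> \<le> 1/2" using dm_ge_1 by (simp add: abs_mult field_simps)
      then have "0 \<le> 1/2 + dm * c $ i" "0 \<le> 1/2 - dm * c $ i" by linarith+
      then show ?thesis unfolding y_def by (intro convexD[OF subdiff_convex f(1) f(2)]) auto
    qed
    then have "(\<Sum>i\<in>UNIV. (1 / dm) *\<^sub>R y i) \<in> subdiff \<delta> x"
      using dm_ge_1 by (intro convex_sum[OF _ subdiff_convex]) (auto simp flip: dm_eq)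
    moreover have "(\<Sum>i\<in>UNIV. (1 / dm) *\<^sub>R y i) = p + (\<delta> / sqrt dm) *\<^sub>R (transpose ?A *v c)"
    proof -
      have "(1 / dm) *\<^sub>R y i = (1 / dm) *\<^sub>R ((1/2) *\<^sub>R fst (f i) + (1/2) *\<^sub>R snd (f i)) + c $ i *\<^sub>R (\<delta> / sqrt dm) *\<^sub>R ?A $ i" for i
      proof -
        have "(1 / dm) *\<^sub>R y i = (1 / dm) *\<^sub>R ((1/2) *\<^sub>R fst (f i) + (1/2) *\<^sub>R snd (f i)) + (1 / dm) *\<^sub>R (dm * c $ i) *\<^sub>R (fst (f i) - snd (f i))"
          unfolding y_def by (simp add: scaleR_add_left scaleR_add_right scaleR_diff_left scaleR_diff_right diff_divide_distrib add_divide_distrib)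
        then show ?thesis by (simp add: f(3))
      qed
      moreover have "transpose ?A *v c = (\<Sum>i\<in>UNIV. c $ i *\<^sub>R ?A $ i)"
        by (simp add: matrix_mult_sum column_transpose row_def vec_lambda_eta scalar_mult_eq_scaleR)
      ultimately show ?thesis
        by (simp add: p_def sum.distrib scaleR_sum_right mult.commute)
    qed
    ultimately show ?thesis by simp
  qed
  then show ?thesis by blast
qed

end

section \<open>Counting separated points\<close>

context signed_dist begin

text \<open>The second difference is a first difference of \<open>G\<close>, so the integral
  telescopes along axis i: all cancels except a slab of thickness R, where \<open>G\<close> is at
  most 2R. The total is quadratic in R.\<close>

lemma integral_second_difference_le:
  fixes a b :: "real^'n" and i :: 'n
  assumes R: "0 < R" and ab: "\<And>j. b $ j - a $ j = s" and s: "0 < s"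
  shows "integral (cbox a b) (\<lambda>y. D y (R *\<^sub>R axis i 1)) \<le> 2 * R\<^sup>2 * s ^ (CARD('n) - 1)"
proof -
  let ?e = "R *\<^sub>R axis i 1 :: real^'n"
  have ax: "R * axis i 1 $ j = (if j = i then R else 0)" for j by (simp add: axis_def)
  \<comment> \<open>The summand R makes \<open>G\<close> nonnegative, so the domain of the first
    integral may be enlarged; this also covers R larger than the side s.\<close>
  define G where "G y = \<phi> (y + ?e) - \<phi> y + R" for y
  have G: "0 \<le> G y" "G y \<le> 2 * R" for y
    using lipschitz[of "y + ?e" y] R by (auto simp: G_def norm_axis_1 abs_le_iff)
  have cont: "continuous_on S G" for S
    unfolding G_def by (intro continuous_intros continuous_on_compose2[OF continuous[of UNIV]] continuous) auto
  have cont': "continuous_on S (\<lambda>y. G (y - ?e))" for S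
    by (intro continuous_on_compose2[OF cont[of UNIV]] continuous_intros) auto
  have int: "G integrable_on cbox c d" for c d by (intro integrable_continuous cont)
  have le: "a $ j \<le> b $ j" for j using ab[of j] s by linarith
  have "integral (cbox a b) (\<lambda>y. D y ?e) = integral (cbox a b) (\<lambda>y. G y - G (y - ?e))"
    by (simp add: D_def G_def)
  also have "\<dots> = integral (cbox a b) G - integral (cbox a b) (\<lambda>y. G (y - ?e))"
    by (intro integral_diff integrable_continuous cont cont')
  also have "integral (cbox a b) (\<lambda>y. G (y - ?e)) = integral (cbox (a - ?e) (b - ?e)) G"
    using integral_shift_cbox[of a ?e b "\<lambda>y. G (y - ?e)"] by simp
  also have "integral (cbox a b) G \<le> integral (cbox (a - ?e) b) G"
  proof (intro integral_subset_le int)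
    have "(a - ?e) $ j \<le> a $ j" for j using R by (simp add: axis_def)
    then show "cbox a b \<subseteq> cbox (a - ?e) b"
      unfolding mem_box_cart subset_iff by (meson order_trans)
  qed (use G in auto)
  also have "integral (cbox (a - ?e) b) G
     = integral (cbox (a - ?e) b \<inter> {y. y \<bullet> axis i 1 \<le> b $ i - R}) G
     + integral (cbox (a - ?e) b \<inter> {y. y \<bullet> axis i 1 \<ge> b $ i - R}) G"
    by (intro integral_split int) (simp add: axis_in_Basis_iff)
  also have "cbox (a - ?e) b \<inter> {y. y \<bullet> axis i 1 \<le> b $ i - R} = cbox (a - ?e) (b - ?e)"
  proof (rule set_eqI)
    fix y :: "real^'n"
    have "(\<forall>j. y $ j \<le> b $ j) \<and> y $ i \<le> b $ i - R \<longleftrightarrow> (\<forall>j. y $ j \<le> b $ j - R * axis i 1 $ j)"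
      unfolding ax
    proof (intro iffI allI conjI)
      show "y $ j \<le> b $ j - (if j = i then R else 0)"
        if "(\<forall>j. y $ j \<le> b $ j) \<and> y $ i \<le> b $ i - R" for j using that by simp
      show "y $ j \<le> b $ j" if "\<forall>j. y $ j \<le> b $ j - (if j = i then R else 0)" for j
        using spec[OF that, of j] R by (cases "j = i") simp_all
      show "y $ i \<le> b $ i - R" if "\<forall>j. y $ j \<le> b $ j - (if j = i then R else 0)"
        using spec[OF that, of i] by simp
    qed
    then show "y \<in> cbox (a - ?e) b \<inter> {y. y \<bullet> axis i 1 \<le> b $ i - R} \<longleftrightarrow> y \<in> cbox (a - ?e) (b - ?e)"
      by (auto simp: mem_box_cart inner_axis)
  qed
  also have "integral (cbox (a - ?e) b \<inter> {y. y \<bullet> axis i 1 \<ge> b $ i - R}) G \<le> 2 * R * (R * s ^ (CARD('n) - 1))"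
  proof -
    define c :: "real^'n" where "c = (\<chi> j. if j = i then b $ i - R else a $ j)"
    have eq: "cbox (a - ?e) b \<inter> {y. y \<bullet> axis i 1 \<ge> b $ i - R} = cbox c b"
    proof (rule set_eqI)
      fix y :: "real^'n"
      have "(\<forall>j. a $ j - R * axis i 1 $ j \<le> y $ j) \<and> b $ i - R \<le> y $ i \<longleftrightarrow> (\<forall>j. c $ j \<le> y $ j)"
        unfolding ax c_def vec_lambda_beta
      proof (intro iffI allI conjI)
        show "(if j = i then b $ i - R else a $ j) \<le> y $ j"
          if "(\<forall>j. a $ j - (if j = i then R else 0) \<le> y $ j) \<and> b $ i - R \<le> y $ i" for j
          using spec[OF conjunct1[OF that], of j] conjunct2[OF that] by (cases "j = i") simp_all
        show "a $ j - (if j = i then R else 0) \<le> y $ j" if "\<forall>j. (if j = i then b $ i - R else a $ j) \<le> y $ j" for j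
          using spec[OF that, of j] le[of i] by (cases "j = i") simp_all
        show "b $ i - R \<le> y $ i" if "\<forall>j. (if j = i then b $ i - R else a $ j) \<le> y $ j"
          using spec[OF that, of i] by simp
      qed
      then show "y \<in> cbox (a - ?e) b \<inter> {y. y \<bullet> axis i 1 \<ge> b $ i - R} \<longleftrightarrow> y \<in> cbox c b"
        by (auto simp: mem_box_cart inner_axis)
    qed
    have cb: "c $ j \<le> b $ j" for j using le[of j] R by (auto simp: c_def)
    then have ne: "cbox c b \<noteq> {}" by (auto simp: interval_ne_empty_cart)
    have "measure lborel (cbox c b) = (\<Prod>j\<in>UNIV. b $ j - c $ j)" by (rule content_cbox_cart[OF ne])
    also have "\<dots> = (b $ i - c $ i) * (\<Prod>j\<in>UNIV - {i}. b $ j - c $ j)" by (simp add: prod.remove)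
    also have "\<dots> = R * (\<Prod>j\<in>UNIV - {i}. s)"
      by (intro arg_cong2[of _ _ _ _ "(*)"] prod.cong) (auto simp: c_def ab)
    also have "\<dots> = R * s ^ (CARD('n) - 1)" by (simp add: card_Diff_singleton)
    finally have "measure lborel (cbox c b) = R * s ^ (CARD('n) - 1)" .
    moreover have "integral (cbox c b) G \<le> integral (cbox c b) (\<lambda>_. 2 * R)"
      using G by (intro integral_le int) auto
    ultimately show ?thesis by (simp add: eq mult_ac)
  qed
  finally show ?thesis by (simp add: power2_eq_square algebra_simps)
qed

text \<open>The vector r u is the mean of the d vectors \<open>u $ i\<close> times (d r) e_i, with
  each factor \<open>u $ i\<close> of modulus at most 1; apply convexity and symmetry of D
  y.\<close>

lemma D_le_average:
  assumes "norm u = 1" "0 \<le> r"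
  shows "dm * D y (r *\<^sub>R u) \<le> (\<Sum>i\<in>UNIV. D y ((dm * r) *\<^sub>R axis i 1))"
proof -
  have cv: "convex_on UNIV (D y)"
    by (intro convex_onI D_convex) auto
  have dp: "0 < dm" using dm_ge_1 by simp
  have "r *\<^sub>R u = (\<Sum>i\<in>UNIV. (1 / dm) *\<^sub>R ((u $ i) *\<^sub>R ((dm * r) *\<^sub>R axis i 1)))"
    using dp by (simp add: vec_eq_iff axis_def if_distrib[of "\<lambda>x. _ * x"] cong: if_cong)
  then have "D y (r *\<^sub>R u) \<le> (\<Sum>i\<in>UNIV. (1 / dm) * D y ((u $ i) *\<^sub>R ((dm * r) *\<^sub>R axis i 1)))"
    using convex_on_sum[OF _ _ cv, of UNIV "\<lambda>_. 1 / dm" "\<lambda>i. (u $ i) *\<^sub>R ((dm * r) *\<^sub>R axis i 1)"] dp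
    by (simp add: dm_eq)
  also have "\<dots> \<le> (\<Sum>i\<in>UNIV. (1 / dm) * D y ((dm * r) *\<^sub>R axis i 1))"
  proof (intro sum_mono mult_left_mono)
    fix i :: 'n
    let ?h = "(dm * r) *\<^sub>R axis i 1 :: real^'n"
    have u: "\<bar>u $ i\<bar> \<le> 1" using component_le_norm_cart[of u i] assms by simp
    have "D y (u $ i *\<^sub>R ?h) = D y (\<bar>u $ i\<bar> *\<^sub>R ?h)"
      using D_minus[of y "u $ i *\<^sub>R ?h"] by (cases "u $ i \<ge> 0") auto
    also have "\<dots> \<le> \<bar>u $ i\<bar> * D y ?h" using u by (intro D_scale) auto
    also have "\<dots> \<le> 1 * D y ?h" using u D_nonneg by (intro mult_right_mono) auto
    finally show "D y (u $ i *\<^sub>R ?h) \<le> D y ?h" by simp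
  qed (use dp in auto)
  also have "\<dots> = (1 / dm) * (\<Sum>i\<in>UNIV. D y ((dm * r) *\<^sub>R axis i 1))" by (simp add: sum_distrib_left)
  finally show ?thesis using dp by (simp add: field_simps)
qed

text \<open>Coordinate directions stand in for the unit subgradient, which varies with y; this makes
  the set closed and its measure accessible by integration. The cube contains the ball of radius 4
  about x0.\<close>

definition bad :: "real \<Rightarrow> real \<Rightarrow> (real^'n) set" where
  "bad \<delta> \<tau> = {y \<in> cbox (\<chi> i. x0 $ i - 4) (\<chi> i. x0 $ i + 4).
     3 * \<delta> * dm \<le> (\<Sum>i\<in>UNIV. D y ((dm * (6 * \<delta> / \<tau>)) *\<^sub>R axis i 1))}"

lemma bad_compact: "compact (bad \<delta> \<tau>)"
proof -
  have "closed {y. 3 * \<delta> * dm \<le> (\<Sum>i\<in>UNIV. D y ((dm * (6 * \<delta> / \<tau>)) *\<^sub>R axis i 1))}"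
    by (intro closed_Collect_le continuous_intros D_continuous')
  then have "compact (cbox (\<chi> i. x0 $ i - 4) (\<chi> i. x0 $ i + 4) \<inter> {y. 3 * \<delta> * dm \<le> (\<Sum>i\<in>UNIV. D y ((dm * (6 * \<delta> / \<tau>)) *\<^sub>R axis i 1))})"
    by (intro compact_Int_closed) auto
  then show ?thesis unfolding bad_def Int_def mem_Collect_eq .
qed

text \<open>A subgradient shorter than \<open>1\<close> can only be compatible with the unit subgradients if the
  function bends by a definite amount at scale \<open>\<delta> / \<tau>\<close>.\<close>
lemma short_subgradient_imp_bad:
  assumes "0 < \<delta>" "0 < \<tau>" "norm p \<le> 1 - \<tau>" "norm (y - x0) \<le> 4"
    and p: "\<And>z. \<phi> y + p \<bullet> (z - y) - 3 * \<delta> \<le> \<phi> z"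
  shows "y \<in> bad \<delta> \<tau>"
proof -
  obtain u where u: "norm u = 1" "\<And>z. \<phi> y + u \<bullet> (z - y) \<le> \<phi> z" using subgradient by blast
  \<comment> \<open>Moving by r along u and back gains r * \<tau>, from which the error 3 * \<delta>
    of p is subtracted; the choice r * \<tau> = 6 * \<delta> leaves 3 * \<delta>.\<close>
  define r where "r = 6 * \<delta> / \<tau>"
  have r: "0 < r" "r * \<tau> = 6 * \<delta>" using assms by (auto simp: r_def)
  have "\<phi> y + r \<le> \<phi> (y + r *\<^sub>R u)" using u(2)[of "y + r *\<^sub>R u"] u(1) by (simp add: dot_square_norm)
  moreover have "\<phi> y - r * (p \<bullet> u) - 3 * \<delta> \<le> \<phi> (y - r *\<^sub>R u)" using p[of "y - r *\<^sub>R u"] by simp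
  moreover have "p \<bullet> u \<le> 1 - \<tau>" using norm_cauchy_schwarz[of p u] u(1) assms(3) by simp
  then have "r * (p \<bullet> u) \<le> r * (1 - \<tau>)" using r by (intro mult_left_mono) auto
  ultimately have "3 * \<delta> \<le> D y (r *\<^sub>R u)" using r(2) by (simp add: D_def algebra_simps)
  then have "3 * \<delta> * dm \<le> dm * D y (r *\<^sub>R u)" using dm_ge_1 by (simp add: mult.commute mult_left_mono)
  also have "\<dots> \<le> (\<Sum>i\<in>UNIV. D y ((dm * r) *\<^sub>R axis i 1))" using D_le_average[OF u(1)] r by simp
  finally have "3 * \<delta> * dm \<le> (\<Sum>i\<in>UNIV. D y ((dm * r) *\<^sub>R axis i 1))" .
  moreover have "y \<in> cbox (\<chi> i. x0 $ i - 4) (\<chi> i. x0 $ i + 4)"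
  proof -
    have "\<bar>(y - x0) $ i\<bar> \<le> 4" for i using component_le_norm_cart[of "y - x0" i] assms(4) by linarith
    then have "\<bar>y $ i - x0 $ i\<bar> \<le> 4" for i by simp
    then show ?thesis by (simp add: mem_box_cart abs_diff_le_iff)
  qed
  ultimately show ?thesis by (simp add: bad_def r_def)
qed

text \<open>Markov's inequality: the integral over a cube of side 8 is of order (\<delta>/\<tau>)^2
  by \<open>integral_second_difference_le\<close>, the threshold is of order \<delta>.\<close>

lemma measure_bad_le:
  assumes "0 < \<delta>" "0 < \<tau>"
  shows "measure lebesgue (bad \<delta> \<tau>) \<le> 24 * dm\<^sup>2 * 8 ^ (CARD('n) - 1) * \<delta> / \<tau>\<^sup>2"
proof -
  define a b :: "real^'n" where "a = (\<chi> i. x0 $ i - 4)" and "b = (\<chi> i. x0 $ i + 4)"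
  define R where "R = dm * (6 * \<delta> / \<tau>)"
  have dp: "0 < dm" using dm_ge_1 by simp
  have R: "0 < R" using dp assms by (simp add: R_def)
  define \<Psi> where "\<Psi> y = (\<Sum>i\<in>UNIV. D y (R *\<^sub>R axis i 1))" for y :: "real^'n"
  have cont: "continuous_on (cbox a b) \<Psi>" unfolding \<Psi>_def by (intro continuous_intros D_continuous')
  have sp: "space (lebesgue_on (cbox a b)) = cbox a b" by (simp add: space_restrict_space)
  have bad: "bad \<delta> \<tau> = {y \<in> space (lebesgue_on (cbox a b)). 3 * \<delta> * dm \<le> \<Psi> y}"
    unfolding sp by (simp add: bad_def \<Psi>_def a_def b_def R_def)
  have "measure lebesgue (bad \<delta> \<tau>) = measure (lebesgue_on (cbox a b)) (bad \<delta> \<tau>)"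
    by (rule measure_restrict_space[symmetric]) (auto simp: bad_def a_def b_def)
  also have "\<dots> \<le> (\<integral>y. \<Psi> y \<partial>lebesgue_on (cbox a b)) / (3 * \<delta> * dm)"
    unfolding bad
  proof (rule integral_Markov_inequality_measure)
    show "integrable (lebesgue_on (cbox a b)) \<Psi>" by (rule continuous_imp_integrable[OF cont])
    show "{} \<in> sets (lebesgue_on (cbox a b))" by simp
    show "AE x in lebesgue_on (cbox a b). 0 \<le> \<Psi> x" by (simp add: \<Psi>_def sum_nonneg D_nonneg)
    show "0 < 3 * \<delta> * dm" using dp assms by simp
  qed
  also have "(\<integral>y. \<Psi> y \<partial>lebesgue_on (cbox a b)) = integral (cbox a b) \<Psi>"
    by (rule lebesgue_integral_eq_integral[OF continuous_imp_integrable[OF cont]]) simp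
  also have "\<dots> = (\<Sum>i\<in>UNIV. integral (cbox a b) (\<lambda>y. D y (R *\<^sub>R axis i 1)))"
    unfolding \<Psi>_def by (intro integral_sum integrable_continuous D_continuous') auto
  also have "\<dots> \<le> (\<Sum>i\<in>(UNIV :: 'n set). 2 * R\<^sup>2 * 8 ^ (CARD('n) - 1))"
    by (intro sum_mono integral_second_difference_le R) (auto simp: a_def b_def)
  also have "\<dots> = dm * (2 * R\<^sup>2 * 8 ^ (CARD('n) - 1))" by (simp add: dm_eq)
  also have "\<dots> / (3 * \<delta> * dm) = 24 * dm\<^sup>2 * 8 ^ (CARD('n) - 1) * \<delta> / \<tau>\<^sup>2"
    using dp assms by (simp add: R_def power2_eq_square field_simps)
  finally show ?thesis using dp assms by (simp add: divide_right_mono)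
qed


lemma card_mnorm_separated_le:
  assumes "finite S" "0 < \<delta>" "0 < \<sigma>" "0 \<le> \<alpha>" and near: "\<And>x. x \<in> S \<Longrightarrow> mnorm \<delta> z (x - z) \<le> \<alpha>"
    and sep: "\<And>x y. x \<in> S \<Longrightarrow> y \<in> S \<Longrightarrow> x \<noteq> y \<Longrightarrow> \<sigma> < mnorm \<delta> z (x - y)"
  shows "real (card S) \<le> (1 + 2 * \<alpha> / \<sigma>) ^ CARD('n)"
proof -
  let ?A = "mmat \<delta> z"
  have inj: "inj_on (\<lambda>x. ?A *v x) S"
  proof (rule inj_onI)
    fix x y assume xy: "x \<in> S" "y \<in> S" "?A *v x = ?A *v y"
    then have "mnorm \<delta> z (x - y) = 0" by (simp add: mnorm_def matrix_vector_mult_diff_distrib)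
    then show "x = y" using sep[OF xy(1,2)] assms(3) by force
  qed
  have "real (card ((\<lambda>x. ?A *v x) ` S)) \<le> (1 + 2 * \<alpha> / \<sigma>) ^ CARD('n)"
  proof (rule card_separated_le[where c = "?A *v z"])
    show "norm (y - ?A *v z) \<le> \<alpha>" if "y \<in> (\<lambda>x. ?A *v x) ` S" for y
      using that near by (auto simp: mnorm_def simp flip: matrix_vector_mult_diff_distrib)
    show "\<sigma> < norm (x - y)" if xy: "x \<in> (\<lambda>x. ?A *v x) ` S" "y \<in> (\<lambda>x. ?A *v x) ` S" "x \<noteq> y" for x y
    proof -
      obtain x' where x': "x = ?A *v x'" "x' \<in> S" using xy(1) by (rule imageE)
      obtain y' where y': "y = ?A *v y'" "y' \<in> S" using xy(2) by (rule imageE)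
      have "x' \<noteq> y'" using xy(3) x'(1) y'(1) by blast
      from sep[OF x'(2) y'(2) this] show ?thesis
        by (simp add: mnorm_def matrix_vector_mult_diff_distrib x'(1) y'(1))
    qed
  qed (use assms in auto)
  then show ?thesis by (simp add: card_image[OF inj])
qed

section \<open>Ellipsoids, dual boxes and their volumes\<close>

definition mball :: "real \<Rightarrow> real^'n \<Rightarrow> real \<Rightarrow> (real^'n) set" where
  "mball \<delta> x r = {y. mnorm \<delta> x (y - x) \<le> r}"

text \<open>In product form, because the volume of the dual box contains the same factor
  \<open>vol_factor (mmat \<delta> x)\<close> and the two cancel.\<close>

lemma mball_measure:
  assumes "0 < \<delta>" "0 \<le> r"
  shows "mball \<delta> x r \<in> lmeasurable"
    "measure lebesgue (mball \<delta> x r) * vol_factor (mmat \<delta> x) = r ^ CARD('n) * unit_vol TYPE('n)"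
proof -
  let ?A = "mmat \<delta> x"
  obtain B where B: "?A ** B = mat 1" "B ** ?A = mat 1"
    using mmat(1)[OF assms(1), of x] unfolding invertible_det_nz[symmetric] invertible_def by blast
  have AB: "?A *v (B *v v) = v" "B *v (?A *v v) = v" for v
    by (simp_all add: matrix_vector_mul_assoc B)
  have eq: "mball \<delta> x r = (+) x ` ((\<lambda>v. B *v v) ` cball 0 r)"
  proof (intro set_eqI iffI)
    fix y assume "y \<in> mball \<delta> x r"
    then have "?A *v (y - x) \<in> cball 0 r" by (simp add: mball_def mnorm_def)
    moreover have "y = x + B *v (?A *v (y - x))" by (simp only: AB) simp
    ultimately show "y \<in> (+) x ` ((\<lambda>v. B *v v) ` cball 0 r)" by blast
  qed (auto simp: mball_def mnorm_def AB)
  have "compact ((\<lambda>v. B *v v) ` cball 0 r)"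
    by (intro compact_continuous_image matrix_vector_mult_linear_continuous_on) simp
  then show "mball \<delta> x r \<in> lmeasurable"
    unfolding eq by (intro measurable_translation lmeasurable_compact)
  have "measure lebesgue (mball \<delta> x r) = measure lebesgue ((\<lambda>v. B *v v) ` cball 0 r)"
    unfolding eq by (rule measure_translation)
  also have "\<dots> = vol_factor B * (r ^ CARD('n) * unit_vol TYPE('n))"
    using measure_matrix_image[OF compact_cball, of B 0 r] measure_cball[OF assms(2), of "0 :: real^'n"]
    by simp
  finally have "measure lebesgue (mball \<delta> x r) * vol_factor ?A
      = (vol_factor B * vol_factor ?A) * (r ^ CARD('n) * unit_vol TYPE('n))"
    by (simp only: mult_ac)
  also have "vol_factor B * vol_factor ?A = 1"
    using vol_factor_mult[of B ?A] by (simp add: B vol_factor_mat_1)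
  finally show "measure lebesgue (mball \<delta> x r) * vol_factor ?A = r ^ CARD('n) * unit_vol TYPE('n)" by simp
qed

definition dual_centre :: "real \<Rightarrow> real^'n \<Rightarrow> real^'n" where
  "dual_centre \<delta> x = (SOME p. \<forall>c. norm c \<le> 1 / (2 * dm) \<longrightarrow> p + (\<delta> / sqrt dm) *\<^sub>R (transpose (mmat \<delta> x) *v c) \<in> subdiff \<delta> x)"

lemma dual_centre: "0 < \<delta> \<Longrightarrow> norm c \<le> 1 / (2 * dm) \<Longrightarrow> dual_centre \<delta> x + (\<delta> / sqrt dm) *\<^sub>R (transpose (mmat \<delta> x) *v c) \<in> subdiff \<delta> x"
  using someI_ex[OF subdiff_box[of \<delta> x]] unfolding dual_centre_def by blast

text \<open>The radius is half of the 1/(2d) that \<open>subdiff_box\<close> permits; the other half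
  becomes the linear margin in \<open>dual_box_strong\<close>.\<close>

definition dual_box :: "real \<Rightarrow> real^'n \<Rightarrow> (real^'n) set" where
  "dual_box \<delta> x = (+) (dual_centre \<delta> x) ` ((\<lambda>c. ((\<delta> / sqrt dm) *\<^sub>R transpose (mmat \<delta> x)) *v c) ` cball 0 (1 / (4 * dm)))"

lemma dual_box_measure:
  assumes "0 < \<delta>"
  shows "dual_box \<delta> x \<in> lmeasurable"
    "measure lebesgue (dual_box \<delta> x) = (\<delta> / (4 * dm * sqrt dm)) ^ CARD('n) * unit_vol TYPE('n) * vol_factor (mmat \<delta> x)"
proof -
  have dp: "0 < dm" using dm_ge_1 by simp
  let ?B = "(\<delta> / sqrt dm) *\<^sub>R transpose (mmat \<delta> x)" and ?r = "1 / (4 * dm)"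
  have "compact ((\<lambda>v. ?B *v v) ` cball 0 ?r)"
    by (intro compact_continuous_image matrix_vector_mult_linear_continuous_on) simp
  then show "dual_box \<delta> x \<in> lmeasurable"
    unfolding dual_box_def by (intro measurable_translation lmeasurable_compact)
  have "measure lebesgue (dual_box \<delta> x) = measure lebesgue ((\<lambda>v. ?B *v v) ` cball 0 ?r)"
    unfolding dual_box_def by (rule measure_translation)
  also have "\<dots> = vol_factor ?B * (?r ^ CARD('n) * unit_vol TYPE('n))"
    using measure_matrix_image[OF compact_cball, of ?B 0 ?r] measure_cball[of ?r "0 :: real^'n"] dp
    by simp
  also have "vol_factor ?B = (\<delta> / sqrt dm) ^ CARD('n) * vol_factor (mmat \<delta> x)"
    using assms dp by (simp add: vol_factor_scaleR vol_factor_transpose)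
  also have "(\<delta> / sqrt dm) ^ CARD('n) * vol_factor (mmat \<delta> x) * (?r ^ CARD('n) * unit_vol TYPE('n))
     = ((\<delta> / sqrt dm) * ?r) ^ CARD('n) * unit_vol TYPE('n) * vol_factor (mmat \<delta> x)"
    by (simp only: power_mult_distrib mult_ac)
  finally show "measure lebesgue (dual_box \<delta> x) = (\<delta> / (4 * dm * sqrt dm)) ^ CARD('n) * unit_vol TYPE('n) * vol_factor (mmat \<delta> x)"
    by (simp add: mult_ac)
qed

text \<open>The parameter c of p may still move by 1/(4d) towards the image of y - x. The new slope
  is also a \<delta>-subgradient, and it is steeper towards y by \<delta>/(4 d sqrt d) times
  \<open>mnorm\<close>.\<close>

lemma dual_box_strong:
  assumes "0 < \<delta>" "p \<in> dual_box \<delta> x"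
  shows "\<phi> x + p \<bullet> (y - x) + \<delta> / (4 * dm * sqrt dm) * mnorm \<delta> x (y - x) - \<delta> \<le> \<phi> y"
proof -
  have dp: "0 < dm" using dm_ge_1 by simp
  let ?A = "mmat \<delta> x" and ?s = "1 / (4 * dm)"
  obtain c where c: "norm c \<le> ?s" "p = dual_centre \<delta> x + (\<delta> / sqrt dm) *\<^sub>R (transpose ?A *v c)"
    using assms(2) unfolding dual_box_def by (auto simp flip: scaleR_matrix_vector_assoc simp del: transpose_matrix_vector)
  define v where "v = ?A *v (y - x)"
  define c' where "c' = c + (?s / norm v) *\<^sub>R v"
  have "norm c' \<le> ?s + ?s"
    unfolding c'_def using c(1) dp by (intro norm_triangle_mono) (auto simp: field_simps)
  then have "norm c' \<le> 1 / (2 * dm)" by simp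
  then have q: "dual_centre \<delta> x + (\<delta> / sqrt dm) *\<^sub>R (transpose ?A *v c') \<in> subdiff \<delta> x" by (rule dual_centre[OF assms(1)])
  have "transpose ?A *v c' = transpose ?A *v c + (?s / norm v) *\<^sub>R (transpose ?A *v v)"
    unfolding c'_def by (simp only: matrix_vector_right_distrib matrix_vector_mult_scaleR)
  then have e: "dual_centre \<delta> x + (\<delta> / sqrt dm) *\<^sub>R (transpose ?A *v c') = p + ((\<delta> / sqrt dm) * (?s / norm v)) *\<^sub>R (transpose ?A *v v)"
    unfolding c(2) by (simp only: scaleR_add_right scaleR_scaleR add.assoc)
  have "(transpose ?A *v v) \<bullet> (y - x) = v \<bullet> v"
    by (simp add: dot_lmul_matrix v_def)
  then have "(?s / norm v) * ((transpose ?A *v v) \<bullet> (y - x)) = ?s * mnorm \<delta> x (y - x)"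
    by (simp add: mnorm_def dot_square_norm power2_eq_square flip: v_def)
  then have "((\<delta> / sqrt dm) * (?s / norm v)) * ((transpose ?A *v v) \<bullet> (y - x)) = (\<delta> / sqrt dm) * (?s * mnorm \<delta> x (y - x))"
    by (simp only: mult.assoc)
  moreover have "\<phi> x + (p + ((\<delta> / sqrt dm) * (?s / norm v)) *\<^sub>R (transpose ?A *v v)) \<bullet> (y - x) - \<delta> \<le> \<phi> y"
    using q unfolding e subdiff_def by blast
  ultimately show ?thesis by (simp add: inner_add_left mult_ac)
qed

lemma dual_box_subdiff:
  assumes "0 < \<delta>" "p \<in> dual_box \<delta> x"
  shows "\<phi> x + p \<bullet> (y - x) - \<delta> \<le> \<phi> y"
proof -
  have "0 \<le> \<delta> / (4 * dm * sqrt dm) * mnorm \<delta> x (y - x)" using assms(1) dm_ge_1 by simp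
  then show ?thesis using dual_box_strong[OF assms, of y] by linarith
qed

text \<open>On the level set at z the function is at most an affine function of slope p plus
  O(\<delta>), while by \<open>dual_box_strong\<close> at x it exceeds one of the same slope by a
  multiple of \<delta> times the norm at x. So this level set lies in a bounded multiple of the
  ellipsoid at x: boxes with a common point belong to close centres with comparable norms.\<close>

lemma dual_box_common:
  assumes d: "0 < \<delta>" and px: "p \<in> dual_box \<delta> x" and pz: "p \<in> dual_box \<delta> z"
  shows "mnorm \<delta> z (x - z) \<le> 8 * dm * sqrt dm" "mnorm \<delta> x h \<le> 16 * dm * sqrt dm * mnorm \<delta> z h"
proof -
  define k where "k = 4 * dm * sqrt dm"
  have k: "0 < k" using dm_ge_1 by (simp add: k_def)
  have cancel: "g \<le> c * k" if "\<delta> / k * g \<le> c * \<delta>" for g c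
    using that d k by (simp add: field_simps)
  have "\<delta> / k * mnorm \<delta> z (x - z) \<le> 2 * \<delta>"
    using dual_box_strong[OF d pz, of x] dual_box_subdiff[OF d px, of z] unfolding k_def
    by (simp add: inner_diff_right)
  from cancel[OF this] show "mnorm \<delta> z (x - z) \<le> 8 * dm * sqrt dm" by (simp add: k_def)
  show "mnorm \<delta> x h \<le> 16 * dm * sqrt dm * mnorm \<delta> z h"
  proof (rule mnorm_compare[OF d])
    fix h assume "mnorm \<delta> z h \<le> 1"
    then have D: "D z h \<le> \<delta>" by (rule D_le_mnorm[OF d])
    have "mnorm \<delta> x (z + g - x) \<le> 4 * k" if "D z g \<le> \<delta>" for g
    proof (rule cancel)
      have "\<phi> z - p \<bullet> g - \<delta> \<le> \<phi> (z - g)" using dual_box_subdiff[OF d pz, of "z - g"] by simp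
      then have "\<phi> (z + g) \<le> \<phi> z + p \<bullet> g + 2 * \<delta>" using that unfolding D_def by linarith
      then show "\<delta> / k * mnorm \<delta> x (z + g - x) \<le> 4 * \<delta>"
        using dual_box_strong[OF d px, of "z + g"] dual_box_subdiff[OF d pz, of x] unfolding k_def
        by (simp add: inner_diff_right inner_add_right)
    qed
    from this[OF D] this[of "-h"] D have 1: "mnorm \<delta> x (z + h - x) \<le> 4 * k" "mnorm \<delta> x (z - h - x) \<le> 4 * k" by auto
    have "mnorm \<delta> x (2 *\<^sub>R h) \<le> mnorm \<delta> x (z + h - x) + mnorm \<delta> x (x - (z - h))"
      using mnorm_triangle[of \<delta> x "z + h - x" "x - (z - h)"] by (simp add: scaleR_2)
    then have "2 * mnorm \<delta> x h \<le> 8 * k" using 1 mnorm_minus[of \<delta> x x "z - h"] by (simp add: mnorm_scale)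
    then show "mnorm \<delta> x h \<le> 16 * dm * sqrt dm" by (simp add: k_def)
  qed
qed

definition separated :: "real \<Rightarrow> real \<Rightarrow> (real^'n) set \<Rightarrow> bool" where
  "separated \<delta> \<rho> S \<longleftrightarrow> (\<forall>x\<in>S. \<forall>y\<in>S. x \<noteq> y \<longrightarrow> \<rho> < mnorm \<delta> x (y - x))"

lemma dual_box_overlap:
  assumes "0 < \<delta>" "0 < \<rho>" "finite S" "separated \<delta> \<rho> S"
  shows "real (card {x \<in> S. p \<in> dual_box \<delta> x}) \<le> (1 + 256 * dm ^ 3 / \<rho>) ^ CARD('n)"
proof (cases "{x \<in> S. p \<in> dual_box \<delta> x} = {}")
  case True
  have "0 \<le> (1 + 256 * dm ^ 3 / \<rho>) ^ CARD('n)" using assms dm_ge_1 by simp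
  then show ?thesis using True by (simp only: card.empty of_nat_0)
next
  case False
  then obtain z where z: "z \<in> S" "p \<in> dual_box \<delta> z" by auto
  define K where "K = 16 * dm * sqrt dm"
  have K: "0 < K" using dm_ge_1 by (simp add: K_def)
  have "real (card {x \<in> S. p \<in> dual_box \<delta> x}) \<le> (1 + 2 * (8 * dm * sqrt dm) / (\<rho> / K)) ^ CARD('n)"
  proof (rule card_mnorm_separated_le[OF _ assms(1)])
    show "mnorm \<delta> z (x - z) \<le> 8 * dm * sqrt dm" if "x \<in> {x \<in> S. p \<in> dual_box \<delta> x}" for x
      using dual_box_common(1)[OF assms(1) _ z(2)] that by auto
    fix x y assume xy: "x \<in> {x \<in> S. p \<in> dual_box \<delta> x}" "y \<in> {x \<in> S. p \<in> dual_box \<delta> x}" "x \<noteq> y"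
    then have "\<rho> < mnorm \<delta> x (y - x)" using assms(4) unfolding separated_def by auto
    also have "mnorm \<delta> x (y - x) \<le> K * mnorm \<delta> z (y - x)"
      using dual_box_common(2)[OF assms(1) _ z(2)] xy unfolding K_def by auto
    finally show "\<rho> / K < mnorm \<delta> z (x - y)" using K mnorm_minus[of \<delta> z x y] by (simp add: field_simps)
  qed (use assms K dm_ge_1 in auto)
  also have "2 * (8 * dm * sqrt dm) / (\<rho> / K) = 256 * dm ^ 3 / \<rho>"
    using dm_ge_1 by (simp add: K_def power3_eq_cube)
  finally show ?thesis .
qed

text \<open>Through a common point two applications of \<open>mnorm_near\<close> cost 16 d^2;
  together with the radius of the first ellipsoid this gives 17 d^2.\<close>

lemma mball_disjoint:
  assumes d: "0 < \<delta>" and "0 < \<rho>" "\<rho> \<le> 1" "separated \<delta> \<rho> S" and xz: "x \<in> S" "z \<in> S" "x \<noteq> z"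
  shows "disjnt (mball \<delta> x (\<rho> / (17 * dm\<^sup>2))) (mball \<delta> z (\<rho> / (17 * dm\<^sup>2)))"
proof (rule ccontr)
  assume meet: "\<not> ?thesis"
  define r where "r = \<rho> / (17 * dm\<^sup>2)"
  have d1: "1 \<le> dm\<^sup>2" using dm_ge_1 by (simp add: one_le_power)
  have "8 * \<rho> \<le> 17 * dm\<^sup>2" using assms(3) d1 by linarith
  then have r8: "r \<le> 1/8" using d1 by (simp add: r_def divide_le_eq)
  have rp: "0 < r" using assms(2) dm_ge_1 by (simp add: r_def)
  obtain y where y: "mnorm \<delta> x (y - x) \<le> r" "mnorm \<delta> z (y - z) \<le> r"
    using meet by (auto simp: disjnt_def mball_def r_def)
  have "mnorm \<delta> x (y - z) \<le> 4 * dm * mnorm \<delta> y (y - z)" using mnorm_near(2)[OF d] y(1) r8 by auto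
  also have "\<dots> \<le> 4 * dm * (4 * dm * mnorm \<delta> z (y - z))"
    using mnorm_near(1)[OF d, of z y "y - z"] y(2) r8 dm_ge_1 by (intro mult_left_mono) auto
  also have "\<dots> \<le> 4 * dm * (4 * dm * r)" using y(2) dm_ge_1 by (intro mult_left_mono) auto
  finally have "mnorm \<delta> x (y - z) \<le> 16 * dm\<^sup>2 * r" by (simp add: power2_eq_square mult_ac)
  moreover have "mnorm \<delta> x (z - x) \<le> mnorm \<delta> x (z - y) + mnorm \<delta> x (y - x)" by (rule mnorm_triangle3)
  ultimately have "mnorm \<delta> x (z - x) \<le> 16 * dm\<^sup>2 * r + r" using y(1) mnorm_minus[of \<delta> x z y] by linarith
  also have "\<dots> \<le> 16 * dm\<^sup>2 * r + dm\<^sup>2 * r" using d1 rp by (simp add: mult_right_mono)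
  also have "\<dots> = \<rho>" using dm_ge_1 by (simp add: r_def field_simps)
  finally show False using assms(4) xz unfolding separated_def by force
qed

end

definition overlap_const :: "'n::finite itself \<Rightarrow> real \<Rightarrow> real" where
  "overlap_const _ \<rho> = (1 + 256 * real CARD('n) ^ 3 / \<rho>) ^ CARD('n)"

text \<open>The constant c for which the shrunk ellipsoid of radius \<rho>/(17 d^2) and the dual box
  have volume product c * \<delta>^d.\<close>

definition pair_const :: "'n::finite itself \<Rightarrow> real \<Rightarrow> real" where
  "pair_const T \<rho> = (\<rho> / (17 * (real CARD('n))\<^sup>2)) ^ CARD('n) * unit_vol T *
     ((1 / (4 * real CARD('n) * sqrt (real CARD('n)))) ^ CARD('n) * unit_vol T)"

text \<open>In the numerator, the first line belongs to the boxes in the shell, the second to the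
  ellipsoids in \<open>bad\<close>.\<close>

definition count_const :: "'n::finite itself \<Rightarrow> real \<Rightarrow> real" where
  "count_const T \<rho> = (4 ^ CARD('n) * unit_vol T + overlap_const T \<rho> * real CARD('n) * unit_vol T
     + 48 * (real CARD('n))\<^sup>2 * 8 ^ (CARD('n) - 1) + 2 * overlap_const T \<rho> * unit_vol T)
     / (2 * sqrt (pair_const T \<rho>))"

context signed_dist begin

text \<open>Each ellipsoid is paired with a dual box so that the product of the two volumes is a constant
  times \<open>\<delta> ^ d\<close>. The total volume on one of the two sides is small: boxes centred at slopes of norm
  close to \<open>1\<close> lie in a thin shell, and all other ellipsoids lie in the small set \<open>bad\<close>.\<close>
lemma card_separated_points_le:
  assumes d: "0 < \<delta>" "\<delta> \<le> 1" and r: "0 < \<rho>" "\<rho> \<le> 1"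
    and S: "finite S" "S \<subseteq> \<Omega>" "separated \<delta> \<rho> S"
  shows "real (card S) \<le> count_const TYPE('n) \<rho> * \<delta> powr (1/8 - real CARD('n) / 2)"
proof -
  let ?n = "CARD('n)" and ?w = "unit_vol TYPE('n)"
  let ?m = "overlap_const TYPE('n) \<rho>" and ?c0 = "pair_const TYPE('n) \<rho>"
  have wp: "0 < ?w" by (rule unit_vol_pos)
  have dp: "0 < dm" using dm_ge_1 by simp
  have c0: "0 < ?c0" using wp r by (simp add: pair_const_def)
  have mp: "0 \<le> ?m" using r by (simp add: overlap_const_def)
  \<comment> \<open>Chosen with \<tau> of order s^2. In the shell case the weighted means have size
    s and \<tau>/s, both O(s). In the other case the measure of \<open>bad\<close>, of order
    \<delta>/\<tau>^2 = O(s^4), leads to O(s^2).\<close>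
  define s where "s = \<delta> powr (1/8)"
  have s01: "0 < s" "s \<le> 1" using d by (auto simp: s_def intro: powr_le1)
  have "s ^ 8 = s powr real 8" using s01(1) by (rule powr_realpow[symmetric])
  also have "\<dots> = \<delta>" using d by (simp add: s_def powr_powr)
  finally have s: "0 < s" "s \<le> 1" "s ^ 8 = \<delta>" using s01 by auto
  define \<tau> where "\<tau> = s\<^sup>2 / 2"
  have \<tau>: "0 < \<tau>" "\<tau> \<le> 1/2" using s by (auto simp: \<tau>_def power_le_one)
  define r2 where "r2 = \<rho> / (17 * dm\<^sup>2)"
  have d1: "1 \<le> dm\<^sup>2" using dm_ge_1 by (simp add: one_le_power)
  have "\<rho> \<le> 17 * dm\<^sup>2" using r d1 by linarith
  then have r2: "0 < r2" "r2 \<le> 1" using r dp by (auto simp: r2_def divide_le_eq)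
  define g where "g x = measure lebesgue (mball \<delta> x r2)" for x
  define q where "q x = measure lebesgue (dual_box \<delta> x)" for x
  have gq: "g x * q x = ?c0 * \<delta> ^ ?n" for x
  proof -
    have "g x * q x = (g x * vol_factor (mmat \<delta> x)) * ((\<delta> / (4 * dm * sqrt dm)) ^ ?n * ?w)"
      unfolding q_def dual_box_measure(2)[OF d(1)] by (simp only: mult_ac)
    also have "\<dots> = (r2 ^ ?n * ?w) * ((\<delta> / (4 * dm * sqrt dm)) ^ ?n * ?w)"
      unfolding g_def using mball_measure(2)[OF d(1), of r2 x] r2 by simp
    also have "\<dots> = ?c0 * \<delta> ^ ?n"
      by (simp add: pair_const_def r2_def dm_eq power_mult_distrib power_divide mult_ac)
    finally show ?thesis .
  qed
  have gnn: "0 \<le> g x" "0 \<le> q x" for x by (auto simp: g_def q_def)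
  define Q where "Q = sqrt (?c0 * \<delta> ^ ?n)"
  have Qp: "0 < Q" using c0 d by (simp add: Q_def)
  \<comment> \<open>The free weight a exploits that only one of the two total volumes is
    small.\<close>
  have amgm: "2 * Q \<le> a * g x + q x / a" if "0 < a" for a x
  proof -
    have "Q = sqrt ((a * g x) * (q x / a))" using that by (simp add: Q_def gq)
    then show ?thesis using arith_geo_mean_sqrt[of "a * g x" "q x / a"] gnn that by simp
  qed
  have disj: "pairwise (\<lambda>x y. disjnt (mball \<delta> x r2) (mball \<delta> y r2)) S"
    unfolding pairwise_def r2_def using mball_disjoint[OF d(1) r S(3)] by blast
  have gsum: "(\<Sum>x\<in>I. g x) \<le> measure lebesgue U"
    if "I \<subseteq> S" "U \<in> lmeasurable" "\<And>x. x \<in> I \<Longrightarrow> mball \<delta> x r2 \<subseteq> U" for I U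
  proof -
    have fI: "finite I" using that(1) S(1) by (rule finite_subset)
    have m: "mball \<delta> x r2 \<in> lmeasurable" for x using mball_measure(1)[OF d(1)] r2 by simp
    have "(\<Sum>x\<in>I. g x) = measure lebesgue (\<Union>x\<in>I. mball \<delta> x r2)"
      unfolding g_def using fI m pairwise_subset[OF disj that(1)] by (intro measure_UNION'[symmetric])
    also have "\<dots> \<le> measure lebesgue U"
      using that fI m by (intro measure_mono_fmeasurable) (auto intro: sets.finite_UN fmeasurableD)
    finally show ?thesis .
  qed
  have qsum: "(\<Sum>x\<in>I. q x) \<le> ?m * measure lebesgue U"
    if "I \<subseteq> S" "U \<in> lmeasurable" "\<And>x. x \<in> I \<Longrightarrow> dual_box \<delta> x \<subseteq> U" for I U
    unfolding q_def
  proof (rule sum_measure_overlap_le)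
    show "finite I" using that(1) S(1) by (rule finite_subset)
    show "dual_box \<delta> x \<in> lmeasurable" for x using dual_box_measure(1)[OF d(1)] .
    fix p
    have "card {i \<in> I. p \<in> dual_box \<delta> i} \<le> card {i \<in> S. p \<in> dual_box \<delta> i}"
      using that(1) S(1) by (intro card_mono) auto
    then show "real (card {i \<in> I. p \<in> dual_box \<delta> i}) \<le> ?m"
      using dual_box_overlap[OF d(1) r(1) S(1,3), of p] by (simp add: overlap_const_def dm_eq)
  qed (use that in auto)
  have gnear: "mball \<delta> x r2 \<subseteq> cball x0 4" if "x \<in> S" for x
  proof
    fix y assume "y \<in> mball \<delta> x r2"
    then have "mnorm \<delta> x (y - x) \<le> 1" using r2 by (simp add: mball_def)
    then have "norm (y - x) \<le> 5/2" using norm_le_mnorm[of x \<delta> "y - x"] that S(2) d by auto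
    moreover have "norm (x - x0) \<le> 1" using near that S(2) by auto
    moreover have "norm (y - x0) \<le> norm (y - x) + norm (x - x0)" using norm_triangle_ineq[of "y - x" "x - x0"] by simp
    ultimately show "y \<in> cball x0 4" by (simp add: dist_norm norm_minus_commute)
  qed
  have qsub: "p \<in> subdiff \<delta> x" if "p \<in> dual_box \<delta> x" for p x
    using dual_box_subdiff[OF d(1) that] by (simp add: subdiff_def)
  define S1 where "S1 = {x \<in> S. 1 - \<tau> \<le> norm (dual_centre \<delta> x)}"
  define S2 where "S2 = {x \<in> S. norm (dual_centre \<delta> x) < 1 - \<tau>}"
  have "real (card S1) * (2 * Q) = (\<Sum>x\<in>S1. 2 * Q)" by simp
  also have "\<dots> \<le> (\<Sum>x\<in>S1. s * g x + q x / s)" by (intro sum_mono amgm s)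
  also have "\<dots> = s * (\<Sum>x\<in>S1. g x) + (\<Sum>x\<in>S1. q x) / s"
    by (simp add: sum.distrib sum_distrib_left sum_divide_distrib)
  also have "\<dots> \<le> s * (4 ^ ?n * ?w) + (?m * (2 * real ?n * \<tau> * ?w)) / s"
  proof (intro add_mono mult_left_mono divide_right_mono)
    have "measure lebesgue (cball x0 4) = 4 ^ ?n * ?w" by (rule measure_cball) simp
    then show "(\<Sum>x\<in>S1. g x) \<le> 4 ^ ?n * ?w"
      using gsum[of S1 "cball x0 4"] gnear by (auto simp: S1_def)
    let ?U = "cball 0 1 - ball (0::real^'n) (1 - 2 * \<tau>)"
    \<comment> \<open>The box is symmetric about its centre and lies in the unit ball. The
      reflection of p also has norm at most 1, so p cannot be shorter than 2 (1 - \<tau>) -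
      1.\<close>
    have Usub: "dual_box \<delta> x \<subseteq> ?U" if "x \<in> S1" for x
    proof
      fix p assume p: "p \<in> dual_box \<delta> x"
      let ?B = "(\<delta> / sqrt dm) *\<^sub>R transpose (mmat \<delta> x)"
      obtain c where c: "norm c \<le> 1 / (4 * dm)" "p = dual_centre \<delta> x + ?B *v c"
        using p unfolding dual_box_def by auto
      have "dual_centre \<delta> x + ?B *v (- c) \<in> dual_box \<delta> x" unfolding dual_box_def using c(1) by (intro imageI) simp
      then have 1: "norm (dual_centre \<delta> x + ?B *v (- c)) \<le> 1" using qsub subdiff_norm by blast
      have "2 *\<^sub>R dual_centre \<delta> x = p + (dual_centre \<delta> x + ?B *v (- c))"
        unfolding c(2) using matrix_vector_right_distrib[of ?B c "- c"] by (simp add: scaleR_2 algebra_simps)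
      then have "2 * norm (dual_centre \<delta> x) \<le> norm p + norm (dual_centre \<delta> x + ?B *v (- c))"
        by (metis norm_scaleR norm_triangle_ineq abs_numeral)
      moreover have "norm p \<le> 1" using qsub[OF p] subdiff_norm by blast
      ultimately show "p \<in> ?U" using 1 that by (simp add: S1_def)
    qed
    have "measure lebesgue ?U = measure lebesgue (cball (0::real^'n) 1) - measure lebesgue (ball (0::real^'n) (1 - 2 * \<tau>))"
      using \<tau> by (intro measurable_measure_Diff) (auto intro!: order_trans[OF ball_subset_cball])
    also have "measure lebesgue (ball (0::real^'n) (1 - 2 * \<tau>)) = (1 - 2 * \<tau>) ^ ?n * ?w"
      using \<tau> measure_cball[of "1 - 2 * \<tau>" "0 :: real^'n"] by (simp add: content_cball_conv_ball)
    also have "?w - (1 - 2 * \<tau>) ^ ?n * ?w \<le> 2 * real ?n * \<tau> * ?w"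
    proof -
      have "1 + real ?n * (- 2 * \<tau>) \<le> (1 + (- 2 * \<tau>)) ^ ?n" using \<tau> by (intro Bernoulli_inequality) simp
      then have "(1 - 2 * real ?n * \<tau>) * ?w \<le> (1 - 2 * \<tau>) ^ ?n * ?w" using wp by (intro mult_right_mono) auto
      then show ?thesis by (simp add: algebra_simps)
    qed
    finally have U: "measure lebesgue ?U \<le> 2 * real ?n * \<tau> * ?w" .
    have "(\<Sum>x\<in>S1. q x) \<le> ?m * measure lebesgue ?U"
      using Usub by (intro qsum) (auto simp: S1_def fmeasurable.Diff)
    also have "\<dots> \<le> ?m * (2 * real ?n * \<tau> * ?w)" using U mp by (rule mult_left_mono)
    finally show "(\<Sum>x\<in>S1. q x) \<le> ?m * (2 * real ?n * \<tau> * ?w)" .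
  qed (use s in auto)
  also have "\<dots> = s * (4 ^ ?n * ?w + ?m * real ?n * ?w)"
    using s by (simp add: \<tau>_def power2_eq_square field_simps)
  finally have I: "real (card S1) * (2 * Q) \<le> s * (4 ^ ?n * ?w + ?m * real ?n * ?w)" .
  \<comment> \<open>Now the ellipsoids have the small total volume, so their weight is
    large.\<close>
  define a where "a = 1 / (2 * s\<^sup>2)"
  have a: "0 < a" using s by (simp add: a_def)
  have "real (card S2) * (2 * Q) = (\<Sum>x\<in>S2. 2 * Q)" by simp
  also have "\<dots> \<le> (\<Sum>x\<in>S2. a * g x + q x / a)" by (intro sum_mono amgm a)
  also have "\<dots> = a * (\<Sum>x\<in>S2. g x) + (\<Sum>x\<in>S2. q x) / a"
    by (simp add: sum.distrib sum_distrib_left sum_divide_distrib)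
  also have "\<dots> \<le> a * (24 * dm\<^sup>2 * 8 ^ (?n - 1) * \<delta> / \<tau>\<^sup>2) + (?m * ?w) / a"
  proof (intro add_mono mult_left_mono divide_right_mono)
    \<comment> \<open>On the ellipsoid \<phi> stays within 2 * \<delta> above the affine function
      through x with the slope of the centre, which is thus a short 3 * \<delta>-subgradient at
      every point y of it.\<close>
    have sub: "mball \<delta> x r2 \<subseteq> bad \<delta> \<tau>" if "x \<in> S2" for x
    proof
      fix y assume y: "y \<in> mball \<delta> x r2"
      have xS: "x \<in> S" using that by (simp add: S2_def)
      let ?p = "dual_centre \<delta> x"
      have "?p + ((\<delta> / sqrt dm) *\<^sub>R transpose (mmat \<delta> x)) *v 0 \<in> dual_box \<delta> x"
        unfolding dual_box_def using dp by (intro imageI) simp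
      then have p: "?p \<in> dual_box \<delta> x" by (simp only: matrix_vector_mult_0_right add_0_right)
      have "mnorm \<delta> x (y - x) \<le> 1" using y r2 by (simp add: mball_def)
      then have "D x (y - x) \<le> \<delta>" by (rule D_le_mnorm[OF d(1)])
      moreover have "\<phi> x - ?p \<bullet> (y - x) - \<delta> \<le> \<phi> (x - (y - x))"
        using dual_box_subdiff[OF d(1) p, of "x - (y - x)"] by (simp add: inner_diff_right)
      ultimately have up: "\<phi> y \<le> \<phi> x + ?p \<bullet> (y - x) + 2 * \<delta>" by (simp add: D_def)
      have "\<phi> y + ?p \<bullet> (z - y) - 3 * \<delta> \<le> \<phi> z" for z
        using dual_box_subdiff[OF d(1) p, of z] up by (simp add: inner_diff_right)
      moreover have "norm (y - x0) \<le> 4" using gnear[OF xS] y by (auto simp: dist_norm norm_minus_commute)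
      ultimately show "y \<in> bad \<delta> \<tau>"
        using short_subgradient_imp_bad[OF d(1) \<tau>(1), of ?p y] that by (simp add: S2_def)
    qed
    have "(\<Sum>x\<in>S2. g x) \<le> measure lebesgue (bad \<delta> \<tau>)"
      using sub by (intro gsum lmeasurable_compact bad_compact) (auto simp: S2_def)
    also have "\<dots> \<le> 24 * dm\<^sup>2 * 8 ^ (?n - 1) * \<delta> / \<tau>\<^sup>2" by (rule measure_bad_le[OF d(1) \<tau>(1)])
    finally show "(\<Sum>x\<in>S2. g x) \<le> 24 * dm\<^sup>2 * 8 ^ (?n - 1) * \<delta> / \<tau>\<^sup>2" .
    have "dual_box \<delta> x \<subseteq> cball 0 1" for x using qsub subdiff_norm by force
    then show "(\<Sum>x\<in>S2. q x) \<le> ?m * ?w" by (intro qsum) (auto simp: S2_def)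
  qed (use a in auto)
  also have "\<dots> = s\<^sup>2 * (48 * dm\<^sup>2 * 8 ^ (?n - 1) + 2 * ?m * ?w)"
  proof -
    have "a * (24 * dm\<^sup>2 * 8 ^ (?n - 1) * \<delta> / \<tau>\<^sup>2) = 24 * dm\<^sup>2 * 8 ^ (?n - 1) * (a * \<delta> / \<tau>\<^sup>2)" by simp
    also have "a * \<delta> / \<tau>\<^sup>2 = 2 * s\<^sup>2"
      unfolding a_def \<tau>_def s(3)[symmetric] using s(1) by (simp add: power2_eq_square eval_nat_numeral field_simps)
    finally show ?thesis using s(1) by (simp add: a_def algebra_simps)
  qed
  also have "\<dots> \<le> s * (48 * dm\<^sup>2 * 8 ^ (?n - 1) + 2 * ?m * ?w)"
  proof (rule mult_right_mono)
    show "s\<^sup>2 \<le> s" using s mult_left_le[of s s] by (simp add: power2_eq_square)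
  qed (use mp wp in auto)
  finally have II: "real (card S2) * (2 * Q) \<le> s * (48 * dm\<^sup>2 * 8 ^ (?n - 1) + 2 * ?m * ?w)" .
  have "S = S1 \<union> S2" "S1 \<inter> S2 = {}" by (auto simp: S1_def S2_def)
  then have "card S = card S1 + card S2"
    using S(1) by (metis card_Un_disjoint finite_Un)
  then have "real (card S) * (2 * Q) \<le> s * (4 ^ ?n * ?w + ?m * real ?n * ?w + 48 * dm\<^sup>2 * 8 ^ (?n - 1) + 2 * ?m * ?w)"
    using add_mono[OF I II] by (simp add: algebra_simps)
  then have "real (card S) \<le> s * (4 ^ ?n * ?w + ?m * real ?n * ?w + 48 * dm\<^sup>2 * 8 ^ (?n - 1) + 2 * ?m * ?w) / (2 * Q)"
    using Qp by (subst pos_le_divide_eq) auto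
  also have "\<dots> = count_const TYPE('n) \<rho> * (s / sqrt (\<delta> ^ ?n))"
    by (simp add: count_const_def Q_def real_sqrt_mult dm_eq mult_ac)
  also have "s / sqrt (\<delta> ^ ?n) = \<delta> powr (1/8 - real ?n / 2)"
  proof -
    have "sqrt (\<delta> ^ ?n) = (\<delta> powr real ?n) powr (1/2)" using d by (simp add: powr_half_sqrt powr_realpow)
    also have "\<dots> = \<delta> powr (real ?n / 2)" by (simp add: powr_powr)
    finally show ?thesis by (simp add: s_def powr_diff)
  qed
  finally show ?thesis .
qed

end

section \<open>Nets and the blended approximation\<close>

context signed_dist begin

lemma mnorm_meet:
  assumes d: "0 < \<delta>" and "mnorm \<delta> x (w - x) \<le> 1/8" "mnorm \<delta> y (w - y) \<le> 1/8"
  shows "mnorm \<delta> x h \<le> 16 * dm\<^sup>2 * mnorm \<delta> y h"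
proof -
  have "mnorm \<delta> x h \<le> 4 * dm * mnorm \<delta> w h" by (rule mnorm_near(2)[OF d assms(2)])
  also have "\<dots> \<le> 4 * dm * (4 * dm * mnorm \<delta> y h)"
    using mnorm_near(1)[OF d assms(3)] dm_ge_1 by (intro mult_left_mono) auto
  finally show ?thesis by (simp add: power2_eq_square mult_ac)
qed

text \<open>A separated set of largest cardinality, which exists by the counting bound. Separation
  is required in the norms of both points, so an uncovered z must also be far in its own norm;
  \<open>mnorm_near\<close> transfers this at the price of the factor 4d in the covering
  radius.\<close>

lemma net_exists:
  assumes d: "0 < \<delta>" "\<delta> \<le> 1" and r: "0 < \<rho>" "\<rho> \<le> 1/8"
  shows "\<exists>X. finite X \<and> X \<subseteq> \<Omega> \<and> separated \<delta> \<rho> X \<and> (\<forall>z\<in>\<Omega>. \<exists>x\<in>X. mnorm \<delta> x (z - x) \<le> 4 * dm * \<rho>)"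
proof -
  define P where "P k \<longleftrightarrow> (\<exists>X. finite X \<and> X \<subseteq> \<Omega> \<and> separated \<delta> \<rho> X \<and> card X = k)" for k
  have P0: "P 0" unfolding P_def by (rule exI[of _ "{}"]) (simp add: separated_def)
  define b where "b = nat \<lceil>count_const TYPE('n) \<rho> * \<delta> powr (1/8 - real CARD('n) / 2)\<rceil>"
  have bnd: "k \<le> b" if Pk: "P k" for k
  proof -
    obtain X where "finite X" "X \<subseteq> \<Omega>" "separated \<delta> \<rho> X" "card X = k" using Pk unfolding P_def by blast
    then have "real k \<le> count_const TYPE('n) \<rho> * \<delta> powr (1/8 - real CARD('n) / 2)"
      using card_separated_points_le[of \<delta> \<rho> X] d r by auto
    then show ?thesis unfolding b_def by linarith
  qed
  obtain k where k: "P k" "\<And>j. P j \<Longrightarrow> j \<le> k"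
    using Nat.ex_has_greatest_nat[of P 0 b] P0 bnd by blast
  obtain X where X: "finite X" "X \<subseteq> \<Omega>" "separated \<delta> \<rho> X" "card X = k" using k(1) unfolding P_def by blast
  have "\<exists>x\<in>X. mnorm \<delta> x (z - x) \<le> 4 * dm * \<rho>" if z: "z \<in> \<Omega>" for z
  proof (rule ccontr)
    assume "\<not> ?thesis"
    then have far: "4 * dm * \<rho> < mnorm \<delta> x (z - x)" if "x \<in> X" for x using that by force
    have rr: "\<rho> \<le> 4 * dm * \<rho>" using dm_ge_1 r by simp
    have far2: "\<rho> < mnorm \<delta> z (x - z)" if x: "x \<in> X" for x
    proof (rule ccontr)
      assume "\<not> ?thesis"
      then have le: "mnorm \<delta> z (x - z) \<le> \<rho>" by simp
      then have "mnorm \<delta> x (z - x) \<le> 4 * dm * mnorm \<delta> z (z - x)" using mnorm_near(1)[OF d(1), of z x] r by auto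
      also have "\<dots> \<le> 4 * dm * \<rho>" using le dm_ge_1 mnorm_minus[of \<delta> z x z] by (intro mult_left_mono) auto
      finally show False using far[OF x] by simp
    qed
    have zX: "z \<notin> X" using far[of z] r dm_ge_1 by (auto simp: mult_less_0_iff)
    have "separated \<delta> \<rho> (insert z X)"
      using X(3) far far2 rr unfolding separated_def by fastforce
    then have "P (Suc k)" unfolding P_def using X zX z by (intro exI[of _ "insert z X"]) auto
    then show False using k(2) by fastforce
  qed
  then show ?thesis using X by blast
qed

text \<open>The fine ellipsoid is first replaced by the coarse one at its own centre. This costs
  only \<open>dm\<close> and not the ratio of the levels; afterwards both norms have level
  \<delta>.\<close>

lemma meeting_comparable:
  assumes d: "0 < \<delta>'" "\<delta>' \<le> \<delta>" and r: "0 \<le> r" "dm * r \<le> 1/8"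
    and w: "mnorm \<delta> x (w - x) \<le> r" "mnorm \<delta>' z (w - z) \<le> r"
  shows "mnorm \<delta> z (w - z) \<le> dm * r" "mnorm \<delta> x h \<le> 16 * dm\<^sup>2 * mnorm \<delta> z h"
    "mnorm \<delta> z h \<le> 16 * dm\<^sup>2 * mnorm \<delta> x h"
proof -
  have r8: "r \<le> 1/8" using r dm_ge_1 mult_right_mono[of 1 dm r] by linarith
  have "mnorm \<delta> z (w - z) \<le> dm * mnorm \<delta>' z (w - z)" by (rule mnorm_level_mono[OF d])
  also have "\<dots> \<le> dm * r" using w dm_ge_1 by (intro mult_left_mono) auto
  finally show z: "mnorm \<delta> z (w - z) \<le> dm * r" .
  have d0: "0 < \<delta>" using d by simp
  have "mnorm \<delta> x (w - x) \<le> 1/8" "mnorm \<delta> z (w - z) \<le> 1/8" using w(1) z r r8 by linarith+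
  then show "mnorm \<delta> x h \<le> 16 * dm\<^sup>2 * mnorm \<delta> z h" "mnorm \<delta> z h \<le> 16 * dm\<^sup>2 * mnorm \<delta> x h"
    using mnorm_meet[OF d0] by blast+
qed

text \<open>The in-degree of the search graph. Coarse points are already separated in the coarse
  norm, hence the bound is free of \<delta>/\<delta>'.\<close>

lemma card_coarse_meeting_le:
  assumes d: "0 < \<delta>'" "\<delta>' \<le> \<delta>" and r: "0 \<le> r" "dm * r \<le> 1/8" and "0 < \<rho>"
    and X: "finite X" "separated \<delta> \<rho> X"
  shows "real (card {x \<in> X. \<exists>w. mnorm \<delta> x (w - x) \<le> r \<and> mnorm \<delta>' z (w - z) \<le> r})
    \<le> (1 + 544 * dm ^ 4 * (r / \<rho>)) ^ CARD('n)"
proof -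
  let ?Y = "{x \<in> X. \<exists>w. mnorm \<delta> x (w - x) \<le> r \<and> mnorm \<delta>' z (w - z) \<le> r}"
  have d0: "0 < \<delta>" using d by simp
  have d1: "dm \<le> dm\<^sup>2" "1 \<le> dm\<^sup>2" using dm_ge_1 self_le_power[of dm 2] one_le_power[of dm 2] by auto
  have "real (card ?Y) \<le> (1 + 2 * (17 * dm\<^sup>2 * r) / (\<rho> / (16 * dm\<^sup>2))) ^ CARD('n)"
  proof (rule card_mnorm_separated_le[OF _ d0])
    fix x assume "x \<in> ?Y"
    then obtain w where w': "mnorm \<delta> x (w - x) \<le> r" "mnorm \<delta>' z (w - z) \<le> r" by blast
    note w = w'(1) meeting_comparable(1,3)[OF d r w']
    have "mnorm \<delta> z (x - z) \<le> mnorm \<delta> z (x - w) + mnorm \<delta> z (w - z)" by (rule mnorm_triangle3)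
    also have "\<dots> \<le> 16 * dm\<^sup>2 * mnorm \<delta> x (x - w) + dm * r" using w by (intro add_mono) auto
    also have "\<dots> \<le> 16 * dm\<^sup>2 * r + dm\<^sup>2 * r"
      using w(1) mnorm_minus[of \<delta> x x w] d1 r by (intro add_mono mult_left_mono mult_right_mono) auto
    finally show "mnorm \<delta> z (x - z) \<le> 17 * dm\<^sup>2 * r" by (simp add: mult_ac)
  next
    fix x y assume xy: "x \<in> ?Y" "y \<in> ?Y" "x \<noteq> y"
    then obtain w where w: "mnorm \<delta> x (w - x) \<le> r" "mnorm \<delta>' z (w - z) \<le> r" by blast
    from xy have "\<rho> < mnorm \<delta> x (y - x)" using X(2) unfolding separated_def by auto
    also have "\<dots> \<le> 16 * dm\<^sup>2 * mnorm \<delta> z (y - x)" by (rule meeting_comparable(2)[OF d r w])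
    finally have "\<rho> < mnorm \<delta> z (x - y) * (16 * dm\<^sup>2)" using mnorm_minus[of \<delta> z x y] by (simp add: mult_ac)
    then show "\<rho> / (16 * dm\<^sup>2) < mnorm \<delta> z (x - y)" using dm_ge_1 by (subst pos_divide_less_eq) auto
  qed (use assms dm_ge_1 in auto)
  also have "2 * (17 * dm\<^sup>2 * r) / (\<rho> / (16 * dm\<^sup>2)) = 544 * dm ^ 4 * (r / \<rho>)"
    by (simp add: eval_nat_numeral)
  finally show ?thesis .
qed

text \<open>The out-degree. The separation of fine points has to be converted to the coarse norm,
  which brings in \<delta>/\<delta>'.\<close>

lemma card_fine_meeting_le:
  assumes d: "0 < \<delta>'" "\<delta>' \<le> \<delta>" and r: "0 \<le> r" "dm * r \<le> 1/8" and "0 < \<rho>"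
    and Z: "finite Z" "separated \<delta>' \<rho> Z"
  shows "real (card {z \<in> Z. \<exists>w. mnorm \<delta> x (w - x) \<le> r \<and> mnorm \<delta>' z (w - z) \<le> r})
    \<le> (1 + 544 * dm ^ 6 * (\<delta> / \<delta>') * (r / \<rho>)) ^ CARD('n)"
proof -
  let ?Y = "{z \<in> Z. \<exists>w. mnorm \<delta> x (w - x) \<le> r \<and> mnorm \<delta>' z (w - z) \<le> r}"
  have d0: "0 < \<delta>" using d by simp
  have d1: "1 \<le> dm ^ 3" using dm_ge_1 by (simp add: one_le_power)
  define K where "K = 16 * dm ^ 3 * (\<delta> / \<delta>')"
  have K: "0 < K" using d dm_ge_1 by (simp add: K_def)
  have "real (card ?Y) \<le> (1 + 2 * (17 * dm ^ 3 * r) / (\<rho> / K)) ^ CARD('n)"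
  proof (rule card_mnorm_separated_le[OF _ d0])
    fix z assume "z \<in> ?Y"
    then obtain w where w': "mnorm \<delta> x (w - x) \<le> r" "mnorm \<delta>' z (w - z) \<le> r" by blast
    note w = w'(1) meeting_comparable(1,2)[OF d r w']
    have "mnorm \<delta> x (z - x) \<le> mnorm \<delta> x (z - w) + mnorm \<delta> x (w - x)" by (rule mnorm_triangle3)
    also have "\<dots> \<le> 16 * dm\<^sup>2 * mnorm \<delta> z (z - w) + r" using w by (intro add_mono) auto
    also have "\<dots> \<le> 16 * dm\<^sup>2 * (dm * r) + dm ^ 3 * r"
      using w(2) mnorm_minus[of \<delta> z z w] mult_right_mono[OF d1 r(1)] by (intro add_mono mult_left_mono) auto
    finally show "mnorm \<delta> x (z - x) \<le> 17 * dm ^ 3 * r" by (simp add: eval_nat_numeral mult_ac)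
  next
    fix z y assume xy: "z \<in> ?Y" "y \<in> ?Y" "z \<noteq> y"
    then obtain w where w: "mnorm \<delta> x (w - x) \<le> r" "mnorm \<delta>' z (w - z) \<le> r" by blast
    from xy have "\<rho> < mnorm \<delta>' z (y - z)" using Z(2) unfolding separated_def by auto
    also have "\<dots> \<le> dm * (\<delta> / \<delta>') * mnorm \<delta> z (y - z)" by (rule mnorm_level_ratio[OF d])
    also have "\<dots> \<le> dm * (\<delta> / \<delta>') * (16 * dm\<^sup>2 * mnorm \<delta> x (y - z))"
      using meeting_comparable(3)[OF d r w] d dm_ge_1 by (intro mult_left_mono) auto
    finally have "\<rho> < mnorm \<delta> x (z - y) * K"
      using mnorm_minus[of \<delta> x z y] by (simp add: K_def mult_ac eval_nat_numeral)
    then show "\<rho> / K < mnorm \<delta> x (z - y)" using K by (subst pos_divide_less_eq) auto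
  qed (use assms K dm_ge_1 in auto)
  also have "2 * (17 * dm ^ 3 * r) / (\<rho> / K) = 544 * dm ^ 6 * (\<delta> / \<delta>') * (r / \<rho>)"
    by (simp add: K_def eval_nat_numeral mult_ac)
  finally show ?thesis .
qed

end

section \<open>The blend over one net: constants, bounds and code\<close>

definition quad_size :: "nat \<Rightarrow> nat" where
  "quad_size n = n * (8 * n + 3) + n + 1"

definition leaf_size :: "nat \<Rightarrow> nat \<Rightarrow> nat" where
  "leaf_size n m = (let w = 9 * (quad_size n + 4) + 24 in 4 * n + 3 + (m * (w + 4 * n + 2) + m + 1) + (m * w + m + 1) + 2)"

text \<open>What the \<open>scaled_bound\<close> rules give for the weights: 4096 d^4 is 1/(4 r^2)
  for the covering radius r = 1/(128 d^2), and 16 d^3 bounds the squared ellipsoid norm with its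
  derivatives.\<close>

definition weight_const :: "real \<Rightarrow> real" where
  "weight_const d = (let a = 1 + 4 * (4096 * d ^ 4 * (16 * d ^ 3)) in 1 + 2 * a + 36 * a\<^sup>2)"

text \<open>Here m bounds the number of neighbours, a a weight, and c from below the denominator, by
  the weight of a net point at covering radius.\<close>

definition deriv_const :: "real \<Rightarrow> real \<Rightarrow> real" where
  "deriv_const d m = (let a = weight_const d; c = exp (- (4/3)) in
     4 * (m * (4 * (a * 2)) * (1 / c + m * a / c\<^sup>2 + 2 * (m * a)\<^sup>2 / c ^ 3)))"

text \<open>The covering radius is the 4 d \<rho> of \<open>net_exists\<close>. It is so small that
  a point in the ellipsoid of j is within norm 1 of every neighbour of j, even after the factor 16
  d^2 of \<open>mnorm_meet\<close>; there all supporting functions are accurate up to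
  \<delta>.\<close>

locale net_level = signed_dist \<phi> \<Omega> x0 dm for \<phi> :: "real^'n \<Rightarrow> real" and \<Omega> x0 dm +
  fixes \<delta> :: real and X :: "(real^'n) set"
  assumes \<delta>: "0 < \<delta>" "\<delta> \<le> 1"
    and X: "finite X" "X \<subseteq> \<Omega>" "separated \<delta> (1 / (512 * dm ^ 3)) X"
    and cover: "z \<in> \<Omega> \<Longrightarrow> \<exists>x\<in>X. mnorm \<delta> x (z - x) \<le> 1 / (128 * dm\<^sup>2)"
begin

definition r1 :: real where "r1 = 1 / (128 * dm\<^sup>2)"

lemma r1: "0 < r1" "dm\<^sup>2 * r1 = 1 / 128" "dm * r1 \<le> 1/128" "r1 \<le> 1/128"
proof -
  have d: "1 \<le> dm\<^sup>2" "dm \<le> dm\<^sup>2" using dm_ge_1 self_le_power[of dm 2] one_le_power[of dm 2] by auto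
  show p: "0 < r1" using dm_ge_1 by (simp add: r1_def)
  show e: "dm\<^sup>2 * r1 = 1 / 128" using dm_ge_1 by (simp add: r1_def)
  show "dm * r1 \<le> 1/128" "r1 \<le> 1/128"
    using mult_right_mono[OF d(2), of r1] mult_right_mono[OF d(1), of r1] p e by auto
qed

definition unit_subgrad :: "real^'n \<Rightarrow> real^'n" where
  "unit_subgrad x = (SOME u. norm u = 1 \<and> (\<forall>y. \<phi> x + u \<bullet> (y - x) \<le> \<phi> y))"

lemma unit_subgrad: "norm (unit_subgrad x) = 1" "\<phi> x + unit_subgrad x \<bullet> (y - x) \<le> \<phi> y"
  using someI_ex[OF subgradient[of x]] unfolding unit_subgrad_def by blast+

definition support_aff :: "real^'n \<Rightarrow> 'n sexpr" where
  "support_aff x = SAff (- unit_subgrad x) (unit_subgrad x \<bullet> x - \<phi> x)"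

text \<open>A single affine atom instead of a sum of two: its value is O(\<delta>) as a whole, which
  the rule for sums could not see.\<close>

definition support_diff :: "real^'n \<Rightarrow> real^'n \<Rightarrow> 'n sexpr" where
  "support_diff x j = SAff (unit_subgrad j - unit_subgrad x) (unit_subgrad x \<bullet> x - \<phi> x - (unit_subgrad j \<bullet> j - \<phi> j))"

definition coord :: "real^'n \<Rightarrow> 'n \<Rightarrow> 'n sexpr" where
  "coord x i = SAff (mmat \<delta> x $ i) (- (mmat \<delta> x *v x) $ i)"

definition quad :: "real^'n \<Rightarrow> 'n sexpr" where
  "quad x = ssum (map (\<lambda>i. SMul (coord x i) (coord x i)) univ_list)"

definition weight :: "real^'n \<Rightarrow> 'n sexpr" where
  "weight x = SBump 0 (SAdd (SC 1) (SMul (SC (- 1 / (4 * r1\<^sup>2))) (quad x)))"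

definition neighbours :: "real^'n \<Rightarrow> (real^'n) set" where
  "neighbours j = {x \<in> X. \<exists>w. mnorm \<delta> x (w - x) \<le> 2 * r1 \<and> mnorm \<delta> j (w - j) \<le> 2 * r1}"

definition blend :: "real^'n \<Rightarrow> real" where
  "blend y = (\<Sum>x\<in>X. seval (weight x) y * seval (support_aff x) y) / (\<Sum>x\<in>X. seval (weight x) y)"

text \<open>The blend minus \<open>support_aff j\<close>, as a weighted mean of small differences.
  It involves only neighbours of j, so its code has bounded size, and all curvature of the blend
  near j is in this term.\<close>

definition corr :: "real^'n \<Rightarrow> 'n sexpr" where
  "corr j = SMul (ssum (map (\<lambda>x. SMul (weight x) (support_diff x j)) (list_of (neighbours j))))
     (SInv (ssum (map weight (list_of (neighbours j)))))"

definition local_blend :: "real^'n \<Rightarrow> 'n sexpr" where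
  "local_blend j = SAdd (support_aff j) (corr j)"

lemma finite_neighbours: "finite (neighbours j)" using X(1) by (simp add: neighbours_def)

lemma seval_support_aff: "seval (support_aff x) y = - (\<phi> x + unit_subgrad x \<bullet> (y - x))"
  by (simp add: support_aff_def inner_diff_right)

lemma seval_support_diff: "seval (support_diff x j) y = seval (support_aff x) y - seval (support_aff j) y"
  by (simp add: support_diff_def support_aff_def inner_diff_left)

lemma seval_coord: "seval (coord x i) y = (mmat \<delta> x *v (y - x)) $ i"
  by (simp add: coord_def matrix_vector_mult_diff_distrib matrix_vector_mul_component)

lemma seval_quad: "seval (quad x) y = (mnorm \<delta> x (y - x))\<^sup>2"
proof -
  have "seval (quad x) y = (\<Sum>i\<leftarrow>univ_list. seval (coord x i) y * seval (coord x i) y)"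
    by (simp add: quad_def seval_ssum comp_def)
  also have "\<dots> = (\<Sum>i\<in>UNIV. ((mmat \<delta> x *v (y - x)) $ i)\<^sup>2)"
    by (simp add: sum_list_of seval_coord power2_eq_square)
  finally show ?thesis by (simp add: mnorm_def norm_vec_def L2_set_def sum_nonneg)
qed

lemma seval_weight: "seval (weight x) y = bump 0 (1 - (mnorm \<delta> x (y - x))\<^sup>2 / (4 * r1\<^sup>2))"
  by (simp add: weight_def seval_quad)

lemma weight_nonneg: "0 \<le> seval (weight x) y" by (simp add: seval_weight bump_nonneg)

lemma weight_pos_iff: "0 < seval (weight x) y \<longleftrightarrow> mnorm \<delta> x (y - x) < 2 * r1"
proof -
  have "0 < seval (weight x) y \<longleftrightarrow> (mnorm \<delta> x (y - x))\<^sup>2 / (4 * r1\<^sup>2) < 1"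
    by (auto simp: seval_weight bump_def)
  also have "\<dots> \<longleftrightarrow> (mnorm \<delta> x (y - x))\<^sup>2 < (2 * r1)\<^sup>2"
    using r1(1) by (simp add: divide_less_eq power_mult_distrib)
  also have "\<dots> \<longleftrightarrow> mnorm \<delta> x (y - x) < 2 * r1"
  proof
    assume "(mnorm \<delta> x (y - x))\<^sup>2 < (2 * r1)\<^sup>2"
    then show "mnorm \<delta> x (y - x) < 2 * r1" by (rule power2_less_imp_less) (use r1(1) in simp)
  next
    assume "mnorm \<delta> x (y - x) < 2 * r1"
    then show "(mnorm \<delta> x (y - x))\<^sup>2 < (2 * r1)\<^sup>2" by (rule power_strict_mono) auto
  qed
  finally show ?thesis .
qed

text \<open>The bumps have radius 2 * r1 while the net covers at radius r1, where their argument is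
  at least 3/4. This keeps the denominator of the blend away from 0.\<close>

lemma weight_ge: 
  assumes "mnorm \<delta> x (y - x) \<le> r1"
  shows "exp (- (4/3)) \<le> seval (weight x) y"
proof -
  define t where "t = 1 - (mnorm \<delta> x (y - x))\<^sup>2 / (4 * r1\<^sup>2)"
  have "(mnorm \<delta> x (y - x))\<^sup>2 \<le> r1\<^sup>2" using assms by (intro power_mono) auto
  then have "(mnorm \<delta> x (y - x))\<^sup>2 / (4 * r1\<^sup>2) \<le> 1/4" using r1(1) by (simp add: divide_le_eq)
  then have t: "3/4 \<le> t" by (simp add: t_def)
  then have "1 / t \<le> 4/3" by (simp add: divide_le_eq)
  then show ?thesis using t by (simp add: seval_weight bump_def flip: t_def)
qed

lemma support_aff_bounds:
  assumes "mnorm \<delta> x (y - x) \<le> 1"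
  shows "- \<phi> y \<le> seval (support_aff x) y" "seval (support_aff x) y \<le> - \<phi> y + \<delta>"
  using unit_subgrad(2)[of x y] affine_on_level_set[of x "unit_subgrad x" y, OF unit_subgrad(2)] D_le_mnorm[OF \<delta>(1) assms]
  by (auto simp: seval_support_aff)

lemma neighbours_sum:
  assumes "mnorm \<delta> j (y - j) < 2 * r1"
  shows "(\<Sum>x\<in>X. seval (weight x) y * g x) = (\<Sum>x\<in>neighbours j. seval (weight x) y * g x)"
proof (rule sum.mono_neutral_right[OF X(1)])
  show "neighbours j \<subseteq> X" by (auto simp: neighbours_def)
  show "\<forall>x\<in>X - neighbours j. seval (weight x) y * g x = 0"
  proof
    fix x assume x: "x \<in> X - neighbours j"
    have "\<not> mnorm \<delta> x (y - x) < 2 * r1"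
    proof
      assume "mnorm \<delta> x (y - x) < 2 * r1"
      then have "x \<in> neighbours j" unfolding neighbours_def using x assms by (intro CollectI conjI exI[of _ y]) auto
      then show False using x by blast
    qed
    then have "seval (weight x) y = 0" using weight_pos_iff[of x y] weight_nonneg[of x y] by linarith
    then show "seval (weight x) y * g x = 0" by simp
  qed
qed

lemma weight_sum_ge:
  assumes "j \<in> X" "mnorm \<delta> j (y - j) < 2 * r1"
  shows "seval (weight j) y \<le> seval (ssum (map weight (list_of (neighbours j)))) y"
proof -
  have "j \<in> neighbours j" using assms r1(1) by (auto simp: neighbours_def intro!: exI[of _ j])
  then have "seval (weight j) y \<le> (\<Sum>x\<in>neighbours j. seval (weight x) y)"
    using finite_neighbours weight_nonneg by (intro member_le_sum) auto
  then show ?thesis by (simp add: seval_ssum comp_def sum_list_of finite_neighbours)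
qed

lemma swf_weight: "swf (weight x) y"
  by (auto simp: weight_def quad_def swf_ssum coord_def)

lemma blend_local:
  assumes "j \<in> X" "mnorm \<delta> j (y - j) < 2 * r1"
  shows "blend y = seval (local_blend j) y" "swf (local_blend j) y"
proof -
  let ?W = "\<Sum>x\<in>neighbours j. seval (weight x) y"
  have W: "seval (ssum (map weight (list_of (neighbours j)))) y = ?W"
    by (simp add: seval_ssum comp_def sum_list_of finite_neighbours)
  have Wp: "0 < ?W" using weight_sum_ge[OF assms] weight_pos_iff[of j y] assms(2) W by simp
  show "swf (local_blend j) y"
    using Wp W by (auto simp: local_blend_def corr_def swf_ssum swf_weight support_aff_def support_diff_def)
  have "seval (local_blend j) y = seval (support_aff j) y + (\<Sum>x\<in>neighbours j. seval (weight x) y * (seval (support_aff x) y - seval (support_aff j) y)) / ?W"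
    by (simp add: local_blend_def corr_def W seval_ssum comp_def sum_list_of finite_neighbours seval_support_diff inverse_eq_divide)
  also have "(\<Sum>x\<in>neighbours j. seval (weight x) y * (seval (support_aff x) y - seval (support_aff j) y))
     = (\<Sum>x\<in>neighbours j. seval (weight x) y * seval (support_aff x) y) - ?W * seval (support_aff j) y"
    by (simp add: right_diff_distrib sum_subtractf sum_distrib_right)
  also have "seval (support_aff j) y + \<dots> / ?W = (\<Sum>x\<in>neighbours j. seval (weight x) y * seval (support_aff x) y) / ?W"
    using Wp by (simp add: field_simps)
  also have "\<dots> = blend y"
    using neighbours_sum[OF assms(2), of "\<lambda>x. seval (support_aff x) y"] neighbours_sum[OF assms(2), of "\<lambda>_. 1"]
    by (simp add: blend_def)
  finally show "blend y = seval (local_blend j) y" ..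
qed

text \<open>A weighted mean of values that lie between -\<phi> y and -\<phi> y + \<delta> wherever
  their weight is positive; supporting functions never exceed \<phi>, so the error is
  one-sided.\<close>

lemma blend_bounds:
  assumes "j \<in> X" "mnorm \<delta> j (y - j) < 2 * r1"
  shows "- \<phi> y \<le> blend y" "blend y \<le> - \<phi> y + \<delta>"
proof -
  let ?W = "\<Sum>x\<in>X. seval (weight x) y"
  have "0 < seval (weight j) y" using assms weight_pos_iff by simp
  also have "\<dots> \<le> ?W" using assms(1) X(1) weight_nonneg by (intro member_le_sum) auto
  finally have W: "0 < ?W" .
  have b: "seval (weight x) y * (- \<phi> y) \<le> seval (weight x) y * seval (support_aff x) y \<and>
      seval (weight x) y * seval (support_aff x) y \<le> seval (weight x) y * (- \<phi> y + \<delta>)" for x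
  proof (cases "0 < seval (weight x) y")
    case True
    then have "mnorm \<delta> x (y - x) \<le> 1" using weight_pos_iff[of x y] r1(4) by linarith
    from support_aff_bounds[OF this] True show ?thesis by (intro conjI mult_left_mono) auto
  next
    case False
    then have "seval (weight x) y = 0" using weight_nonneg[of x y] by linarith
    then show ?thesis by simp
  qed
  have "?W * (- \<phi> y) \<le> (\<Sum>x\<in>X. seval (weight x) y * seval (support_aff x) y)"
    unfolding sum_distrib_right using b by (intro sum_mono) blast
  then show "- \<phi> y \<le> blend y" using W by (simp add: blend_def pos_le_divide_eq mult.commute)
  have "(\<Sum>x\<in>X. seval (weight x) y * seval (support_aff x) y) \<le> ?W * (- \<phi> y + \<delta>)"
    unfolding sum_distrib_right using b by (intro sum_mono) blast
  then show "blend y \<le> - \<phi> y + \<delta>" using W by (simp add: blend_def pos_divide_le_eq mult.commute)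
qed

lemma scaled_bound_coord:
  assumes "mnorm \<delta> x (y - x) \<le> 1"
  shows "scaled_bound \<delta> (coord x i) y (2 * dm)"
proof -
  have "\<bar>(mmat \<delta> x *v (y - x)) $ i\<bar> \<le> mnorm \<delta> x (y - x)"
    unfolding mnorm_def by (rule component_le_norm_cart)
  then have 1: "\<bar>seval (coord x i) y\<bar> \<le> 2 * dm" using assms dm_ge_1 by (simp add: seval_coord)
  have "\<bar>mmat \<delta> x $ i $ k\<bar> \<le> 2 * dm / \<delta>" for k
  proof -
    have "mmat \<delta> x $ i $ k = (mmat \<delta> x *v axis k 1) $ i"
      by (simp add: matrix_vector_mul_component inner_axis)
    also have "\<bar>\<dots>\<bar> \<le> mnorm \<delta> x (axis k 1)" unfolding mnorm_def by (rule component_le_norm_cart)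
    also have "\<dots> \<le> 2 * dm / \<delta> * norm (axis k (1::real) :: real^'n)" by (rule mnorm_le_norm[OF \<delta>(1)])
    finally show ?thesis by (simp add: norm_axis_1)
  qed
  then show ?thesis using 1 unfolding coord_def by (intro scaled_bound_SAff \<delta>) auto
qed

lemma scaled_bound_weight:
  assumes "mnorm \<delta> x (y - x) \<le> 1"
  shows "scaled_bound \<delta> (weight x) y (weight_const dm)"
proof -
  have "scaled_bound \<delta> (SMul (coord x i) (coord x i)) y (4 * (2 * dm * (2 * dm)))" for i
    by (intro scaled_bound_SMul scaled_bound_coord assms \<delta>)
  then have "scaled_bound \<delta> (quad x) y (real (length (map (\<lambda>i. SMul (coord x i) (coord x i)) univ_list)) * (4 * (2 * dm * (2 * dm))))"
    unfolding quad_def by (intro scaled_bound_ssum \<delta>) auto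
  then have q: "scaled_bound \<delta> (quad x) y (16 * dm ^ 3)"
    by (simp add: length_univ_list dm_eq power3_eq_cube mult_ac)
  have "\<bar>- 1 / (4 * r1\<^sup>2)\<bar> = 4096 * dm ^ 4"
    using dm_ge_1 by (simp add: r1_def eval_nat_numeral)
  then have c: "scaled_bound \<delta> (SC (- 1 / (4 * r1\<^sup>2))) y (4096 * dm ^ 4)" by (intro scaled_bound_SC \<delta>) simp
  have "scaled_bound \<delta> (SAdd (SC 1) (SMul (SC (- 1 / (4 * r1\<^sup>2))) (quad x))) y (1 + 4 * (4096 * dm ^ 4 * (16 * dm ^ 3)))"
    by (intro scaled_bound_SAdd scaled_bound_SMul c q \<delta> scaled_bound_SC) auto
  then show ?thesis unfolding weight_def weight_const_def Let_def by (intro scaled_bound_SBump0 \<delta>)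
qed

lemma neighbours_near:
  assumes "mnorm \<delta> j (y - j) \<le> r1" "x \<in> neighbours j"
  shows "mnorm \<delta> x (y - x) \<le> 1"
proof -
  obtain w where w: "mnorm \<delta> x (w - x) \<le> 2 * r1" "mnorm \<delta> j (w - j) \<le> 2 * r1"
    using assms(2) by (auto simp: neighbours_def)
  have w8: "mnorm \<delta> x (w - x) \<le> 1/8" "mnorm \<delta> j (w - j) \<le> 1/8" using w r1(4) by linarith+
  have "mnorm \<delta> j (y - w) \<le> mnorm \<delta> j (y - j) + mnorm \<delta> j (j - w)" by (rule mnorm_triangle3)
  then have 1: "mnorm \<delta> j (y - w) \<le> 3 * r1" using assms(1) w(2) mnorm_minus[of \<delta> j j w] by linarith
  have "mnorm \<delta> x (y - w) \<le> 16 * dm\<^sup>2 * mnorm \<delta> j (y - w)" by (rule mnorm_meet[OF \<delta>(1) w8])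
  also have "\<dots> \<le> 16 * dm\<^sup>2 * (3 * r1)" using 1 by (intro mult_left_mono) auto
  also have "\<dots> = 48 / 128" using r1(2) by linarith
  finally show ?thesis using mnorm_triangle3[of \<delta> x y x w] w(1) r1(4) by linarith
qed

text \<open>Size of order \<delta> at length scale \<delta>: the gradient is O(1) and the Hessian
  O(1/\<delta>).\<close>

lemma scaled_bound_corr:
  assumes j: "j \<in> X" "mnorm \<delta> j (y - j) \<le> r1" and m: "real (card (neighbours j)) \<le> m"
  shows "scaled_bound \<delta> (corr j) y (\<delta> * deriv_const dm m)"
proof -
  let ?a = "weight_const dm" and ?L = "list_of (neighbours j)" and ?c = "exp (- (4/3)) :: real"
  have near: "mnorm \<delta> x (y - x) \<le> 1" if "x \<in> neighbours j" for x using neighbours_near[OF j(2) that] .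
  have L: "set ?L = neighbours j" "real (length ?L) \<le> m" using m by (auto simp: list_of finite_neighbours length_list_of)
  have jn: "mnorm \<delta> j (y - j) \<le> 1" "mnorm \<delta> j (y - j) < 2 * r1" using j(2) r1 by linarith+
  have ld: "scaled_bound \<delta> (support_diff x j) y (2 * \<delta>)" if x: "x \<in> neighbours j" for x
    unfolding support_diff_def
  proof (rule scaled_bound_SAff[OF _ _ \<delta>(1)])
    have "\<bar>seval (support_diff x j) y\<bar> \<le> 2 * \<delta>"
      using support_aff_bounds[OF near[OF x]] support_aff_bounds[OF jn(1)] \<delta>(1) by (simp add: seval_support_diff abs_le_iff)
    then show "\<bar>(unit_subgrad j - unit_subgrad x) \<bullet> y + (unit_subgrad x \<bullet> x - \<phi> x - (unit_subgrad j \<bullet> j - \<phi> j))\<bar> \<le> 2 * \<delta>"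
      by (simp add: support_diff_def)
    fix k
    \<comment> \<open>Slopes of unit length differ by at most 2, which is the value bound 2 *
      \<delta> divided by the length scale.\<close>
    have "\<bar>(unit_subgrad j - unit_subgrad x) $ k\<bar> \<le> norm (unit_subgrad j - unit_subgrad x)" by (rule component_le_norm_cart)
    also have "\<dots> \<le> norm (unit_subgrad j) + norm (unit_subgrad x)" by (rule norm_triangle_ineq4)
    finally show "\<bar>(unit_subgrad j - unit_subgrad x) $ k\<bar> \<le> 2 * \<delta> / \<delta>" using \<delta>(1) by (simp add: unit_subgrad)
  qed
  have a0: "0 \<le> ?a" using scaled_bound_nonneg[OF scaled_bound_weight[OF jn(1)]] .
  have m0: "0 \<le> m" using m by (meson of_nat_0_le_iff order_trans)
  have "scaled_bound \<delta> (ssum (map (\<lambda>x. SMul (weight x) (support_diff x j)) ?L)) y (real (length (map (\<lambda>x. SMul (weight x) (support_diff x j)) ?L)) * (4 * (?a * (2 * \<delta>))))"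
  proof (rule scaled_bound_ssum[OF \<delta>(1)])
    fix e assume "e \<in> set (map (\<lambda>x. SMul (weight x) (support_diff x j)) ?L)"
    then have "\<exists>x\<in>neighbours j. e = SMul (weight x) (support_diff x j)" using L(1) by auto
    then obtain x where x: "x \<in> neighbours j" "e = SMul (weight x) (support_diff x j)" by blast
    show "scaled_bound \<delta> e y (4 * (?a * (2 * \<delta>)))"
      unfolding x(2) by (intro scaled_bound_SMul scaled_bound_weight near ld x(1) \<delta>(1))
  qed
  then have A: "scaled_bound \<delta> (ssum (map (\<lambda>x. SMul (weight x) (support_diff x j)) ?L)) y (m * (4 * (?a * (2 * \<delta>))))"
    by (rule scaled_bound_mono) (use L a0 \<delta> in \<open>auto intro!: mult_right_mono\<close>)
  have "scaled_bound \<delta> (ssum (map weight ?L)) y (real (length (map weight ?L)) * ?a)"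
    by (rule scaled_bound_ssum[OF \<delta>(1)]) (use L near in \<open>auto intro!: scaled_bound_weight\<close>)
  then have W: "scaled_bound \<delta> (ssum (map weight ?L)) y (m * ?a)"
    by (rule scaled_bound_mono) (use L a0 \<delta> in \<open>auto intro!: mult_right_mono\<close>)
  have "?c \<le> \<bar>seval (ssum (map weight ?L)) y\<bar>"
    using weight_ge[OF j(2)] weight_sum_ge[OF j(1) jn(2)] by linarith
  then have "scaled_bound \<delta> (SInv (ssum (map weight ?L))) y (1 / ?c + m * ?a / ?c\<^sup>2 + 2 * (m * ?a)\<^sup>2 / ?c ^ 3)"
    by (intro scaled_bound_SInv W \<delta>) auto
  from scaled_bound_SMul[OF A this \<delta>(1)] show ?thesis
    by (simp add: corr_def deriv_const_def Let_def mult_ac)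
qed

lemma blend_derivatives:
  assumes j: "j \<in> X" "mnorm \<delta> j (y - j) \<le> r1" and m: "real (card (neighbours j)) \<le> m"
  shows "norm (grad blend y) \<le> real CARD('n) * (1 + deriv_const dm m)"
    "hess_norm blend y \<le> real CARD('n) * real CARD('n) * (deriv_const dm m / \<delta>)"
    "grad blend y = (\<chi> i. seval (sderiv i (local_blend j)) y)"
proof -
  let ?V = "{z. mnorm \<delta> j (z - j) < 2 * r1}" and ?C = "deriv_const dm m"
  have V: "open ?V"
    by (intro open_Collect_less mnorm_continuous continuous_intros)
  have y: "y \<in> ?V" using j(2) r1(1) by simp
  have ip: "ipartial ks blend y = seval (foldr sderiv ks (local_blend j)) y" for ks
    using ipartial_eq_seval[OF V, of blend "local_blend j" y ks] blend_local[OF j(1)] y by auto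
  have b: "\<bar>seval (sderiv i (corr j)) y\<bar> \<le> ?C" "\<bar>seval (sderiv i (sderiv k (corr j))) y\<bar> \<le> ?C / \<delta>" for i k
    using scaled_bound_corr[OF assms] \<delta>(1) by (auto simp: scaled_bound_def power2_eq_square)
  show g: "grad blend y = (\<chi> i. seval (sderiv i (local_blend j)) y)"
    unfolding grad_def by (simp only: ip foldr.simps comp_def id_def)
  have gi: "\<bar>grad blend y $ i\<bar> \<le> 1 + ?C" for i
  proof -
    have "seval (sderiv i (local_blend j)) y = - unit_subgrad j $ i + seval (sderiv i (corr j)) y"
      by (simp add: local_blend_def support_aff_def)
    moreover have "\<bar>unit_subgrad j $ i\<bar> \<le> 1" using component_le_norm_cart[of "unit_subgrad j" i] by (simp add: unit_subgrad)
    ultimately show ?thesis using b(1)[of i] by (simp add: g)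
  qed
  have "norm (grad blend y) \<le> (\<Sum>i\<in>UNIV. \<bar>grad blend y $ i\<bar>)" by (rule norm_le_l1_cart)
  also have "\<dots> \<le> (\<Sum>i\<in>(UNIV::'n set). 1 + ?C)" by (intro sum_mono gi)
  finally show "norm (grad blend y) \<le> real CARD('n) * (1 + ?C)" by simp
  have "\<bar>hessian blend y $ i $ k\<bar> \<le> ?C / \<delta>" for i k
  proof -
    have "hessian blend y $ i $ k = seval (sderiv i (sderiv k (corr j))) y"
      unfolding hessian_def by (simp only: ip vec_lambda_beta foldr.simps comp_def id_def) (simp add: local_blend_def support_aff_def)
    then show ?thesis using b(2) by simp
  qed
  then show "hess_norm blend y \<le> real CARD('n) * real CARD('n) * (?C / \<delta>)"
    unfolding hess_norm_def by (rule onorm_le_matrix_component)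
qed

lemma code_size_quad: "code_size (translate (quad x)) = quad_size CARD('n)"
  by (simp add: quad_def code_size_translate_ssum coord_def code_size_translate_SAff comp_def sum_list_triv length_univ_list quad_size_def del: translate.simps(2))
    (simp add: algebra_simps)

lemma code_size_local_blend:
  assumes "card (neighbours j) \<le> m"
  shows "code_size (translate (local_blend j)) \<le> leaf_size CARD('n) m"
proof -
  let ?w = "9 * (quad_size CARD('n) + 4) + 24" and ?L = "list_of (neighbours j)"
  have w: "code_size (translate (weight x)) = ?w" for x
    unfolding weight_def code_size_translate_SBump by (simp add: code_size_quad)
  have l: "length ?L \<le> m" using assms by (simp add: length_list_of finite_neighbours)
  have aff: "code_size (translate (support_aff x)) = 4 * CARD('n) + 1" "code_size (translate (support_diff x j)) = 4 * CARD('n) + 1" for x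
    unfolding support_aff_def support_diff_def by (rule code_size_translate_SAff)+
  have A: "code_size (translate (ssum (map (\<lambda>x. SMul (weight x) (support_diff x j)) ?L))) = length ?L * (?w + 4 * CARD('n) + 2) + length ?L + 1"
    unfolding code_size_translate_ssum by (simp add: comp_def w aff sum_list_triv)
  have B: "code_size (translate (ssum (map weight ?L))) = length ?L * ?w + length ?L + 1"
    unfolding code_size_translate_ssum by (simp add: comp_def w sum_list_triv)
  have "code_size (translate (local_blend j)) = (4 * CARD('n) + 1) + code_size (translate (ssum (map (\<lambda>x. SMul (weight x) (support_diff x j)) ?L)))
      + code_size (translate (ssum (map weight ?L))) + 4"
    by (simp add: local_blend_def corr_def aff)
  also have "\<dots> = (4 * CARD('n) + 1) + (length ?L * (?w + 4 * CARD('n) + 2) + length ?L + 1) + (length ?L * ?w + length ?L + 1) + 4"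
    by (simp only: A B)
  also have "\<dots> \<le> (4 * CARD('n) + 1) + (m * (?w + 4 * CARD('n) + 2) + m + 1) + (m * ?w + m + 1) + 4"
    using l by (intro add_mono mult_right_mono) auto
  also have "\<dots> = leaf_size CARD('n) m" by (simp add: leaf_size_def Let_def algebra_simps)
  finally show ?thesis .
qed

definition test :: "real^'n \<Rightarrow> 'n cexpr" where
  "test x = translate (SAdd (quad x) (SC (- (r1\<^sup>2))))"

lemma test_iff: "ceval (test x) y \<le> 0 \<longleftrightarrow> mnorm \<delta> x (y - x) \<le> r1"
proof -
  have "ceval (test x) y \<le> 0 \<longleftrightarrow> (mnorm \<delta> x (y - x))\<^sup>2 \<le> r1\<^sup>2"
    unfolding test_def ceval_translate by (simp add: seval_quad)
  also have "\<dots> \<longleftrightarrow> mnorm \<delta> x (y - x) \<le> r1"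
    using r1(1) abs_le_square_iff[of "mnorm \<delta> x (y - x)" r1] by auto
  finally show ?thesis .
qed

lemma code_size_test: "code_size (test x) = quad_size CARD('n) + 2"
  by (simp add: test_def code_size_quad)

lemma smooth_blend: "smooth_on blend (\<Union>j\<in>X. {z. mnorm \<delta> j (z - j) < 2 * r1})"
proof (rule smooth_on_locally_seval)
  have V: "open {z. mnorm \<delta> j (z - j) < 2 * r1}" for j
    by (intro open_Collect_less mnorm_continuous continuous_intros)
  then show "open (\<Union>j\<in>X. {z. mnorm \<delta> j (z - j) < 2 * r1})" by blast
  fix x assume "x \<in> (\<Union>j\<in>X. {z. mnorm \<delta> j (z - j) < 2 * r1})"
  then obtain j where j: "j \<in> X" "mnorm \<delta> j (x - j) < 2 * r1" by auto
  show "\<exists>V e. open V \<and> x \<in> V \<and> (\<forall>y\<in>V. blend y = seval e y \<and> swf e y)"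
    by (rule exI[of _ "{z. mnorm \<delta> j (z - j) < 2 * r1}"], rule exI[of _ "local_blend j"])
       (use V blend_local[OF j(1)] j in auto)
qed

text \<open>The coarse count with both levels equal, at radius 2 * r1.\<close>

lemma card_neighbours_le: "real (card (neighbours j)) \<le> (1 + 4352 * dm ^ 5) ^ CARD('n)"
proof -
  have "2 * r1 / (1 / (512 * dm ^ 3)) = 8 * dm"
    using dm_ge_1 by (simp add: r1_def eval_nat_numeral)
  then have e: "544 * dm ^ 4 * (2 * r1 / (1 / (512 * dm ^ 3))) = 4352 * dm ^ 5"
    by (simp add: eval_nat_numeral)
  show ?thesis
    using card_coarse_meeting_le[OF \<delta>(1) order_refl, of "2 * r1" "1 / (512 * dm ^ 3)" X j] X dm_ge_1 r1
    unfolding e neighbours_def by simp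
qed

lemma blend_package:
  assumes m: "(1 + 4352 * dm ^ 5) ^ CARD('n) \<le> real m"
    and s: "s = leaf_size CARD('n) m + CARD('n) * (20 * (leaf_size CARD('n) m)\<^sup>2) + 1"
  shows "\<exists>f U lf. \<Omega> \<subseteq> U \<and> smooth_on f U \<and> (\<forall>x\<in>\<Omega>. - \<phi> x \<le> f x \<and> f x \<le> - \<phi> x + \<delta>)
     \<and> (\<forall>j\<in>X. \<forall>x rs. mnorm \<delta> j (x - j) \<le> r1 \<longrightarrow> ct_eval (lf j (length rs)) x rs = (f x, grad f x))
     \<and> (\<forall>j\<in>X. \<forall>n. ct_depth (lf j n) \<le> s \<and> ct_size (lf j n) \<le> s)
     \<and> (\<forall>x\<in>\<Omega>. norm (grad f x) \<le> real CARD('n) * (1 + deriv_const dm m)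
          \<and> hess_norm f x \<le> real CARD('n) * real CARD('n) * (deriv_const dm m / \<delta>))"
proof (intro exI conjI ballI allI impI)
  have nm: "real (card (neighbours j)) \<le> real m" for j using card_neighbours_le[of j] m by linarith
  have cov: "\<exists>j\<in>X. mnorm \<delta> j (x - j) \<le> r1" if "x \<in> \<Omega>" for x using cover[OF that] by (simp add: r1_def)
  have lt: "mnorm \<delta> j (x - j) \<le> r1 \<Longrightarrow> mnorm \<delta> j (x - j) < 2 * r1" for j x using r1(1) by linarith
  show "\<Omega> \<subseteq> (\<Union>j\<in>X. {z. mnorm \<delta> j (z - j) < 2 * r1})" using cov lt by blast
  show "smooth_on blend (\<Union>j\<in>X. {z. mnorm \<delta> j (z - j) < 2 * r1})" by (rule smooth_blend)
  show "- \<phi> x \<le> blend x" "blend x \<le> - \<phi> x + \<delta>" if "x \<in> \<Omega>" for x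
    using cov[OF that] lt blend_bounds by blast+
  show "ct_eval (leaf_tree (local_blend j) (length rs)) x rs = (blend x, grad blend x)"
    if "j \<in> X" "mnorm \<delta> j (x - j) \<le> r1" for j x rs
    using leaf_tree_correct[of "local_blend j" rs x] blend_local(1)[OF that(1) lt[OF that(2)]]
      blend_derivatives(3)[OF that nm] by simp
  have "code_size (translate (local_blend j)) \<le> leaf_size CARD('n) m" for j
    by (rule code_size_local_blend) (use nm in simp)
  from leaf_tree_size[OF this] show "ct_depth (leaf_tree (local_blend j) n) \<le> s" "ct_size (leaf_tree (local_blend j) n) \<le> s" for j n
    by (simp_all add: s)
  show "norm (grad blend x) \<le> real CARD('n) * (1 + deriv_const dm m)"
    "hess_norm blend x \<le> real CARD('n) * real CARD('n) * (deriv_const dm m / \<delta>)" if "x \<in> \<Omega>" for x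
    using cov[OF that] blend_derivatives(1,2)[OF _ _ nm] by blast+
qed

end

section \<open>The search structure\<close>

lemma le_nat_ceiling: "real c \<le> r \<Longrightarrow> c \<le> nat \<lceil>r\<rceil>"
  by linarith

lemma halfspace_inter_closed_convex: "closed (halfspace_inter n a b)" "convex (halfspace_inter n a b)"
proof -
  have "halfspace_inter n a b = (\<Inter>i\<in>{..<n}. {x. a i \<bullet> x \<le> b i})" by (auto simp: halfspace_inter_def)
  then show "closed (halfspace_inter n a b)" "convex (halfspace_inter n a b)"
    by (auto intro!: closed_INT convex_INT simp: closed_halfspace_le convex_halfspace_le)
qed

text \<open>It bounds both the neighbours in a net and the in-degree. The former has ratio 8d of
  radius to separation, whence 544 * 8 = 4352; the latter has ratio 4d and stays below.\<close>

definition mult_const :: "nat \<Rightarrow> nat" where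
  "mult_const d = nat \<lceil>(1 + 4352 * real d ^ 5) ^ d\<rceil>"

definition base :: "nat \<Rightarrow> real" where
  "base d = real (mult_const d) ^ 8"

text \<open>The maximum covers the root, which tests all of level 0, and the inner nodes, which test
  at most the out-degree for level ratio \<open>base\<close>.\<close>

definition branch_const :: "'n::finite itself \<Rightarrow> nat" where
  "branch_const T = nat \<lceil>max (count_const T (1 / (512 * real CARD('n) ^ 3)))
     ((1 + 544 * real CARD('n) ^ 6 * base CARD('n) * (4 * real CARD('n))) ^ CARD('n))\<rceil>"

definition leaf_const :: "nat \<Rightarrow> nat" where
  "leaf_const d = leaf_size d (mult_const d) + d * (20 * (leaf_size d (mult_const d))\<^sup>2) + 1"

definition node_const :: "'n::finite itself \<Rightarrow> nat" where
  "node_const T = branch_const T * (quad_size CARD('n) + 2 + 1)"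

lemma mult_const: 
  assumes "1 \<le> d"
  shows "(1 + 4352 * real d ^ 5) ^ d \<le> real (mult_const d)" "2 \<le> mult_const d" "2 \<le> base d" "0 < base d"
proof -
  show 1: "(1 + 4352 * real d ^ 5) ^ d \<le> real (mult_const d)"
    unfolding mult_const_def by linarith
  have "1 \<le> real d ^ 5" using assms by (intro one_le_power) simp
  then have "2 \<le> 1 + 4352 * real d ^ 5" by linarith
  then have "(2::real) ^ d \<le> (1 + 4352 * real d ^ 5) ^ d" by (rule power_mono) simp
  moreover have "2 ^ 1 \<le> (2 :: real) ^ d" using assms by (rule power_increasing) simp
  ultimately have "2 \<le> real (mult_const d)" using 1 unfolding power_one_right by linarith
  then show 2: "2 \<le> mult_const d" by simp
  have "(2::real) ^ 8 \<le> base d" unfolding base_def using 2 by (intro power_mono) auto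
  then show "2 \<le> base d" "0 < base d" by simp_all
qed

lemma geometric_sum_le:
  fixes \<beta> :: real
  assumes "2 \<le> \<beta>"
  shows "(\<Sum>i\<le>K. \<beta> ^ i) \<le> 2 * \<beta> ^ K"
proof (induction K)
  case (Suc K)
  have "2 * \<beta> ^ K \<le> \<beta> * \<beta> ^ K" using assms by (intro mult_right_mono) auto
  then show ?case using Suc by simp
qed simp

context signed_dist begin

lemma approximation_structure:
  assumes e: "0 < \<epsilon>" "\<epsilon> \<le> 1/2"
  shows "\<exists>f U T. \<Omega> \<subseteq> U \<and> smooth_on f U \<and> (\<forall>x\<in>\<Omega>. - \<phi> x \<le> f x \<and> f x \<le> - \<phi> x + \<epsilon>)
     \<and> (\<forall>x\<in>\<Omega>. query T x = (f x, grad f x))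
     \<and> real (ct_depth T) \<le> (real (node_const TYPE('n)) * 3 + leaf_const CARD('n)) / ln 2 * ln (1 / \<epsilon>)
     \<and> real (ct_size T) \<le> real (1 + node_const TYPE('n) + leaf_const CARD('n)) *
         (1 + 2 * \<bar>count_const TYPE('n) (1 / (512 * real CARD('n) ^ 3))\<bar> * base CARD('n) powr (real CARD('n) / 2))
         * (1 / \<epsilon>) powr (real CARD('n) / 2)
     \<and> (\<forall>x\<in>\<Omega>. norm (grad f x) \<le> real CARD('n) * (1 + deriv_const (real CARD('n)) (mult_const CARD('n)))
         \<and> hess_norm f x \<le> real CARD('n) * real CARD('n) * \<bar>deriv_const (real CARD('n)) (mult_const CARD('n))\<bar> * base CARD('n) / \<epsilon>)"
proof -
  let ?n = "CARD('n)"
  let ?m = "mult_const ?n" and ?s = "leaf_const ?n" and ?b = "branch_const TYPE('n)" and ?c = "quad_size ?n + 2"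
  define B where "B = base ?n"
  define \<rho> where "\<rho> = 1 / (512 * dm ^ 3)"
  define r where "r = 1 / (128 * dm\<^sup>2)"
  have n1: "1 \<le> ?n" by (simp add: Suc_leI)
  have B: "2 \<le> B" "0 < B" using mult_const[OF n1] by (auto simp: B_def)
  have m2: "2 \<le> ?m" using mult_const[OF n1] by auto
  have dp: "0 < dm" using dm_ge_1 by simp
  have d3: "1 \<le> dm ^ 3" using dm_ge_1 by (rule one_le_power)
  have rho: "0 < \<rho>" "\<rho> \<le> 1/8" using dp d3 by (auto simp: \<rho>_def divide_le_eq)
  have rr: "4 * dm * \<rho> = r" "r / \<rho> = 4 * dm" using dp by (auto simp: \<rho>_def r_def eval_nat_numeral field_simps)
  have "1 \<le> dm" by (rule dm_ge_1)
  then have r8: "0 \<le> r" "dm * r \<le> 1/8" using dp by (auto simp: r_def power2_eq_square field_simps)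
  define \<delta> where "\<delta> k = 1 / B ^ k" for k
  have \<delta>: "0 < \<delta> k" "\<delta> k \<le> 1" for k using B by (auto simp: \<delta>_def divide_le_eq intro: one_le_power)
  have \<delta>S: "\<delta> (Suc k) \<le> \<delta> k" "\<delta> k / \<delta> (Suc k) = B" for k
    using B by (auto simp: \<delta>_def field_simps)
  have "\<exists>X. \<forall>k. finite (X k) \<and> X k \<subseteq> \<Omega> \<and> separated (\<delta> k) \<rho> (X k) \<and> (\<forall>z\<in>\<Omega>. \<exists>x\<in>X k. mnorm (\<delta> k) x (z - x) \<le> r)"
    using net_exists[OF \<delta> rho] unfolding rr by (intro choice allI)
  then obtain X where X: "\<And>k. finite (X k)" "\<And>k. X k \<subseteq> \<Omega>" "\<And>k. separated (\<delta> k) \<rho> (X k)"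
    "\<And>k z. z \<in> \<Omega> \<Longrightarrow> \<exists>x\<in>X k. mnorm (\<delta> k) x (z - x) \<le> r" by blast
  have NL: "net_level \<phi> \<Omega> x0 dm (\<delta> k) (X k)" for k
    using X(1,2) X(3)[of k] X(4)[of _ k] \<delta>[of k]
    by unfold_locales (auto simp: \<rho>_def r_def)
  have r1: "net_level.r1 dm = r" using net_level.r1_def[OF NL] by (simp add: r_def)
  have "\<exists>te :: nat \<Rightarrow> real^'n \<Rightarrow> 'n cexpr. \<forall>k. (\<forall>y x. ceval (te k y) x \<le> 0 \<longleftrightarrow> mnorm (\<delta> k) y (x - y) \<le> r) \<and> (\<forall>y. code_size (te k y) = ?c)"
    using net_level.test_iff[OF NL] net_level.code_size_test[OF NL] unfolding r1 by (intro choice allI exI conjI)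
  then obtain te :: "nat \<Rightarrow> real^'n \<Rightarrow> 'n cexpr" where te: "\<And>k y x. ceval (te k y) x \<le> 0 \<longleftrightarrow> mnorm (\<delta> k) y (x - y) \<le> r"
    "\<And>k y. code_size (te k y) = ?c" by blast
  have count: "real (card (X k)) \<le> \<bar>count_const TYPE('n) \<rho>\<bar> * \<delta> k powr (1/8 - real ?n / 2)" for k
  proof -
    have "real (card (X k)) \<le> count_const TYPE('n) \<rho> * \<delta> k powr (1/8 - real ?n / 2)"
      using rho by (intro card_separated_points_le \<delta> X) auto
    also have "\<dots> \<le> \<bar>count_const TYPE('n) \<rho>\<bar> * \<delta> k powr (1/8 - real ?n / 2)" by (intro mult_right_mono) auto
    finally show ?thesis .
  qed
  \<comment> \<open>The first level with \<delta> K \<le> \<epsilon>. Rounding up costs at most one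
    factor B in the storage and in the Hessian bound.\<close>
  define K where "K = nat \<lceil>ln (1/\<epsilon>) / ln B\<rceil>"
  have lnB: "ln 2 \<le> ln B" "0 < ln B" using B by auto
  have "2 \<le> 1/\<epsilon>" using e by (simp add: field_simps)
  then have L1: "ln 2 \<le> ln (1/\<epsilon>)" using e by (subst ln_le_cancel_iff) auto
  moreover have "0 < ln (2::real)" by simp
  ultimately have L: "ln 2 \<le> ln (1/\<epsilon>)" "0 < ln (1/\<epsilon>)" by linarith+
  have Kge: "ln (1/\<epsilon>) / ln B \<le> real K" "real K \<le> ln (1/\<epsilon>) / ln B + 1"
    using divide_pos_pos[OF L(2) lnB(2)] unfolding K_def by linarith+
  have lnBK: "ln (B ^ K) = real K * ln B" using B by (simp add: ln_realpow)
  have "ln (1/\<epsilon>) \<le> ln (B ^ K)" using Kge(1) lnB by (simp add: lnBK pos_divide_le_eq)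
  then have K1: "1/\<epsilon> \<le> B ^ K" using e B by simp
  have "real K * ln B \<le> (ln (1/\<epsilon>) / ln B + 1) * ln B" using Kge(2) lnB by (intro mult_right_mono) auto
  also have "\<dots> = ln (B / \<epsilon>)" using lnB e B by (simp add: ln_div field_simps)
  finally have "ln (B ^ K) \<le> ln (B / \<epsilon>)" by (simp add: lnBK)
  then have K2: "B ^ K \<le> B / \<epsilon>" using e B by simp
  have \<delta>K: "\<delta> K \<le> \<epsilon>" "1 / \<delta> K \<le> B / \<epsilon>" using K1 K2 e B by (auto simp: \<delta>_def field_simps)
  have m: "(1 + 4352 * dm ^ 5) ^ ?n \<le> real ?m" using mult_const(1)[OF n1] by (simp add: dm_eq)
  from net_level.blend_package[OF NL[of K] m leaf_const_def, unfolded r1] obtain f U lf where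
    f: "\<Omega> \<subseteq> U" "smooth_on f U" "\<forall>x\<in>\<Omega>. - \<phi> x \<le> f x \<and> f x \<le> - \<phi> x + \<delta> K"
    "\<forall>j\<in>X K. \<forall>x rs. mnorm (\<delta> K) j (x - j) \<le> r \<longrightarrow> ct_eval (lf j (length rs)) x rs = (f x, grad f x)"
    "\<forall>j\<in>X K. \<forall>n. ct_depth (lf j n) \<le> ?s \<and> ct_size (lf j n) \<le> ?s"
    "\<forall>x\<in>\<Omega>. norm (grad f x) \<le> real ?n * (1 + deriv_const dm ?m)
          \<and> hess_norm f x \<le> real ?n * real ?n * (deriv_const dm ?m / \<delta> K)"
    by (elim exE conjE) (rule that; assumption)
  have "\<exists>T. (\<forall>x\<in>\<Omega>. query T x = (f x, grad f x)) \<and>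
     ct_depth T \<le> (K + 1) * (?b * (?c + 1)) + ?s \<and>
     ct_size T \<le> (1 + ?b * (?c + 1) + ?s) * (1 + (\<Sum>i\<le>K. ?m ^ i * card (X i)))"
  proof (rule layered_search_tree)
    show "finite (X k)" for k by (rule X)
    show "\<exists>y\<in>X k. ceval (te k y) x \<le> 0" if "x \<in> \<Omega>" for x k using X(4)[OF that] by (simp add: te)
    show "ct_eval (lf y (length rs)) x rs = (f x, grad f x)" if "x \<in> \<Omega>" "y \<in> X K" "ceval (te K y) x \<le> 0" for x y rs
      using bspec[OF f(4) that(2)] that(3) unfolding te by blast
    show "code_size (te k y) \<le> ?c" for k y by (simp add: te)
    show "ct_depth (lf y n) \<le> ?s \<and> ct_size (lf y n) \<le> ?s" if "y \<in> X K" for y n using bspec[OF f(5) that] by blast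
    \<comment> \<open>At level 0 the power of \<delta> equals 1, so the number of roots is a
      constant.\<close>
    have "real (card (X 0)) \<le> count_const TYPE('n) \<rho> * \<delta> 0 powr (1/8 - real ?n / 2)"
      using rho by (intro card_separated_points_le \<delta> X) auto
    then have "real (card (X 0)) \<le> count_const TYPE('n) \<rho>" by (simp add: \<delta>_def)
    then have "real (card (X 0)) \<le> max (count_const TYPE('n) (1 / (512 * real ?n ^ 3)))
      ((1 + 544 * real ?n ^ 6 * base ?n * (4 * real ?n)) ^ ?n)"
      unfolding \<rho>_def dm_eq by (rule max.coboundedI1)
    then show "card (X 0) \<le> ?b" unfolding branch_const_def by (rule le_nat_ceiling)
    show "card {z \<in> X (Suc k). linked te \<Omega> k y z} \<le> ?b" for k y
    proof -
      have "card {z \<in> X (Suc k). linked te \<Omega> k y z} \<le>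
         card {z \<in> X (Suc k). \<exists>w. mnorm (\<delta> k) y (w - y) \<le> r \<and> mnorm (\<delta> (Suc k)) z (w - z) \<le> r}"
        using X(1)[of "Suc k"] by (intro card_mono) (auto simp: linked_def te)
      then have "real (card {z \<in> X (Suc k). linked te \<Omega> k y z}) \<le> (1 + 544 * dm ^ 6 * (\<delta> k / \<delta> (Suc k)) * (r / \<rho>)) ^ ?n"
        using card_fine_meeting_le[OF \<delta>(1) \<delta>S(1) r8 rho(1) X(1) X(3), of k y] by linarith
      then have "real (card {z \<in> X (Suc k). linked te \<Omega> k y z}) \<le> (1 + 544 * real ?n ^ 6 * base ?n * (4 * real ?n)) ^ ?n"
        unfolding \<delta>S rr B_def dm_eq .
      then show ?thesis unfolding branch_const_def by (intro le_nat_ceiling max.coboundedI2)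
    qed
    show "card {y \<in> X k. linked te \<Omega> k y z} \<le> ?m" for k z
    proof -
      have "card {y \<in> X k. linked te \<Omega> k y z} \<le>
         card {y \<in> X k. \<exists>w. mnorm (\<delta> k) y (w - y) \<le> r \<and> mnorm (\<delta> (Suc k)) z (w - z) \<le> r}"
        using X(1)[of k] by (intro card_mono) (auto simp: linked_def te)
      then have "real (card {y \<in> X k. linked te \<Omega> k y z}) \<le> (1 + 544 * dm ^ 4 * (r / \<rho>)) ^ ?n"
        using card_coarse_meeting_le[OF \<delta>(1) \<delta>S(1) r8 rho(1) X(1) X(3), of k z] by linarith
      also have "\<dots> \<le> (1 + 4352 * dm ^ 5) ^ ?n"
        unfolding rr using dp by (intro power_mono) (auto simp: eval_nat_numeral)
      also have "\<dots> \<le> real ?m" using mult_const(1)[OF n1] by (simp add: dm_eq)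
      finally show ?thesis by simp
    qed
  qed
  then obtain T where T: "\<forall>x\<in>\<Omega>. query T x = (f x, grad f x)"
     "ct_depth T \<le> (K + 1) * (?b * (?c + 1)) + ?s"
     "ct_size T \<le> (1 + ?b * (?c + 1) + ?s) * (1 + (\<Sum>i\<le>K. ?m ^ i * card (X i)))" by blast
  have nc: "?b * (?c + 1) = node_const TYPE('n)" by (simp add: node_const_def)
  have depth: "real (ct_depth T) \<le> (real (node_const TYPE('n)) * 3 + ?s) / ln 2 * ln (1 / \<epsilon>)"
  proof -
    \<comment> \<open>Since \<epsilon> \<le> 1/2, every additive constant is absorbed into the
      logarithm; rounding K and the extra root level give the factor 3.\<close>
    have "1 \<le> ln (1/\<epsilon>) / ln 2" using L by (simp add: le_divide_eq)
    moreover have "ln (1/\<epsilon>) / ln B \<le> ln (1/\<epsilon>) / ln 2" using L lnB by (intro divide_left_mono) auto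
    ultimately have K3: "real (K + 1) \<le> 3 * (ln (1/\<epsilon>) / ln 2)"
      using Kge(2) unfolding of_nat_add of_nat_1 by linarith
    have "real (ct_depth T) \<le> real ((K + 1) * node_const TYPE('n) + ?s)" using T(2) unfolding nc by (rule of_nat_mono)
    also have "\<dots> = real (K + 1) * real (node_const TYPE('n)) + real ?s * 1"
      by (simp only: of_nat_add of_nat_mult mult_1_right)
    also have "\<dots> \<le> 3 * (ln (1/\<epsilon>) / ln 2) * real (node_const TYPE('n)) + real ?s * (ln (1/\<epsilon>) / ln 2)"
      using K3 \<open>1 \<le> ln (1/\<epsilon>) / ln 2\<close> by (intro add_mono mult_right_mono mult_left_mono) auto
    finally show ?thesis by (simp add: field_simps)
  qed
  have size: "real (ct_size T) \<le> real (1 + node_const TYPE('n) + ?s) *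
         (1 + 2 * \<bar>count_const TYPE('n) \<rho>\<bar> * B powr (real ?n / 2)) * (1 / \<epsilon>) powr (real ?n / 2)"
  proof -
    let ?Cc = "\<bar>count_const TYPE('n) \<rho>\<bar>"
    define \<beta> where "\<beta> = B powr (real ?n / 2)"
    have m8: "real ?m = B powr (1/8)"
    proof -
      have "B powr (1/8) = (real ?m powr real 8) powr (1/8)"
        unfolding B_def base_def using m2 by (subst powr_realpow) auto
      also have "\<dots> = real ?m" unfolding powr_powr using m2 by simp
      finally show ?thesis ..
    qed
    \<comment> \<open>With ratio at least 2 the geometric sum over the levels is dominated by its
      last term.\<close>
    have b2: "2 \<le> \<beta>"
    proof -
      have "(2::real) \<le> real ?m ^ 4"
      proof -
        have "real ?m \<le> real ?m ^ 4" using m2 by (intro self_le_power) auto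
        then show ?thesis using m2 by linarith
      qed
      also have "real ?m ^ 4 = B powr (1/2)"
      proof -
        have "real ?m ^ 4 = real ?m powr real 4" using m2 by (subst powr_realpow) auto
        also have "\<dots> = B powr (1/2)" unfolding m8 by (simp add: powr_powr)
        finally show ?thesis .
      qed
      also have "\<dots> \<le> \<beta>" unfolding \<beta>_def using B n1 by (intro powr_mono) auto
      finally show ?thesis .
    qed
    \<comment> \<open>The purpose of B = m^8: the m^i copies amount to B^(i/8), which is cancelled
      exactly by the gain \<delta>^(1/8) in the count. What remains is B^(d/2) per level.\<close>
    have lev: "real (?m ^ i * card (X i)) \<le> ?Cc * \<beta> ^ i" for i
    proof -
      have di: "\<delta> i = B powr (- real i)" using B by (simp add: \<delta>_def powr_minus powr_realpow inverse_eq_divide)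
      have "real (?m ^ i * card (X i)) \<le> (B powr (1/8)) ^ i * (?Cc * \<delta> i powr (1/8 - real ?n / 2))"
        using count[of i] by (simp add: m8[symmetric] mult_left_mono)
      also have "(B powr (1/8)) ^ i = B powr (real i / 8)" using B by (simp add: powr_realpow[symmetric] powr_powr)
      also have "\<delta> i powr (1/8 - real ?n / 2) = B powr (- real i * (1/8 - real ?n / 2))"
        by (simp add: di powr_powr)
      also have "B powr (real i / 8) * (?Cc * B powr (- real i * (1/8 - real ?n / 2)))
         = ?Cc * (B powr (real i / 8) * B powr (- real i * (1/8 - real ?n / 2)))" by (simp only: mult_ac)
      also have "B powr (real i / 8) * B powr (- real i * (1/8 - real ?n / 2)) = B powr (real ?n / 2 * real i)"
        by (simp add: powr_add[symmetric] algebra_simps)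
      also have "\<dots> = \<beta> ^ i" using B by (simp add: \<beta>_def powr_realpow[symmetric] powr_powr)
      finally show ?thesis .
    qed
    have "real (\<Sum>i\<le>K. ?m ^ i * card (X i)) = (\<Sum>i\<le>K. real (?m ^ i * card (X i)))" by (rule of_nat_sum)
    also have "\<dots> \<le> (\<Sum>i\<le>K. ?Cc * \<beta> ^ i)" by (intro sum_mono lev)
    also have "\<dots> = ?Cc * (\<Sum>i\<le>K. \<beta> ^ i)" by (simp add: sum_distrib_left)
    also have "\<dots> \<le> ?Cc * (2 * \<beta> ^ K)" by (intro mult_left_mono geometric_sum_le b2) auto
    also have "\<beta> ^ K \<le> \<beta> * (1/\<epsilon>) powr (real ?n / 2)"
    proof -
      have "\<beta> ^ K = (B ^ K) powr (real ?n / 2)" using B by (simp add: \<beta>_def powr_realpow[symmetric] powr_powr mult.commute)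
      also have "\<dots> \<le> (B * (1/\<epsilon>)) powr (real ?n / 2)" using K2 B by (intro powr_mono2) auto
      also have "\<dots> = \<beta> * (1/\<epsilon>) powr (real ?n / 2)" using B e by (subst powr_mult) (auto simp: \<beta>_def)
      finally show ?thesis .
    qed
    finally have S: "real (\<Sum>i\<le>K. ?m ^ i * card (X i)) \<le> ?Cc * (2 * (\<beta> * (1/\<epsilon>) powr (real ?n / 2)))"
      by (simp add: mult_left_mono)
    have one: "1 \<le> (1/\<epsilon>) powr (real ?n / 2)" using e by (intro ge_one_powr_ge_zero) auto
    have "real (ct_size T) \<le> real ((1 + node_const TYPE('n) + ?s) * (1 + (\<Sum>i\<le>K. ?m ^ i * card (X i))))"
      using T(3) unfolding nc by (rule of_nat_mono)
    also have "\<dots> = real (1 + node_const TYPE('n) + ?s) * (1 + real (\<Sum>i\<le>K. ?m ^ i * card (X i)))"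
      by (simp only: of_nat_mult of_nat_add of_nat_1)
    also have "\<dots> \<le> real (1 + node_const TYPE('n) + ?s) * ((1/\<epsilon>) powr (real ?n / 2) + ?Cc * (2 * (\<beta> * (1/\<epsilon>) powr (real ?n / 2))))"
      using S one by (intro mult_left_mono add_mono) auto
    finally show ?thesis by (simp add: \<beta>_def algebra_simps)
  qed
  have "norm (grad f x) \<le> real ?n * (1 + deriv_const (real ?n) ?m) \<and>
      hess_norm f x \<le> real ?n * real ?n * \<bar>deriv_const (real ?n) ?m\<bar> * base ?n / \<epsilon>" if x: "x \<in> \<Omega>" for x
  proof
    show "norm (grad f x) \<le> real ?n * (1 + deriv_const (real ?n) ?m)" using bspec[OF f(6) x] by (simp add: dm_eq)
    have "hess_norm f x \<le> real ?n * real ?n * (deriv_const dm ?m * (1 / \<delta> K))" using bspec[OF f(6) x] by simp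
    also have "\<dots> \<le> real ?n * real ?n * (\<bar>deriv_const dm ?m\<bar> * (B / \<epsilon>))"
      using \<delta>K(2) \<delta>(1)[of K] by (intro mult_left_mono mult_mono) auto
    finally show "hess_norm f x \<le> real ?n * real ?n * \<bar>deriv_const (real ?n) ?m\<bar> * base ?n / \<epsilon>"
      by (simp add: B_def dm_eq)
  qed
  moreover have "- \<phi> x \<le> f x \<and> f x \<le> - \<phi> x + \<epsilon>" if "x \<in> \<Omega>" for x
    using bspec[OF f(3) that] \<delta>K(1) by linarith
  ultimately show ?thesis using f(1,2) T(1) depth size unfolding \<rho>_def B_def dm_eq by blast
qed

end

theorem theorem2:
  fixes dummy :: "real^'n"
  shows "\<exists>C>0. \<forall>(n::nat) (a :: nat \<Rightarrow> real^'n) (b :: nat \<Rightarrow> real) (\<epsilon>::real).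
     (let \<Omega> = halfspace_inter n a b in
       bounded \<Omega> \<and> interior \<Omega> \<noteq> {} \<and> diameter \<Omega> = 1 \<and> 0 < \<epsilon> \<and> \<epsilon> \<le> 1/2 \<longrightarrow>
       (\<exists>(f :: real^'n \<Rightarrow> real) U (T :: 'n ctree).
          \<Omega> \<subseteq> U \<and> smooth_on f U \<and>
          (\<forall>x\<in>\<Omega>. bdist \<Omega> x \<le> f x \<and> f x \<le> bdist \<Omega> x + \<epsilon> * diameter \<Omega>) \<and>
          (\<forall>x\<in>\<Omega>. query T x = (f x, grad f x)) \<and>
          real (ct_depth T) \<le> C * ln (1/\<epsilon>) \<and>
          real (ct_size T) \<le> C * (1/\<epsilon>) powr (real CARD('n) / 2) \<and>
          (\<forall>x\<in>\<Omega>. norm (grad f x) \<le> C \<and> hess_norm f x \<le> C / \<epsilon>)))"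
proof -
  let ?d = "CARD('n)"
  define C1 where "C1 = (real (node_const TYPE('n)) * 3 + leaf_const ?d) / ln 2"
  define C2 where "C2 = real (1 + node_const TYPE('n) + leaf_const ?d) *
     (1 + 2 * \<bar>count_const TYPE('n) (1 / (512 * real ?d ^ 3))\<bar> * base ?d powr (real ?d / 2))"
  define C3 where "C3 = real ?d * (1 + deriv_const (real ?d) (mult_const ?d))"
  define C4 where "C4 = real ?d * real ?d * \<bar>deriv_const (real ?d) (mult_const ?d)\<bar> * base ?d"
  \<comment> \<open>The absolute values spare tracking the signs of the constants, all of which
    depend on the dimension only.\<close>
  define C where "C = 1 + \<bar>C1\<bar> + \<bar>C2\<bar> + \<bar>C3\<bar> + \<bar>C4\<bar>"
  have C: "0 < C" "C1 \<le> C" "C2 \<le> C" "C3 \<le> C" "C4 \<le> C" unfolding C_def by linarith+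
  show ?thesis
    unfolding Let_def
  proof (intro exI[of _ C] conjI C(1) allI impI, elim conjE)
    fix n and a :: "nat \<Rightarrow> real^'n" and b and \<epsilon> :: real
    define \<Omega> where "\<Omega> = halfspace_inter n a b"
    assume "bounded (halfspace_inter n a b)" "interior (halfspace_inter n a b) \<noteq> {}"
      "diameter (halfspace_inter n a b) = 1" and e: "0 < \<epsilon>" "\<epsilon> \<le> 1/2"
    then have bnd: "bounded \<Omega>" and int: "interior \<Omega> \<noteq> {}" and diam: "diameter \<Omega> = 1"
      by (simp_all add: \<Omega>_def)
    have cv: "convex \<Omega>" "compact \<Omega>"
      using halfspace_inter_closed_convex[of n a b] bnd by (auto simp: \<Omega>_def compact_eq_bounded_closed)
    obtain x0 where x0: "x0 \<in> \<Omega>" using int interior_subset by blast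
    have d1: "norm (x - y) \<le> 1" if "x \<in> \<Omega>" "y \<in> \<Omega>" for x y
      using diameter_bounded_bound[OF bnd that] diam by (simp add: dist_norm)
    obtain \<phi> :: "real^'n \<Rightarrow> real" where \<phi>: "\<And>x. \<exists>u. norm u = 1 \<and> (\<forall>y. \<phi> x + u \<bullet> (y - x) \<le> \<phi> y)"
      "\<And>x. x \<in> \<Omega> \<Longrightarrow> \<phi> x = - bdist \<Omega> x" "\<And>y. norm (y - x0) - 1 \<le> \<phi> y"
      using signed_distance_exists[OF cv x0 d1 int] by blast
    have bn: "0 \<le> bdist \<Omega> x" for x by (simp add: bdist_def infdist_nonneg)
    interpret signed_dist \<phi> \<Omega> x0 "real CARD('n)"
      by unfold_locales (use \<phi> bn d1 x0 in auto)
    have L: "0 < ln (1/\<epsilon>)" using e by simp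
    from approximation_structure[OF e, folded C1_def C2_def C3_def C4_def] obtain f U T where
      f: "\<Omega> \<subseteq> U" "smooth_on f U" "\<forall>x\<in>\<Omega>. - \<phi> x \<le> f x \<and> f x \<le> - \<phi> x + \<epsilon>"
      "\<forall>x\<in>\<Omega>. query T x = (f x, grad f x)"
      "real (ct_depth T) \<le> C1 * ln (1 / \<epsilon>)" "real (ct_size T) \<le> C2 * (1 / \<epsilon>) powr (real ?d / 2)"
      "\<forall>x\<in>\<Omega>. norm (grad f x) \<le> C3 \<and> hess_norm f x \<le> C4 / \<epsilon>"
      by (elim exE conjE) (rule that; assumption)
    show "\<exists>f U (T :: 'n ctree). halfspace_inter n a b \<subseteq> U \<and> smooth_on f U \<and>
        (\<forall>x\<in>halfspace_inter n a b. bdist (halfspace_inter n a b) x \<le> f x \<and>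
           f x \<le> bdist (halfspace_inter n a b) x + \<epsilon> * diameter (halfspace_inter n a b)) \<and>
        (\<forall>x\<in>halfspace_inter n a b. query T x = (f x, grad f x)) \<and>
        real (ct_depth T) \<le> C * ln (1/\<epsilon>) \<and>
        real (ct_size T) \<le> C * (1/\<epsilon>) powr (real CARD('n) / 2) \<and>
        (\<forall>x\<in>halfspace_inter n a b. norm (grad f x) \<le> C \<and> hess_norm f x \<le> C / \<epsilon>)"
      unfolding \<Omega>_def[symmetric]
    proof (intro exI[of _ f] exI[of _ U] exI[of _ T] conjI ballI)
      show "\<Omega> \<subseteq> U" "smooth_on f U" by (rule f)+
      show "bdist \<Omega> x \<le> f x" "f x \<le> bdist \<Omega> x + \<epsilon> * diameter \<Omega>" if "x \<in> \<Omega>" for x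
        using bspec[OF f(3) that] \<phi>(2)[OF that] diam by auto
      show "query T x = (f x, grad f x)" if "x \<in> \<Omega>" for x by (rule bspec[OF f(4) that])
      show "real (ct_depth T) \<le> C * ln (1/\<epsilon>)"
        using f(5) C(2) L by (meson less_imp_le mult_right_mono order_trans)
      show "real (ct_size T) \<le> C * (1/\<epsilon>) powr (real CARD('n) / 2)"
        using f(6) C(3) by (meson powr_ge_zero mult_right_mono order_trans)
      show "norm (grad f x) \<le> C" if "x \<in> \<Omega>" for x using bspec[OF f(7) that] C(4) by linarith
      show "hess_norm f x \<le> C / \<epsilon>" if "x \<in> \<Omega>" for x
        using bspec[OF f(7) that] divide_right_mono[OF C(5), of \<epsilon>] e(1) by linarith
    qed
  qed
qed

end
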